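(* There exists $c > 0$ such that for all sufficiently large $n \in \mathbb{N}$, $$\Pr\big( \det(M_n) = 0 \big) \le \exp\big( - c \sqrt{n} \big),$$ where $M_n$ denotes a uniformly chosen random symmetric $n \times n$ matrix with entries in $\{-1,1\}$.
   Context: $M_n$ is chosen uniformly at random among all symmetric $n\times n$ matrices with all entries in $\{-1,1\}$ (equivalently, the entries $m_{ij}$ with $i \le j$ are independent uniform signs and $m_{ji}=m_{ij}$). *)

theory Defs
  imports Complex_Main "Jordan_Normal_Form.Determinant"
begin

definition sym_sign_mats :: "nat \<Rightarrow> int mat set" where
  "sym_sign_mats n = {A \<in> carrier_mat n n.
      (\<forall>i<n. \<forall>j<n. A $$ (i,j) \<in> {-1, 1} \<and> A $$ (i,j) = A $$ (j,i))}"

definition prob_singular :: "nat \<Rightarrow> real" where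
  "prob_singular n = real (card {A \<in> sym_sign_mats n. det A = 0}) / real (card (sym_sign_mats n))"

end

theory Submission
  imports Defs "HOL-Library.FuncSet" "HOL-Real_Asymp.Real_Asymp" "HOL-Number_Theory.Cong"
begin

text \<open>
  Work modulo a prime \<open>p = exp (\<Theta> (sqrt n))\<close>. If the matrix \<open>M\<close> is singular, take a maximal nonsingular
  principal submatrix \<open>M\<^sub>J\<close>: its Schur complement vanishes. If \<open>J\<close> is small this determines many entries of
  \<open>M\<close>. If \<open>J\<close> is large it forces \<open>x\<^sup>T M\<^sub>J\<^sup>-\<^sup>1 x = a\<close> for a row \<open>x\<close> independent of \<open>M\<^sub>J\<close>; resampling about
  \<open>sqrt n\<close> coordinates of \<open>x\<close> (Cauchy--Schwarz) makes this linear in the remaining ones, with coefficient vector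
  \<open>v\<close> satisfying \<open>M\<^sub>J v = w\<close> for a nonzero \<open>w\<close> independent of \<open>M\<^sub>J\<close>. So it suffices that with
  high probability no \<open>v\<close> with \<open>M\<^sub>J v\<close> in the line of \<open>w\<close> concentrates more than about \<open>1 / p\<close> modulo \<open>p\<close>.

  This is a union bound over \<open>v\<close>. By an inverse Littlewood--Offord lemma in the spirit of hypergraph
  containers (following Campos, Mattos, Morris and Morrison), a fixed proportion of the coordinates of \<open>v\<close> lie in one of
  \<open>p ^ O(ln p)\<close> sets, whose size times the concentration probability of the other coordinates is
  \<open>O(1 / sqrt (card D))\<close>, where \<open>D\<close> is the support of \<open>v\<close>. Iterating \<open>O(ln n)\<close> times on what remains, the gain
  per coordinate beats the number of choices of the sets.
\<close>

text \<open>Two obstacles shape the argument. Rows of a symmetric matrix are dependent, so the event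
  that M v equals a given vector is handled by adding one index at a time: a new index brings a
  fresh row over the indices D already present and costs a factor \<open>R p D v\<close>. Hence
  gains appear as concentration on a subset, raised to the number of remaining indices. The second
  obstacle is the entropy of the union bound. One round of containers has about p^(16 ln p) choices
  and there are about 4 ln n rounds, against a gain of order exp (- n ln n / 8). The exponents (ln
  p)^2 ln n and n ln n have the same order exactly when ln p is of order sqrt n, which is where the
  rate of the theorem comes from; the constant in ln p \<le> sqrt n / 1000 makes the entropy lose.
  Singularity itself is treated over the integers throughout. Only vectors and their concentration
  are reduced modulo p, and solutions with cleared denominators mediate between the two.\<close>

abbreviation signs :: "'a set \<Rightarrow> ('a \<Rightarrow> int) set" where
  "signs A \<equiv> PiE A (\<lambda>_. {-1, 1})"

section \<open>Averages over independent uniform signs\<close>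

definition avg :: "'a set \<Rightarrow> (('a \<Rightarrow> int) \<Rightarrow> real) \<Rightarrow> real" where
  "avg A f = (\<Sum>x\<in>signs A. f x) / 2 ^ card A"

lemma finite_signs [simp]: "finite A \<Longrightarrow> finite (signs A)"
  by (simp add: finite_PiE)

lemma card_signs: "finite A \<Longrightarrow> card (signs A) = 2 ^ card A"
  by (simp add: card_PiE numeral_2_eq_2)

lemma signsD: "x \<in> signs A \<Longrightarrow> i \<in> A \<Longrightarrow> x i = -1 \<or> x i = 1"
  by (auto dest!: PiE_mem)

lemma avg_mono: "(\<And>x. x \<in> signs A \<Longrightarrow> f x \<le> g x) \<Longrightarrow> avg A f \<le> avg A g"
  unfolding avg_def by (intro divide_right_mono sum_mono) auto

lemma avg_cong: "(\<And>x. x \<in> signs A \<Longrightarrow> f x = g x) \<Longrightarrow> avg A f = avg A g"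
  unfolding avg_def by (auto intro!: arg_cong2[where f="(/)"] sum.cong)

lemma avg_nonneg: "(\<And>x. x \<in> signs A \<Longrightarrow> 0 \<le> f x) \<Longrightarrow> 0 \<le> avg A f"
  unfolding avg_def by (intro divide_nonneg_nonneg sum_nonneg) auto

lemma avg_const [simp]: "finite A \<Longrightarrow> avg A (\<lambda>_. c) = c"
  by (simp add: avg_def card_signs)

lemma avg_add: "avg A (\<lambda>x. f x + g x) = avg A f + avg A g"
  by (simp add: avg_def sum.distrib add_divide_distrib)

lemma avg_cmult: "avg A (\<lambda>x. c * f x) = c * avg A f"
  by (simp add: avg_def sum_distrib_left)

lemma avg_cmult_right: "avg A (\<lambda>x. f x * c) = avg A f * c"
  by (simp add: avg_def sum_distrib_right)

lemma avg_sum: "avg A (\<lambda>x. \<Sum>i\<in>I. f i x) = (\<Sum>i\<in>I. avg A (f i))"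
  unfolding avg_def by (subst sum.swap) (simp add: sum_divide_distrib)

lemma avg_swap: "avg A (\<lambda>x. avg B (\<lambda>y. f x y)) = avg B (\<lambda>y. avg A (\<lambda>x. f x y))"
  unfolding avg_def
  by (simp add: sum_divide_distrib [symmetric] mult.commute) (subst sum.swap, simp)

lemma avg_le_const: "finite A \<Longrightarrow> (\<And>x. x \<in> signs A \<Longrightarrow> f x \<le> c) \<Longrightarrow> avg A f \<le> c"
  using avg_mono[of A f "\<lambda>_. c"] by simp

lemma avg_empty [simp]: "avg {} f = f (\<lambda>_. undefined)"
  by (simp add: avg_def)

lemma avg_union:
  assumes "finite A" "finite B" "A \<inter> B = {}"
  shows "avg (A \<union> B) f = avg A (\<lambda>x. avg B (\<lambda>y. f (override_on y x A)))"
proof -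
  have "(\<Sum>z\<in>signs (A \<union> B). f z) = (\<Sum>(x,y)\<in>signs A \<times> signs B. f (override_on y x A))"
    by (rule sum.reindex_bij_witness[of _ "\<lambda>(x,y). override_on y x A"
          "\<lambda>z. (restrict z A, restrict z B)"])
       ((use assms(3) in \<open>auto simp: override_on_def PiE_iff extensional_def fun_eq_iff intro!: arg_cong[of _ _ f]\<close>), blast+)
  also have "\<dots> = (\<Sum>x\<in>signs A. \<Sum>y\<in>signs B. f (override_on y x A))"
    by (simp add: sum.cartesian_product)
  finally show ?thesis
    unfolding avg_def using assms
    by (simp add: card_Un_disjoint power_add sum_divide_distrib field_simps)
qed

lemma avg_singleton: "avg {a} f = (f ((\<lambda>_. undefined)(a := 1)) + f ((\<lambda>_. undefined)(a := -1))) / 2"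
proof -
  have "signs {a} = {(\<lambda>_. undefined)(a := 1), (\<lambda>_. undefined)(a := -1)}"
    by (auto simp: PiE_insert_eq)
  moreover have "(\<lambda>_. undefined)(a := 1::int) \<noteq> (\<lambda>_. undefined)(a := -1)"
    by (metis fun_upd_eqD one_neq_neg_one)
  ultimately show ?thesis by (simp add: avg_def)
qed

lemma avg_insert:
  assumes "finite A" "a \<notin> A"
  shows "avg (insert a A) f = (avg A (\<lambda>x. f (x(a := 1))) + avg A (\<lambda>x. f (x(a := -1)))) / 2"
proof -
  have "avg (insert a A) f = avg (A \<union> {a}) f" by simp
  also have "\<dots> = avg A (\<lambda>x. avg {a} (\<lambda>y. f (override_on y x A)))"
    using assms by (intro avg_union) auto
  also have "\<dots> = avg A (\<lambda>x. (f (x(a := 1)) + f (x(a := -1))) / 2)"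
  proof (rule avg_cong)
    fix x assume "x \<in> signs A"
    then have "override_on ((\<lambda>_. undefined)(a := c)) x A = x(a := c)" for c
      using assms(2) by (auto simp: override_on_def PiE_iff extensional_def fun_eq_iff)
    then show "avg {a} (\<lambda>y. f (override_on y x A)) = (f (x(a := 1)) + f (x(a := -1))) / 2"
      by (simp add: avg_singleton)
  qed
  finally show ?thesis
    by (simp add: avg_def sum.distrib add_divide_distrib sum_divide_distrib[symmetric])
qed

lemma avg_marginal:
  assumes "finite B" "A \<subseteq> B"
  shows "avg B (\<lambda>x. f (restrict x A)) = avg A f"
proof -
  have "avg B (\<lambda>x. f (restrict x A)) = avg (A \<union> (B - A)) (\<lambda>x. f (restrict x A))"
    using assms by (simp add: Un_absorb1)
  also have "\<dots> = avg A (\<lambda>x. avg (B - A) (\<lambda>y. f (restrict (override_on y x A) A)))"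
    using assms finite_subset by (intro avg_union) auto
  also have "\<dots> = avg A (\<lambda>x. avg (B - A) (\<lambda>y. f x))"
    by (intro avg_cong arg_cong[of _ _ f])
       (auto simp: override_on_def fun_eq_iff PiE_iff extensional_def)
  finally show ?thesis using assms by simp
qed

lemma avg_reindex:
  assumes "inj_on \<phi> D"
  shows "avg (\<phi> ` D) (\<lambda>m. F (restrict (m \<circ> \<phi>) D)) = avg D F"
proof -
  have "(\<Sum>m\<in>signs (\<phi> ` D). F (restrict (m \<circ> \<phi>) D)) = (\<Sum>x\<in>signs D. F x)"
    by (rule sum.reindex_bij_witness[of _ "\<lambda>x. restrict (x \<circ> the_inv_into D \<phi>) (\<phi> ` D)"
          "\<lambda>m. restrict (m \<circ> \<phi>) D"])
       (use assms in \<open>auto simp: PiE_iff extensional_def fun_eq_iff the_inv_into_f_f\<close>)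
  then show ?thesis
    by (simp add: avg_def card_image assms)
qed

lemma avg_power2_le:
  assumes "finite A"
  shows "(avg A f)\<^sup>2 \<le> avg A (\<lambda>x. (f x)\<^sup>2)"
proof -
  have "0 \<le> avg A (\<lambda>x. (f x - avg A f)\<^sup>2)"
    by (rule avg_nonneg) simp
  also have "\<dots> = avg A (\<lambda>x. (f x)\<^sup>2 + ((- 2 * avg A f) * f x + (avg A f)\<^sup>2))"
    by (intro avg_cong) (simp add: power2_eq_square algebra_simps)
  also have "\<dots> = avg A (\<lambda>x. (f x)\<^sup>2) - (avg A f)\<^sup>2"
    unfolding avg_add avg_cmult using assms by (simp add: power2_eq_square)
  finally show ?thesis by simp
qed

lemma avg_of_bool_le_inverse:
  assumes "finite A" "\<And>x y. x \<in> signs A \<Longrightarrow> y \<in> signs A \<Longrightarrow> P x \<Longrightarrow> P y \<Longrightarrow> x = y"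
  shows "avg A (\<lambda>x. of_bool (P x)) \<le> 1 / 2 ^ card A"
proof -
  have "card {x \<in> signs A. P x} \<le> 1"
  proof (rule ccontr)
    assume "\<not> ?thesis"
    then obtain x y where "x \<in> {x \<in> signs A. P x}" "y \<in> {x \<in> signs A. P x}" "x \<noteq> y"
      by (metis (no_types, lifting) card_le_Suc0_iff_eq One_nat_def assms(1) card.infinite le0 )
    then show False using assms(2) by blast
  qed
  moreover have "(\<Sum>x\<in>signs A. of_bool (P x)) = real (card {x \<in> signs A. P x})"
    using assms(1) by (simp add: sum.If_cases of_bool_def Int_def)
  ultimately show ?thesis
    unfolding avg_def by (intro divide_right_mono) auto
qed

text \<open>Averaging cos (\<theta> + e \<phi>) over a sign e gives cos \<theta> cos \<phi>, the
  sine terms cancelling. So coordinates factor with real cosines in place of complex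
  characters.\<close>

lemma avg_cos_linear:
  assumes "finite D"
  shows "avg D (\<lambda>x. cos (\<theta> + (\<Sum>i\<in>D. of_int (x i) * \<phi> i))) = cos \<theta> * (\<Prod>i\<in>D. cos (\<phi> i))"
  using assms
proof (induction D arbitrary: \<theta>)
  case empty
  then show ?case by simp
next
  case (insert a D)
  have *: "avg D (\<lambda>x. cos (\<theta> + (\<Sum>i\<in>insert a D. of_int ((x(a := c)) i) * \<phi> i)))
        = cos (\<theta> + of_int c * \<phi> a) * (\<Prod>i\<in>D. cos (\<phi> i))" for c
  proof -
    have "(\<Sum>i\<in>D. of_int ((x(a := c)) i) * \<phi> i) = (\<Sum>i\<in>D. of_int (x i) * \<phi> i)" for x
      using insert.hyps by (intro sum.cong) auto
    then show ?thesis
      using insert by (simp add: add.assoc[symmetric] insert.IH del: fun_upd_apply)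
         (simp add: insert.IH)
  qed
  show ?case
    using insert.hyps
    unfolding avg_insert[OF insert.hyps] *
    by (simp add: cos_add cos_diff field_simps)
qed

section \<open>Fourier analysis modulo a prime\<close>

definition ck :: "nat \<Rightarrow> int \<Rightarrow> real" where
  "ck p x = cos (2 * pi * of_int x / of_nat p)"

text \<open>A smooth stand-in for the squared distance of 2 x / p to the nearest integer; for odd p
  it vanishes exactly at the multiples of p.\<close>

definition sk :: "nat \<Rightarrow> int \<Rightarrow> real" where
  "sk p x = (sin (2 * pi * of_int x / of_nat p))\<^sup>2"

lemma ck_0 [simp]: "ck p 0 = 1" by (simp add: ck_def)
lemma sk_0 [simp]: "sk p 0 = 0" by (simp add: sk_def)
lemma sk_nonneg [simp]: "0 \<le> sk p x" by (simp add: sk_def)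
lemma sk_le_1 [simp]: "sk p x \<le> 1"
  unfolding sk_def by (metis abs_sin_le_one abs_square_le_1)
lemma abs_ck_le_1 [simp]: "\<bar>ck p x\<bar> \<le> 1" by (simp add: ck_def)

lemma ck_add_mult:
  assumes "p > 0"
  shows "ck p (x + of_nat p * t) = ck p x"
proof -
  have "2 * pi * real_of_int (x + of_nat p * t) / of_nat p = 2 * pi * real_of_int x / of_nat p + 2 * pi * of_int t"
    using assms by (simp add: field_simps)
  then show ?thesis
    unfolding ck_def by (simp add: cos_add cos_int_2pin sin_int_2pin)
qed

lemma ck_cong:
  assumes "p > 0" "[x = y] (mod int p)"
  shows "ck p x = ck p y"
proof -
  obtain t where "x = y + int p * t"
    using assms(2) by (metis cong_iff_lin cong_sym)
  then show ?thesis using ck_add_mult[OF assms(1)] by simp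
qed

lemma ck_double: "ck p (2 * x) = 1 - 2 * sk p x"
proof -
  have "2 * pi * real_of_int (2 * x) / real p = 2 * (2 * pi * real_of_int x / real p)" by simp
  then show ?thesis unfolding ck_def sk_def by (simp only: cos_double_sin)
qed

lemma sk_eq: "sk p x = 1 - (ck p x)\<^sup>2"
  by (simp add: sk_def ck_def sin_squared_eq)

lemma sk_cong:
  assumes "p > 0" "[x = y] (mod int p)"
  shows "sk p x = sk p y"
  using ck_cong[OF assms] by (simp add: sk_eq)

text \<open>The absolute sine is subadditive and squaring costs a factor 2. Over two summands this
  becomes the factor 4 by which Bohr radii grow under addition.\<close>

lemma sk_add_le: "sk p (x + y) \<le> 2 * sk p x + 2 * sk p y"
proof -
  define a where "a = 2 * pi * real_of_int x / real p"
  define b where "b = 2 * pi * real_of_int y / real p"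
  have eq: "2 * pi * real_of_int (x + y) / real p = a + b"
    by (simp add: a_def b_def ring_distribs add_divide_distrib)
  have "\<bar>sin (a + b)\<bar> \<le> \<bar>sin a\<bar> + \<bar>sin b\<bar>"
  proof -
    have "\<bar>sin a * cos b\<bar> \<le> \<bar>sin a\<bar>" "\<bar>cos a * sin b\<bar> \<le> \<bar>sin b\<bar>"
      by (simp_all add: abs_mult mult_left_le mult_left_le_one_le)
    then show ?thesis unfolding sin_add by linarith
  qed
  then have "(sin (a + b))\<^sup>2 \<le> (\<bar>sin a\<bar> + \<bar>sin b\<bar>)\<^sup>2"
    by (metis abs_ge_zero power2_abs power_mono)
  also have "\<dots> \<le> 2 * (sin a)\<^sup>2 + 2 * (sin b)\<^sup>2"
    using sum_squares_bound[of "\<bar>sin a\<bar>" "\<bar>sin b\<bar>"]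
    by (simp add: power2_sum)
  finally show ?thesis
    unfolding sk_def eq by (simp add: a_def b_def)
qed

text \<open>With c the absolute cosine, c^2 = 1 - \<open>sk\<close> gives c \<le> 1 -
  \<open>sk\<close> / 2 and so (1 + c) / 2 \<le> 1 - \<open>sk\<close> / 4. Both bounds carry the
  exponent of the mean, so that a single sum of exponentials majorizes both kinds of
  product.\<close>

lemma abs_ck_le_exp: "\<bar>ck p x\<bar> \<le> exp (- sk p x / 4)"
  and mean_abs_ck_le_exp: "(1 + \<bar>ck p x\<bar>) / 2 \<le> exp (- sk p x / 4)"
proof -
  have "(ck p x)\<^sup>2 = 1 - sk p x" by (simp add: sk_eq)
  also have "\<dots> \<le> (1 - sk p x / 2)\<^sup>2" by (simp add: power2_eq_square field_simps)
  finally have "\<bar>ck p x\<bar> \<le> \<bar>1 - sk p x / 2\<bar>"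
    by (simp only: abs_le_square_iff)
  then have *: "\<bar>ck p x\<bar> \<le> 1 - sk p x / 2"
    using sk_le_1[of p x] by linarith
  show "(1 + \<bar>ck p x\<bar>) / 2 \<le> exp (- sk p x / 4)"
    using * exp_ge_add_one_self[of "- sk p x / 4"] by (simp add: field_simps)
  show "\<bar>ck p x\<bar> \<le> exp (- sk p x / 4)"
    using * exp_ge_add_one_self[of "- sk p x / 4"] sk_nonneg[of p x] by linarith
qed

text \<open>Multiplying the sum by \<open>2 sin (\<theta>/2)\<close>, which is nonzero, makes it telescope.\<close>

lemma sum_ck:
  assumes "p > 0"
  shows "(\<Sum>k<p. ck p (int k * x)) = (if int p dvd x then real p else 0)"
proof (cases "int p dvd x")
  case True
  then obtain t where t: "x = int p * t" by blast
  have "ck p (int k * x) = 1" for k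
    using ck_add_mult[OF assms, of 0 "int k * t"] by (simp add: t mult_ac)
  then show ?thesis using True by simp
next
  case False
  define \<theta> where "\<theta> = 2 * pi * of_int x / real p"
  have sin_nz: "sin (\<theta> / 2) \<noteq> 0"
  proof
    assume "sin (\<theta> / 2) = 0"
    then obtain i :: int where "\<theta> / 2 = of_int i * pi"
      by (auto simp only: sin_zero_iff_int2)
    then have "real_of_int x = of_int i * real p"
      using assms by (simp add: \<theta>_def field_simps)
    then have "x = i * int p"
      by (metis of_int_eq_iff of_int_mult of_int_of_nat_eq)
    then show False using False by simp
  qed
  have "2 * sin (\<theta> / 2) * (\<Sum>k<n. cos (real k * \<theta>)) = sin (real n * \<theta> - \<theta> / 2) + sin (\<theta> / 2)" for n
  proof (induction n)
    case 0
    then show ?case by simp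
  next
    case (Suc n)
    have "real (Suc n) * \<theta> - \<theta> / 2 = real n * \<theta> + \<theta> / 2" by (simp add: field_simps)
    moreover have "sin (a + b) = sin (a - b) + 2 * sin b * cos a" for a b :: real
      by (simp add: sin_add sin_diff)
    ultimately have "sin (real (Suc n) * \<theta> - \<theta> / 2)
        = sin (real n * \<theta> - \<theta> / 2) + 2 * sin (\<theta> / 2) * cos (real n * \<theta>)"
      by metis
    then show ?case
      using Suc by (simp only: sum.lessThan_Suc distrib_left)
  qed
  moreover have "sin (real p * \<theta> - \<theta> / 2) = - sin (\<theta> / 2)"
  proof -
    have "real p * \<theta> = 2 * pi * of_int x" using assms by (simp add: \<theta>_def)
    then show ?thesis by (simp add: sin_diff cos_int_2pin sin_int_2pin)
  qed
  ultimately have "2 * sin (\<theta> / 2) * (\<Sum>k<p. cos (real k * \<theta>)) = 0" by simp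
  then have "(\<Sum>k<p. cos (real k * \<theta>)) = 0" using sin_nz by simp
  moreover have "ck p (int k * x) = cos (real k * \<theta>)" for k
    by (simp add: ck_def \<theta>_def mult_ac)
  ultimately show ?thesis using False by simp
qed

text \<open>Fourier majorant, monotone in \<open>D\<close>, of the probability that \<open>\<Sum>i\<in>D. x i * v i\<close> takes a prescribed
  value modulo \<open>p\<close>.\<close>

definition R :: "nat \<Rightarrow> nat set \<Rightarrow> (nat \<Rightarrow> int) \<Rightarrow> real" where
  "R p D v = (\<Sum>k<p. \<Prod>i\<in>D. \<bar>ck p (int k * v i)\<bar>) / real p"

lemma R_nonneg: "0 \<le> R p D v"
  unfolding R_def by (intro divide_nonneg_nonneg sum_nonneg prod_nonneg) auto

lemma R_mono:
  assumes "finite D" "E \<subseteq> D"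
  shows "R p D v \<le> R p E v"
proof -
  have "(\<Prod>i\<in>D. \<bar>ck p (int k * v i)\<bar>) \<le> (\<Prod>i\<in>E. \<bar>ck p (int k * v i)\<bar>)" for k
  proof -
    have "(\<Prod>i\<in>D. \<bar>ck p (int k * v i)\<bar>)
        = (\<Prod>i\<in>D - E. \<bar>ck p (int k * v i)\<bar>) * (\<Prod>i\<in>E. \<bar>ck p (int k * v i)\<bar>)"
      by (rule prod.subset_diff[OF assms(2,1)])
    also have "\<dots> \<le> 1 * (\<Prod>i\<in>E. \<bar>ck p (int k * v i)\<bar>)"
      by (intro mult_right_mono prod_le_1 prod_nonneg) auto
    finally show ?thesis by simp
  qed
  then show ?thesis
    unfolding R_def by (intro divide_right_mono sum_mono) auto
qed

lemma R_cong:
  assumes "p > 0" "\<And>i. i \<in> D \<Longrightarrow> [v i = w i] (mod int p)"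
  shows "R p D v = R p D w"
  unfolding R_def
  by (intro arg_cong2[where f="(/)"] sum.cong prod.cong refl arg_cong[of _ _ abs] ck_cong cong_mult)
     (use assms in auto)

lemma R_remove_zeros:
  assumes "finite D" "p > 0" "E \<subseteq> D" "\<And>i. i \<in> D - E \<Longrightarrow> int p dvd v i"
  shows "R p D v = R p E v"
proof -
  have "(\<Prod>i\<in>D. \<bar>ck p (int k * v i)\<bar>) = (\<Prod>i\<in>E. \<bar>ck p (int k * v i)\<bar>)" for k
  proof (rule prod.mono_neutral_right)
    show "\<forall>i\<in>D - E. \<bar>ck p (int k * v i)\<bar> = 1"
    proof
      fix i assume "i \<in> D - E"
      then have "[int k * v i = 0] (mod int p)"
        using assms(4) by (simp add: cong_0_iff)
      then show "\<bar>ck p (int k * v i)\<bar> = 1" using ck_cong[OF assms(2)] by fastforce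
    qed
  qed (use assms in auto)
  then show ?thesis by (simp add: R_def)
qed

text \<open>Fourier inversion writes the indicator as a mean of cosines over the frequencies k. The
  average over x factors, and the phase carrying b disappears in absolute values, hence uniformity
  in b.\<close>

lemma avg_cong_le_R:
  assumes "finite D" "p > 0"
  shows "avg D (\<lambda>x. of_bool ([(\<Sum>i\<in>D. x i * v i) = b] (mod int p))) \<le> R p D v"
proof -
  have "avg D (\<lambda>x. of_bool ([(\<Sum>i\<in>D. x i * v i) = b] (mod int p)))
      = avg D (\<lambda>x. (\<Sum>k<p. ck p (int k * ((\<Sum>i\<in>D. x i * v i) - b))) / real p)"
    using assms by (intro avg_cong) (simp add: sum_ck cong_iff_dvd_diff)
  also have "\<dots> = (\<Sum>k<p. avg D (\<lambda>x. ck p (int k * ((\<Sum>i\<in>D. x i * v i) - b)))) / real p"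
    unfolding avg_cmult_right[of _ _ "inverse (real p)", folded divide_inverse] avg_sum ..
  also have "\<dots> \<le> (\<Sum>k<p. \<Prod>i\<in>D. \<bar>ck p (int k * v i)\<bar>) / real p"
  proof (intro divide_right_mono sum_mono)
    fix k assume "k \<in> {..<p}"
    define \<theta> where "\<theta> = 2 * pi * of_int (- int k * b) / real p"
    have "avg D (\<lambda>x. ck p (int k * ((\<Sum>i\<in>D. x i * v i) - b)))
        = avg D (\<lambda>x. cos (\<theta> + (\<Sum>i\<in>D. of_int (x i) * (2 * pi * of_int (int k * v i) / real p))))"
    proof (intro avg_cong)
      fix x :: "nat \<Rightarrow> int"
      have "2 * pi * real_of_int (int k * ((\<Sum>i\<in>D. x i * v i) - b)) / real p
          = \<theta> + (2 * pi * of_int k / real p) * (\<Sum>i\<in>D. of_int (x i) * of_int (v i))"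
        by (simp add: \<theta>_def right_diff_distrib diff_divide_distrib)
      also have "\<dots> = \<theta> + (\<Sum>i\<in>D. of_int (x i) * (2 * pi * of_int (int k * v i) / real p))"
        unfolding sum_distrib_left by (intro arg_cong2[where f="(+)"] refl sum.cong) simp_all
      finally show "ck p (int k * ((\<Sum>i\<in>D. x i * v i) - b))
          = cos (\<theta> + (\<Sum>i\<in>D. of_int (x i) * (2 * pi * of_int (int k * v i) / real p)))"
        by (simp only: ck_def)
    qed
    also have "\<dots> = cos \<theta> * (\<Prod>i\<in>D. ck p (int k * v i))"
      unfolding ck_def by (rule avg_cos_linear[OF assms(1)])
    also have "\<dots> \<le> \<bar>cos \<theta> * (\<Prod>i\<in>D. ck p (int k * v i))\<bar>" by simp
    also have "\<dots> \<le> 1 * \<bar>\<Prod>i\<in>D. ck p (int k * v i)\<bar>"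
      unfolding abs_mult by (intro mult_right_mono) auto
    finally show "avg D (\<lambda>x. ck p (int k * ((\<Sum>i\<in>D. x i * v i) - b)))
        \<le> (\<Prod>i\<in>D. \<bar>ck p (int k * v i)\<bar>)" by (simp add: abs_prod)
  qed simp
  finally show ?thesis by (simp add: R_def)
qed

lemma sum_sk:
  assumes "p > 0" "\<not> int p dvd 2 * x"
  shows "(\<Sum>k<p. sk p (int k * x)) = real p / 2"
proof -
  have "ck p (int k * (2 * x)) = 1 - 2 * sk p (int k * x)" for k
    using ck_double[of p "int k * x"] by (simp add: mult_ac)
  then have "(\<Sum>k<p. 1 - 2 * sk p (int k * x)) = 0"
    using sum_ck[OF assms(1), of "2 * x"] assms(2) by simp
  then show ?thesis by (simp add: sum_subtractf sum_distrib_left[symmetric])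
qed

text \<open>The absolute value of c is at most (1 + c^2) / 2, and c^2 has mean 1/2 over the
  frequencies: 1/2 + 1/4. This is the baseline for an arbitrary nonzero vector.\<close>

lemma R_singleton:
  assumes "p > 0" "\<not> int p dvd 2 * v i"
  shows "R p {i} v \<le> 3 / 4"
proof -
  have "\<bar>c\<bar> \<le> 1/2 + c\<^sup>2 / 2" for c :: real
    using sum_squares_bound[of 1 "\<bar>c\<bar>"] by simp
  then have "\<bar>ck p (int k * v i)\<bar> \<le> 1 - sk p (int k * v i) / 2" for k
    using sk_eq[of p "int k * v i"] by (smt (verit, best) field_sum_of_halves)
  then have "(\<Sum>k<p. \<bar>ck p (int k * v i)\<bar>) \<le> (\<Sum>k<p. 1 - sk p (int k * v i) / 2)"
    by (intro sum_mono)
  also have "\<dots> = real p * (3/4)"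
    using sum_sk[OF assms] by (simp add: sum_subtractf sum_divide_distrib[symmetric])
  finally show ?thesis using assms(1) by (simp add: R_def divide_le_eq field_simps)
qed

section \<open>Bohr sets\<close>

text \<open>d is invertible modulo p, so the translates a + n d exhaust the residues. Used
  contrapositively: a proper nonempty A has a point that d moves out of A.\<close>

lemma residues_closed_under_shift:
  fixes A :: "int set"
  assumes "prime p" "A \<subseteq> {0..<int p}" "A \<noteq> {}" "\<not> int p dvd d"
    and closed: "\<And>a. a \<in> A \<Longrightarrow> (a + d) mod int p \<in> A"
  shows "A = {0..<int p}"
proof
  show "{0..<int p} \<subseteq> A"
  proof
    fix y assume y: "y \<in> {0..<int p}"
    obtain a where a: "a \<in> A" using assms(3) by blast
    have step: "(a + int n * d) mod int p \<in> A" for n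
    proof (induction n)
      case 0
      then show ?case using a assms(2) by (metis add.right_neutral atLeastLessThan_iff mod_pos_pos_trivial mult_zero_left of_nat_0 subsetD)
    next
      case (Suc n)
      have "((a + int n * d) mod int p + d) mod int p = (a + int (Suc n) * d) mod int p"
        unfolding mod_add_left_eq by (simp add: algebra_simps)
      then show ?case using closed[OF Suc] by metis
    qed
    have "prime (int p)" using assms(1) by simp
    then have "coprime d (int p)"
      using assms(4) by (metis coprime_commute prime_imp_coprime)
    then obtain x where x: "[d * x = 1] (mod int p)"
      using cong_solve_coprime_int by blast
    define n where "n = nat (((y - a) * x) mod int p)"
    have p0: "int p > 0" using assms(1) by (simp add: prime_gt_0_nat)
    have "int n = ((y - a) * x) mod int p" using p0 by (simp add: n_def)
    then have "[int n = (y - a) * x] (mod int p)" by (simp add: cong_def)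
    then have "[a + int n * d = a + (y - a) * x * d] (mod int p)"
      by (intro cong_add cong_mult cong_refl)
    also have "[a + (y - a) * x * d = a + (y - a) * 1] (mod int p)"
      unfolding mult.assoc using x by (intro cong_add cong_mult cong_refl) (simp add: mult.commute)
    finally have "(a + int n * d) mod int p = y mod int p" by (simp add: cong_def)
    then show "y \<in> A" using step[of n] y by simp
  qed
qed (rule assms)

abbreviation sumset_mod :: "nat \<Rightarrow> int set \<Rightarrow> int set \<Rightarrow> int set" where
  "sumset_mod p A B \<equiv> (\<lambda>(a, b). (a + b) mod int p) ` (A \<times> B)"

lemma inj_on_shift_mod: "inj_on (\<lambda>b. (b + e) mod int p) {0..<int p}"
proof (rule inj_onI)
  fix x y assume xy: "x \<in> {0..<int p}" "y \<in> {0..<int p}" "(x + e) mod int p = (y + e) mod int p"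
  then have "[x + e = y + e] (mod int p)" by (simp add: cong_def)
  then have "[x = y] (mod int p)" by (simp add: cong_add_rcancel)
  then show "x = y" using xy by (auto simp: cong_def)
qed

text \<open>Dyson's e-transform: \<open>B\<close> is shifted so that it meets \<open>A\<close> without being contained in it, and then
  \<open>(A, B)\<close> is replaced by \<open>(A \<union> B, A \<inter> B)\<close>.\<close>

lemma cauchy_davenport:
  assumes p: "prime p"
  shows "A \<subseteq> {0..<int p} \<Longrightarrow> B \<subseteq> {0..<int p} \<Longrightarrow> A \<noteq> {} \<Longrightarrow> B \<noteq> {} \<Longrightarrow>
    min p (card A + card B - 1) \<le> card (sumset_mod p A B)"
proof (induction "card B" arbitrary: A B rule: less_induct)
  case less
  have fin: "finite A" "finite B"
    using less.prems finite_subset by blast+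
  have card_shift: "card ((\<lambda>b. (b + e) mod int p) ` X) = card X" if "X \<subseteq> {0..<int p}" for e X
    using that inj_on_shift_mod inj_on_subset by (intro card_image) blast
  have one: "card A \<le> card (sumset_mod p A B)"
  proof -
    obtain b where "b \<in> B" using less.prems by blast
    then have "(\<lambda>a. (a + b) mod int p) ` A \<subseteq> sumset_mod p A B" by auto
    then show ?thesis
      using card_shift[OF less.prems(1)] card_mono fin by (metis finite_SigmaI finite_imageI)
  qed
  show ?case
  proof (cases "card B \<le> 1 \<or> A = {0..<int p}")
    case True
    then show ?thesis using one by auto
  next
    case False
    then obtain b1 b2 where b: "b1 \<in> B" "b2 \<in> B" "b1 \<noteq> b2"
      using fin by (metis One_nat_def card_le_Suc0_iff_eq)
    have "\<not> int p dvd b2 - b1"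
    proof
      assume "int p dvd b2 - b1"
      then have "[b2 = b1] (mod int p)" by (simp add: cong_iff_dvd_diff)
      then show False using b less.prems(2) by (auto simp: cong_def subset_iff)
    qed
    then obtain a where a: "a \<in> A" "(a + (b2 - b1)) mod int p \<notin> A"
      using residues_closed_under_shift[OF p less.prems(1,3)] False by blast
    \<comment> \<open>Shifting by a - b1 sends b1 to a in A and b2 to a point outside A, so the
      intersection with A is nonempty and smaller than B.\<close>
    define Be where "Be = (\<lambda>b. (b + (a - b1)) mod int p) ` B"
    have p0: "int p > 0" using p by (simp add: prime_gt_0_nat)
    have Be: "Be \<subseteq> {0..<int p}" using p0 by (auto simp: Be_def)
    have finBe: "finite Be" using fin by (simp add: Be_def)
    have cBe: "card Be = card B" unfolding Be_def by (rule card_shift[OF less.prems(2)])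
    have "(b1 + (a - b1)) mod int p = a" using a less.prems(1) by auto
    then have aBe: "a \<in> Be" unfolding Be_def using b by (metis imageI)
    have "(b2 + (a - b1)) mod int p \<in> Be" unfolding Be_def using b by blast
    moreover have "(b2 + (a - b1)) mod int p \<notin> A" using a(2)
      by (metis add.commute add_diff_eq)
    ultimately have "A \<inter> Be \<subset> Be" by blast
    then have lt: "card (A \<inter> Be) < card B" using finBe cBe by (metis psubset_card_mono)
    have sub: "sumset_mod p (A \<union> Be) (A \<inter> Be) \<subseteq> (\<lambda>b. (b + (a - b1)) mod int p) ` sumset_mod p A B"
    proof -
      have key: "(x + y) mod int p \<in> (\<lambda>b. (b + (a - b1)) mod int p) ` sumset_mod p A B"
        if xA: "x \<in> A" and yBe: "y \<in> Be" for x y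
      proof -
        obtain b where b: "b \<in> B" and y: "y = (b + (a - b1)) mod int p"
          using yBe unfolding Be_def by (elim imageE)
        have "(x + y) mod int p = ((x + b) mod int p + (a - b1)) mod int p"
          unfolding y by (simp add: mod_add_left_eq mod_add_right_eq add.assoc)
        moreover have "(x + b) mod int p \<in> sumset_mod p A B" using xA b by auto
        ultimately show ?thesis by blast
      qed
      show ?thesis
      proof clarify
        fix x y assume "x \<in> A \<union> Be" "y \<in> A" "y \<in> Be"
        then consider "x \<in> A" "y \<in> Be" | "y \<in> A" "x \<in> Be" by blast
        then show "(x + y) mod int p \<in> (\<lambda>b. (b + (a - b1)) mod int p) ` sumset_mod p A B"
          by cases (use key[of x y] key[of y x] in \<open>simp_all add: add.commute\<close>)
      qed
    qed
    have "min p (card A + card B - 1) = min p (card (A \<union> Be) + card (A \<inter> Be) - 1)"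
      using card_Un_Int[OF fin(1) finBe] cBe by simp
    also have "\<dots> \<le> card (sumset_mod p (A \<union> Be) (A \<inter> Be))"
      using less.hyps[OF lt, of "A \<union> Be"] less.prems Be a aBe by blast
    also have "\<dots> \<le> card ((\<lambda>b. (b + (a - b1)) mod int p) ` sumset_mod p A B)"
      using sub fin by (intro card_mono) auto
    also have "\<dots> \<le> card (sumset_mod p A B)"
      using fin by (intro card_image_le) auto
    finally show ?thesis .
  qed
qed

text \<open>Only the mean over the listed frequencies is controlled, not each of them, since a mean
  is what Markov's inequality provides. Frequencies may repeat, so a list \<kappa> costs p^r
  choices.\<close>

definition bohr :: "nat \<Rightarrow> nat \<Rightarrow> (nat \<Rightarrow> nat) \<Rightarrow> real \<Rightarrow> int set" where
  "bohr p r \<kappa> \<tau> = {a \<in> {0..<int p}. (\<Sum>j<r. sk p (int (\<kappa> j) * a)) \<le> \<tau> * real r}"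

lemma bohr_subset: "bohr p r \<kappa> \<tau> \<subseteq> {0..<int p}"
  by (auto simp: bohr_def)

lemma finite_bohr [simp]: "finite (bohr p r \<kappa> \<tau>)"
  by (rule finite_subset[OF bohr_subset]) simp

lemma bohr_mono: "\<sigma> \<le> \<tau> \<Longrightarrow> bohr p r \<kappa> \<sigma> \<subseteq> bohr p r \<kappa> \<tau>"
  unfolding bohr_def using mult_right_mono[of \<sigma> \<tau> "real r"] by auto

lemma zero_in_bohr: "p > 0 \<Longrightarrow> 0 \<le> \<tau> \<Longrightarrow> 0 \<in> bohr p r \<kappa> \<tau>"
  by (auto simp: bohr_def)

lemma bohr_add:
  assumes "p > 0" "a \<in> bohr p r \<kappa> \<tau>" "b \<in> bohr p r \<kappa> \<tau>"
  shows "(a + b) mod int p \<in> bohr p r \<kappa> (4 * \<tau>)"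
proof -
  have "(\<Sum>j<r. sk p (int (\<kappa> j) * ((a + b) mod int p))) = (\<Sum>j<r. sk p (int (\<kappa> j) * (a + b)))"
    by (intro sum.cong sk_cong[OF assms(1)] cong_mult cong_refl refl) (simp add: cong_def)
  also have "\<dots> \<le> (\<Sum>j<r. 2 * sk p (int (\<kappa> j) * a) + 2 * sk p (int (\<kappa> j) * b))"
    by (intro sum_mono) (simp only: distrib_left sk_add_le)
  also have "\<dots> = 2 * (\<Sum>j<r. sk p (int (\<kappa> j) * a)) + 2 * (\<Sum>j<r. sk p (int (\<kappa> j) * b))"
    by (simp only: sum.distrib sum_distrib_left)
  also have "\<dots> \<le> 4 * \<tau> * real r"
    using assms(2,3) unfolding bohr_def by auto
  finally have "(\<Sum>j<r. sk p (int (\<kappa> j) * ((a + b) mod int p))) \<le> 4 * \<tau> * real r" .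
  then show ?thesis using assms(1) by (simp add: bohr_def)
qed

text \<open>Quadrupling the radius admits all sums of two elements, so Cauchy-Davenport doubles the
  size minus one as long as the set stays proper. Read backwards, size decays like the square root
  of the radius, which is the origin of 1 / sqrt (card D).\<close>

lemma card_bohr_doubling:
  assumes p: "prime p" and "0 \<le> \<tau>" "card (bohr p r \<kappa> (4 ^ q * \<tau>)) < p"
  shows "2 ^ q * (real (card (bohr p r \<kappa> \<tau>)) - 1) \<le> real (card (bohr p r \<kappa> (4 ^ q * \<tau>))) - 1"
  using assms(3)
proof (induction q)
  case 0
  then show ?case by simp
next
  case (Suc q)
  have p0: "p > 0" using p by (simp add: prime_gt_0_nat)
  let ?B = "\<lambda>q. bohr p r \<kappa> (4 ^ q * \<tau>)"
  have nonneg: "0 \<le> 4 ^ q * \<tau>" using assms(2) by simp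
  have "?B q \<subseteq> ?B (Suc q)" using assms(2) by (intro bohr_mono mult_right_mono) simp_all
  then have "card (?B q) \<le> card (?B (Suc q))" by (intro card_mono) auto
  then have IH: "2 ^ q * (real (card (bohr p r \<kappa> \<tau>)) - 1) \<le> real (card (?B q)) - 1"
    using Suc by simp
  have ne: "?B q \<noteq> {}" using zero_in_bohr[OF p0 nonneg] by blast
  have "sumset_mod p (?B q) (?B q) \<subseteq> ?B (Suc q)"
    using bohr_add[OF p0] by (fastforce simp: mult.assoc)
  then have "card (sumset_mod p (?B q) (?B q)) \<le> card (?B (Suc q))" by (intro card_mono) auto
  then have "min p (card (?B q) + card (?B q) - 1) \<le> card (?B (Suc q))"
    using cauchy_davenport[OF p bohr_subset bohr_subset ne ne] by linarith
  then have "card (?B q) + card (?B q) \<le> card (?B (Suc q)) + 1"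
    using Suc.prems by linarith
  then show ?case using IH by simp
qed

lemma ck_mult: "ck p x * ck p y = (ck p (x - y) + ck p (x + y)) / 2"
  unfolding ck_def cos_times_cos
  by (simp add: ring_distribs add_divide_distrib diff_divide_distrib)

lemma sum_ck_int:
  assumes "p > 0"
  shows "(\<Sum>a\<in>{0..<int p}. ck p (x * a)) = (if int p dvd x then real p else 0)"
proof -
  have "(\<Sum>a\<in>{0..<int p}. ck p (x * a)) = (\<Sum>a<p. ck p (int a * x))"
    by (rule sum.reindex_bij_witness[of _ int nat]) (auto simp: mult.commute)
  then show ?thesis using sum_ck[OF assms] by simp
qed

text \<open>Parseval: the cosines of k and l are orthogonal on the residues unless k = l or k = -l
  modulo p, and for each k each sign admits at most one l in S.\<close>

lemma sum_power2_ck_le: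
  assumes "prime p" "odd p" "S \<subseteq> {..<p}"
  shows "(\<Sum>a\<in>{0..<int p}. (\<Sum>k\<in>S. ck p (2 * int k * a))\<^sup>2) \<le> real p * real (card S)"
proof -
  have p0: "p > 0" using assms by (simp add: prime_gt_0_nat)
  have fS: "finite S" using assms(3) finite_subset by blast
  have cop: "coprime (int p) 2" using assms(2) by simp
  let ?f = "\<lambda>k l. (\<Sum>a\<in>{0..<int p}. ck p (2 * int k * a) * ck p (2 * int l * a))"
  have f: "?f k l = (real p * of_bool (int p dvd 2 * (int k - int l)) + real p * of_bool (int p dvd 2 * (int k + int l))) / 2" for k l
  proof -
    have "?f k l = (\<Sum>a\<in>{0..<int p}. ck p (2 * (int k - int l) * a) + ck p (2 * (int k + int l) * a)) / 2"
      unfolding ck_mult sum_divide_distrib by (simp add: algebra_simps)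
    then show ?thesis unfolding sum.distrib sum_ck_int[OF p0] by simp
  qed
  have count: "(\<Sum>l\<in>S. of_bool (int p dvd 2 * (c + s * int l)) :: real) \<le> 1" if "s = 1 \<or> s = -1" for c s
  proof -
    have "card {l \<in> S. int p dvd 2 * (c + s * int l)} \<le> Suc 0"
    proof (subst card_le_Suc0_iff_eq)
      show "\<forall>x\<in>{l \<in> S. int p dvd 2 * (c + s * int l)}. \<forall>y\<in>{l \<in> S. int p dvd 2 * (c + s * int l)}. x = y"
      proof (intro ballI)
        fix x y assume "x \<in> {l \<in> S. int p dvd 2 * (c + s * int l)}" "y \<in> {l \<in> S. int p dvd 2 * (c + s * int l)}"
        then have xy: "int p dvd c + s * int x" "int p dvd c + s * int y" "x < p" "y < p"
          using cop assms(3) unfolding mem_Collect_eq by (auto simp only: coprime_dvd_mult_right_iff)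
        then have "int p dvd (c + s * int x) - (c + s * int y)" by (intro dvd_diff)
        then have "int p dvd int x - int y" using that by (auto simp: dvd_diff_commute)
        then have "[int x = int y] (mod int p)" by (simp add: cong_iff_dvd_diff)
        then show "x = y" using xy by (simp add: cong_def)
      qed
    qed (use fS in auto)
    then show ?thesis using fS by (simp add: of_bool_def sum.If_cases Int_def)
  qed
  have "(\<Sum>a\<in>{0..<int p}. (\<Sum>k\<in>S. ck p (2 * int k * a))\<^sup>2)
      = (\<Sum>a\<in>{0..<int p}. \<Sum>k\<in>S. \<Sum>l\<in>S. ck p (2 * int k * a) * ck p (2 * int l * a))"
    by (simp add: power2_eq_square sum_product)
  also have "\<dots> = (\<Sum>k\<in>S. \<Sum>l\<in>S. ?f k l)"
    by (subst sum.swap, intro sum.cong refl, subst sum.swap, rule refl)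
  also have "\<dots> \<le> (\<Sum>k\<in>S. real p)"
  proof (rule sum_mono)
    fix k assume "k \<in> S"
    have "(\<Sum>l\<in>S. ?f k l) = real p / 2 * ((\<Sum>l\<in>S. of_bool (int p dvd 2 * (int k + (- 1) * int l)))
        + (\<Sum>l\<in>S. of_bool (int p dvd 2 * (int k + 1 * int l))))"
      unfolding f by (simp add: sum.distrib sum_distrib_left distrib_left add_divide_distrib)
    also have "\<dots> \<le> real p / 2 * (1 + 1)"
      by (intro mult_left_mono add_mono count) auto
    finally show "(\<Sum>l\<in>S. ?f k l) \<le> real p" by simp
  qed
  finally show ?thesis by (simp add: mult.commute)
qed

text \<open>Chebyshev: a small mean of \<open>sk\<close> at a makes the sum of the doubled cosines
  at least card S / 2, which the second moment bound allows for at most 4 p / card S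
  residues.\<close>

lemma card_small_average_sk_le:
  assumes "prime p" "odd p" "S \<subseteq> {..<p}"
  shows "real (card {a \<in> {0..<int p}. (\<Sum>k\<in>S. sk p (int k * a)) \<le> real (card S) / 4}) * real (card S) \<le> 4 * real p"
proof -
  let ?A = "{a \<in> {0..<int p}. (\<Sum>k\<in>S. sk p (int k * a)) \<le> real (card S) / 4}"
  have sq: "(real (card S) / 2)\<^sup>2 \<le> (\<Sum>k\<in>S. ck p (2 * int k * a))\<^sup>2" if "a \<in> ?A" for a
  proof -
    have "(\<Sum>k\<in>S. ck p (2 * int k * a)) = real (card S) - 2 * (\<Sum>k\<in>S. sk p (int k * a))"
      unfolding mult.assoc ck_double by (simp add: sum_subtractf sum_distrib_left)
    then have "real (card S) / 2 \<le> (\<Sum>k\<in>S. ck p (2 * int k * a))" using that by simp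
    then show ?thesis by (intro power_mono) auto
  qed
  have "real (card ?A) * (real (card S) / 2)\<^sup>2 \<le> (\<Sum>a\<in>?A. (\<Sum>k\<in>S. ck p (2 * int k * a))\<^sup>2)"
    using sum_mono[of ?A "\<lambda>_. (real (card S) / 2)\<^sup>2", OF sq] by simp
  also have "\<dots> \<le> (\<Sum>a\<in>{0..<int p}. (\<Sum>k\<in>S. ck p (2 * int k * a))\<^sup>2)"
    by (intro sum_mono2) auto
  also have "\<dots> \<le> real p * real (card S)" by (rule sum_power2_ck_le[OF assms])
  finally have "real (card S) * (real (card ?A) * real (card S)) \<le> real (card S) * (4 * real p)"
    by (simp add: power2_eq_square field_simps)
  then show ?thesis by (cases "card S = 0") simp_all
qed

section \<open>An inverse Littlewood--Offord lemma\<close>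

lemma exp_minus_le:
  fixes x :: real
  assumes "0 \<le> x" "x \<le> 1"
  shows "exp (- x) \<le> 1 - x / 2"
proof -
  have "exp (- x) \<le> 1 / (1 + x)"
    using exp_ge_add_one_self[of x] assms by (simp add: exp_minus field_simps)
  also have "\<dots> \<le> 1 - x / 2"
    using assms mult_left_mono[of x 1 x] by (simp add: field_simps)
  finally show ?thesis .
qed

text \<open>S has too many possible values to be recorded, so r frequencies drawn from it take its
  place. If the mean of \<open>sk\<close> over S exceeds 1/4, then the mean of exp (-
  \<open>sk\<close>) is at most exp (-1/8), and a random sample has sum at most r / 16 with
  probability at most exp (r / 16 - r / 8). A union bound over the p residues leaves a good
  sample.\<close>

lemma exists_sample:
  assumes "p > 0" "S \<subseteq> {..<p}" "S \<noteq> {}" "real p * exp (- real r / 16) < 1"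
  shows "\<exists>\<kappa>\<in>PiE {..<r} (\<lambda>_. S). \<forall>a\<in>{0..<int p}.
    (\<Sum>k\<in>S. sk p (int k * a)) > real (card S) / 4 \<longrightarrow> (\<Sum>j<r. sk p (int (\<kappa> j) * a)) > 1 / 16 * real r"
proof (rule ccontr)
  assume neg: "\<not> ?thesis"
  have fS: "finite S" using assms(2) finite_subset by blast
  have cS: "card S > 0" using fS assms(3) by (simp add: card_gt_0_iff)
  let ?A = "{a \<in> {0..<int p}. (\<Sum>k\<in>S. sk p (int k * a)) > real (card S) / 4}"
  let ?K = "PiE {..<r} (\<lambda>_. S)"
  have fK: "finite ?K" using fS by (simp add: finite_PiE)
  have cK: "real (card ?K) = real (card S) ^ r" by (simp add: card_PiE)
  have fA: "finite ?A" by (rule finite_subset[of _ "{0..<int p}"]) auto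
  let ?w = "\<lambda>\<kappa> a. exp (real r / 16) * (\<Prod>j<r. exp (- sk p (int (\<kappa> j) * a)))"
  have "1 \<le> (\<Sum>a\<in>?A. ?w \<kappa> a)" if \<kappa>: "\<kappa> \<in> ?K" for \<kappa>
  proof -
    have "\<not> (\<forall>a\<in>{0..<int p}. (\<Sum>k\<in>S. sk p (int k * a)) > real (card S) / 4 \<longrightarrow>
        (\<Sum>j<r. sk p (int (\<kappa> j) * a)) > 1 / 16 * real r)"
      using neg \<kappa> by blast
    then obtain a where a: "a \<in> ?A" "(\<Sum>j<r. sk p (int (\<kappa> j) * a)) \<le> 1 / 16 * real r"
      by (auto simp: not_less)
    have "?w \<kappa> a = exp (real r / 16 - (\<Sum>j<r. sk p (int (\<kappa> j) * a)))"
      by (simp add: exp_sum[symmetric] exp_add[symmetric] sum_negf)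
    then have "1 \<le> ?w \<kappa> a" using a(2) by simp
    also have "\<dots> \<le> (\<Sum>a\<in>?A. ?w \<kappa> a)"
      using a(1) by (intro member_le_sum mult_nonneg_nonneg prod_nonneg fA) simp_all
    finally show ?thesis .
  qed
  then have "real (card ?K) \<le> (\<Sum>\<kappa>\<in>?K. \<Sum>a\<in>?A. ?w \<kappa> a)"
    using sum_mono[of ?K "\<lambda>_. 1" "\<lambda>\<kappa>. \<Sum>a\<in>?A. ?w \<kappa> a"] by simp
  also have "\<dots> = (\<Sum>a\<in>?A. exp (real r / 16) * (\<Sum>\<kappa>\<in>?K. \<Prod>j<r. exp (- sk p (int (\<kappa> j) * a))))"
    by (subst sum.swap) (simp add: sum_distrib_left)
  also have "\<dots> = (\<Sum>a\<in>?A. exp (real r / 16) * (\<Sum>k\<in>S. exp (- sk p (int k * a))) ^ r)"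
    using fS prod_sum_PiE[of "{..<r}" "\<lambda>_. S" "\<lambda>j k. exp (- sk p (int k * _))"]
    by (intro sum.cong refl arg_cong2[where f="(*)"])
       (subst prod_sum_PiE[symmetric], auto)
  also have "\<dots> \<le> (\<Sum>a\<in>?A. exp (real r / 16) * (real (card S) * exp (- 1 / 8)) ^ r)"
  proof (intro sum_mono mult_left_mono power_mono)
    fix a assume a: "a \<in> ?A"
    have "(\<Sum>k\<in>S. exp (- sk p (int k * a))) \<le> (\<Sum>k\<in>S. 1 - sk p (int k * a) / 2)"
      by (intro sum_mono exp_minus_le) auto
    also have "\<dots> = real (card S) - (\<Sum>k\<in>S. sk p (int k * a)) / 2"
      by (simp add: sum_subtractf sum_divide_distrib)
    also have "\<dots> \<le> real (card S) * (1 + (- 1 / 8))" using a by simp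
    also have "\<dots> \<le> real (card S) * exp (- 1 / 8)"
      by (intro mult_left_mono exp_ge_add_one_self) auto
    finally show "(\<Sum>k\<in>S. exp (- sk p (int k * a))) \<le> real (card S) * exp (- 1 / 8)" .
  qed (auto intro!: sum_nonneg)
  also have "\<dots> = real (card ?A) * exp (- real r / 16) * real (card S) ^ r"
    by (simp add: power_mult_distrib exp_of_nat_mult[symmetric] exp_add[symmetric])
  also have "\<dots> \<le> real p * exp (- real r / 16) * real (card S) ^ r"
  proof (intro mult_right_mono)
    have "card ?A \<le> card {0..<int p}" by (intro card_mono) auto
    then show "real (card ?A) \<le> real p" by simp
  qed auto
  also have "\<dots> < real (card S) ^ r" using assms(4) cS by simp
  finally show False using cK by simp
qed

text \<open>Let \<Psi> be the sum of exponentials. If all level sets were small, level t would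
  contribute at most exp (1/4 - t/4) exp (t/8) \<Psi> / 40. Over all t this is at most (4/15)
  \<Psi>, and the tail beyond T is at most 1/2, contradicting \<Psi> \<ge> 1. The surplus exp (t/8)
  later absorbs a factor sqrt t.\<close>

lemma exists_level:
  fixes H :: "nat \<Rightarrow> real"
  assumes "finite K" and H: "\<And>k. k \<in> K \<Longrightarrow> 0 \<le> H k"
    and "1 \<le> (\<Sum>k\<in>K. exp (- H k / 4))" and T: "real (card K) * exp (- real T / 4) \<le> 1/2"
  shows "\<exists>t\<in>{1..T}. exp (real t / 8) * (\<Sum>k\<in>K. exp (- H k / 4)) \<le> 40 * real (card {k \<in> K. H k \<le> real t})"
proof (rule ccontr)
  assume neg: "\<not> ?thesis"
  define \<Psi> where "\<Psi> = (\<Sum>k\<in>K. exp (- H k / 4))"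
  let ?S = "\<lambda>t. {k \<in> K. H k \<le> real t}"
  have small: "real (card (?S t)) \<le> exp (real t / 8) * \<Psi> / 40" if "t \<in> {1..T}" for t
  proof -
    have "\<not> exp (real t / 8) * \<Psi> \<le> 40 * real (card (?S t))"
      using neg that unfolding \<Psi>_def by blast
    then show ?thesis by simp
  qed
  have pt: "exp (- H k / 4) \<le> (\<Sum>t\<in>{1..T}. of_bool (H k \<le> real t) * exp (1/4 - real t / 4)) + exp (- real T / 4)"
    if k: "k \<in> K" for k
  proof (cases "H k \<le> real T \<and> T \<ge> 1")
    case True
    \<comment> \<open>Levels start at 1 even if H k = 0, since the Bohr radius formed from t has to
      be positive.\<close>
    define t where "t = max 1 (nat \<lceil>H k\<rceil>)"
    have t: "t \<in> {1..T}" "H k \<le> real t" "real t \<le> H k + 1"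
      using True H[OF k] by (auto simp: t_def) linarith+
    have "exp (- H k / 4) \<le> of_bool (H k \<le> real t) * exp (1/4 - real t / 4)" using t by simp
    also have "\<dots> \<le> (\<Sum>t\<in>{1..T}. of_bool (H k \<le> real t) * exp (1/4 - real t / 4))"
      using t by (intro member_le_sum) auto
    finally show ?thesis by (simp add: add_increasing2)
  next
    case False
    then have "exp (- H k / 4) \<le> exp (- real T / 4)" using H[OF k] by (auto simp: not_le)
    then show ?thesis by (simp add: add_increasing sum_nonneg)
  qed
  have geo: "(\<Sum>t\<in>{1..T}. exp (- real t / 8)) \<le> 8"
  proof -
    have "(\<Sum>t\<in>{1..n}. exp (- real t / 8)) \<le> 8 * (1 - exp (- real n / 8))" for n
    proof (induction n)
      case (Suc n)
      define x y where "x = exp (- real (Suc n) / 8)" and "y = exp (- real n / 8)"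
      have "y = x * exp (1 / 8)"
        unfolding x_def y_def by (simp add: exp_add[symmetric] diff_divide_distrib)
      moreover have "x * (1 + 1 / 8) \<le> x * exp (1 / 8)"
        unfolding x_def by (intro mult_left_mono exp_ge_add_one_self) auto
      ultimately have "9 / 8 * x \<le> y" by simp
      then have "8 * (1 - y) + x \<le> 8 * (1 - x)" by simp
      then have "(\<Sum>t\<in>{1..n}. exp (- real t / 8)) + x \<le> 8 * (1 - x)"
        using Suc unfolding y_def[symmetric] by simp
      moreover have "(\<Sum>t\<in>{1..Suc n}. exp (- real t / 8)) = (\<Sum>t\<in>{1..n}. exp (- real t / 8)) + x"
        unfolding x_def by (subst sum.nat_ivl_Suc', simp, rule add.commute)
      ultimately show ?case unfolding x_def[symmetric] by (simp only:)
    qed simp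
    from this[of T] show ?thesis by (smt (verit) exp_ge_zero)
  qed
  have "\<Psi> \<le> (\<Sum>k\<in>K. (\<Sum>t\<in>{1..T}. of_bool (H k \<le> real t) * exp (1/4 - real t / 4)) + exp (- real T / 4))"
    unfolding \<Psi>_def by (intro sum_mono pt)
  also have "\<dots> = (\<Sum>t\<in>{1..T}. exp (1/4 - real t / 4) * real (card (?S t))) + real (card K) * exp (- real T / 4)"
    unfolding sum.distrib
    by (subst sum.swap) (use assms(1) in \<open>simp add: of_bool_def sum.If_cases Int_def sum_distrib_right[symmetric] mult.commute\<close>)
  also have "\<dots> \<le> (\<Sum>t\<in>{1..T}. exp (1/4 - real t / 4) * (exp (real t / 8) * \<Psi> / 40)) + 1/2"
    by (intro add_mono sum_mono mult_left_mono small T) auto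
  also have "(\<Sum>t\<in>{1..T}. exp (1/4 - real t / 4) * (exp (real t / 8) * \<Psi> / 40))
      = exp (1/4) * (\<Sum>t\<in>{1..T}. exp (- real t / 8)) * \<Psi> / 40"
    unfolding sum_distrib_left sum_distrib_right sum_divide_distrib
    by (intro sum.cong refl) (simp add: exp_add[symmetric] mult.assoc[symmetric])
  also have "\<dots> \<le> (4/3) * 8 * \<Psi> / 40"
  proof -
    have "exp (1/4) \<le> (4/3 :: real)"
      using exp_ge_add_one_self[of "-1/4 :: real"] by (simp add: exp_minus field_simps)
    then have "exp (1/4) * (\<Sum>t\<in>{1..T}. exp (- real t / 8)) \<le> 4/3 * 8"
      using geo by (intro mult_mono) (auto intro: sum_nonneg)
    then show ?thesis using assms(3) unfolding \<Psi>_def[symmetric]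
      by (intro divide_right_mono mult_right_mono) auto
  qed
  finally show False using assms(3) unfolding \<Psi>_def[symmetric] by simp
qed

text \<open>The average over all \<open>Y\<close> is \<open>\<Psi>\<close>, so some \<open>Y\<close> and its complement together contribute at most \<open>2 \<Psi>\<close>.\<close>

lemma exists_half_subset:
  assumes "finite D" "p > 0"
  shows "\<exists>Y\<subseteq>D. 2 * card Y \<le> card D \<and>
    real p * R p Y v \<le> 2 * (\<Sum>k<p. exp (- (\<Sum>i\<in>D. sk p (int k * v i)) / 4))"
proof -
  define \<Psi> where "\<Psi> = (\<Sum>k<p. exp (- (\<Sum>i\<in>D. sk p (int k * v i)) / 4))"
  define f where "f Y = real p * R p Y v" for Y
  have f: "f Y = (\<Sum>k<p. \<Prod>i\<in>Y. \<bar>ck p (int k * v i)\<bar>)" for Y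
    using assms by (simp add: f_def R_def)
  have f0: "0 \<le> f Y" for Y by (simp add: f_def R_nonneg)
  have "(\<Sum>Y\<in>Pow D. f Y) = (\<Sum>k<p. \<Prod>i\<in>D. \<bar>ck p (int k * v i)\<bar> + 1)"
    unfolding f by (subst sum.swap) (simp add: prod_add[OF assms(1)])
  also have "\<dots> \<le> (\<Sum>k<p. \<Prod>i\<in>D. 2 * exp (- sk p (int k * v i) / 4))"
    using mean_abs_ck_le_exp by (intro sum_mono prod_mono) (auto simp: field_simps)
  also have "\<dots> = 2 ^ card D * \<Psi>"
    unfolding \<Psi>_def sum_distrib_left
    using assms by (intro sum.cong refl) (simp add: prod.distrib exp_sum[symmetric] sum_negf sum_divide_distrib)
  finally have le: "(\<Sum>Y\<in>Pow D. f Y) \<le> 2 ^ card D * \<Psi>" .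
  have compl: "(\<Sum>Y\<in>Pow D. f (D - Y)) = (\<Sum>Y\<in>Pow D. f Y)"
    by (rule sum.reindex_bij_witness[of _ "\<lambda>Y. D - Y" "\<lambda>Y. D - Y"]) (auto simp: double_diff)
  have "\<exists>Y\<in>Pow D. f Y + f (D - Y) \<le> 2 * \<Psi>"
  proof (rule ccontr)
    assume "\<not> ?thesis"
    then have "(\<Sum>Y\<in>Pow D. 2 * \<Psi>) < (\<Sum>Y\<in>Pow D. f Y + f (D - Y))"
      using assms by (intro sum_strict_mono) (auto simp: not_le)
    then show False using le compl assms by (simp add: sum.distrib card_Pow)
  qed
  then obtain Y where Y: "Y \<subseteq> D" "f Y + f (D - Y) \<le> 2 * \<Psi>" by blast
  have "f Y \<le> 2 * \<Psi>" "f (D - Y) \<le> 2 * \<Psi>" using Y(2) f0[of Y] f0[of "D - Y"] by linarith+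
  moreover have "card Y + card (D - Y) = card D"
    using Y assms by (metis card_Diff_subset card_mono finite_subset le_add_diff_inverse)
  ultimately show ?thesis
    using Y(1) unfolding f_def \<Psi>_def[symmetric]
    by (metis Diff_subset add.commute mult_2 nat_add_left_cancel_le nat_le_linear order_trans add_le_mono1)
qed

text \<open>Let \<Psi> be the sum of exponentials majorizing p times R. Some level set S of
  frequencies with H \<le> t has size s \<ge> exp (t/8) \<Psi> / 40. For frequencies sampled from S,
  Markov's inequality puts all but a quarter of the coordinates into the Bohr set of radius \<tau> =
  4 t / card D. At radius 1/16 that set has at most 4 p / s elements, and descending to \<tau> saves
  a factor of order sqrt \<tau>. On a suitable half Y the value of R is at most 2 \<Psi> / p, so
  \<Psi> cancels in the product. D' consists of Y and the exceptional quarter.\<close>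

lemma inverse_littlewood_offord_step:
  assumes p: "prime p" "odd p" and D: "finite D"
    and r: "real r > 16 * ln (real p)" and T: "real T \<ge> 4 * (ln (real p) + 1)"
    and d: "card D \<ge> 64 * T" and R: "real p * R p D v \<ge> 200"
    and v: "\<And>i. i \<in> D \<Longrightarrow> v i \<in> {1..<int p}"
  shows "\<exists>\<kappa>\<in>PiE {..<r} (\<lambda>_. {..<p}). \<exists>t\<in>{1..T}. \<exists>D'\<subseteq>D. 4 * card D' \<le> 3 * card D \<and>
    (\<forall>i\<in>D - D'. v i \<in> bohr p r \<kappa> (4 * real t / real (card D)) - {0}) \<and>
    real (card (bohr p r \<kappa> (4 * real t / real (card D)) - {0})) * R p D' v \<le> 10240 / sqrt (real (card D))"
proof -
  have p0: "p > 0" and p1: "p > 1" using prime_gt_1_nat[OF p(1)] by simp_all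
  have lnp: "ln (real p) > 0" using p1 by simp
  define dd where "dd = real (card D)"
  define H where "H k = (\<Sum>i\<in>D. sk p (int k * v i))" for k
  define \<Psi> where "\<Psi> = (\<Sum>k<p. exp (- H k / 4))"
  have H0: "0 \<le> H k" for k by (simp add: H_def sum_nonneg)
  have "real p * R p D v \<le> \<Psi>"
  proof -
    have "(\<Prod>i\<in>D. \<bar>ck p (int k * v i)\<bar>) \<le> exp (- H k / 4)" for k
    proof -
      have "(\<Prod>i\<in>D. \<bar>ck p (int k * v i)\<bar>) \<le> (\<Prod>i\<in>D. exp (- sk p (int k * v i) / 4))"
        by (intro prod_mono conjI abs_ck_le_exp abs_ge_zero)
      then show ?thesis using D by (simp add: H_def exp_sum[symmetric] sum_negf sum_divide_distrib)
    qed
    then show ?thesis using p0 by (simp add: R_def \<Psi>_def sum_mono)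
  qed
  then have \<Psi>200: "200 \<le> \<Psi>" using R by simp
  have Tsmall: "real (card {..<p}) * exp (- real T / 4) \<le> 1/2"
  proof -
    have "exp (- real T / 4) \<le> exp (- ln (real p) - 1)" using T by simp
    also have "\<dots> = exp (- 1) / real p" using p0 by (simp add: exp_diff exp_minus divide_inverse mult.commute)
    finally have "real p * exp (- real T / 4) \<le> exp (- 1)" using p0 by (simp add: field_simps)
    also have "\<dots> \<le> 1 - 1 / 2" by (rule exp_minus_le) auto
    finally show ?thesis by simp
  qed
  obtain t where t: "t \<in> {1..T}" "exp (real t / 8) * \<Psi> \<le> 40 * real (card {k \<in> {..<p}. H k \<le> real t})"
    using exists_level[of "{..<p}" H T] H0 Tsmall \<Psi>200 unfolding \<Psi>_def by auto
  define S where "S = {k \<in> {..<p}. H k \<le> real t}"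
  define s where "s = real (card S)"
  have sS: "exp (real t / 8) * \<Psi> \<le> 40 * s" using t(2) by (simp add: S_def s_def)
  have "1 * \<Psi> \<le> exp (real t / 8) * \<Psi>" using \<Psi>200 by (intro mult_right_mono) auto
  \<comment> \<open>200 = 5 * 40 gives more than four frequencies, hence 4 p / s < p: the Bohr sets
    below are proper and really double.\<close>
  then have s5: "s \<ge> 5" using sS \<Psi>200 by linarith
  have SS: "S \<subseteq> {..<p}" by (auto simp: S_def)
  have SS': "S \<noteq> {}" using s5 unfolding s_def by (intro notI) simp

  have "real p * exp (- real r / 16) < 1"
  proof -
    have "exp (- real r / 16) < exp (- ln (real p))" using r by simp
    also have "\<dots> = 1 / real p" using p0 by (simp add: exp_minus inverse_eq_divide)
    finally show ?thesis using p0 by (simp add: field_simps)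
  qed
  then obtain \<kappa> where \<kappa>: "\<kappa> \<in> PiE {..<r} (\<lambda>_. S)"
    "\<forall>a\<in>{0..<int p}. (\<Sum>k\<in>S. sk p (int k * a)) > real (card S) / 4 \<longrightarrow> (\<Sum>j<r. sk p (int (\<kappa> j) * a)) > 1 / 16 * real r"
    using exists_sample[OF p0 SS SS'] by blast
  have cbig: "real (card (bohr p r \<kappa> (1/16))) * s \<le> 4 * real p"
  proof -
    have "bohr p r \<kappa> (1/16) \<subseteq> {a \<in> {0..<int p}. (\<Sum>k\<in>S. sk p (int k * a)) \<le> real (card S) / 4}"
      using \<kappa>(2) unfolding bohr_def by (auto simp: not_less[symmetric])
    then have "card (bohr p r \<kappa> (1/16)) \<le> card {a \<in> {0..<int p}. (\<Sum>k\<in>S. sk p (int k * a)) \<le> real (card S) / 4}"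
      by (rule card_mono[rotated]) (rule finite_subset[of _ "{0..<int p}"], auto)
    then have "real (card (bohr p r \<kappa> (1/16))) * s \<le> real (card {a \<in> {0..<int p}. (\<Sum>k\<in>S. sk p (int k * a)) \<le> real (card S) / 4}) * s"
      using s5 by (intro mult_right_mono) auto
    also have "\<dots> \<le> 4 * real p" unfolding s_def by (rule card_small_average_sk_le[OF p SS])
    finally show ?thesis .
  qed
  define \<tau> where "\<tau> = 4 * real t / dd"
  have T1: "real T \<ge> 4" 
    using order_trans[OF _ T, of 4] lnp by simp
  have ddT: "dd \<ge> 64 * real T" using d by (simp add: dd_def)
  then have dd0: "dd > 0" using T1 by linarith
  have \<tau>: "0 < \<tau>" "\<tau> \<le> 1/16" using t(1) dd0 ddT by (auto simp: \<tau>_def field_simps)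
  \<comment> \<open>The number of quadruplings that fit between \<tau> and 1/16; its maximality
    makes 2^q of order 1 / sqrt \<tau>.\<close>
  obtain q where q: "4 ^ q * \<tau> \<le> 1/16" "1/16 < 4 ^ Suc q * \<tau>"
  proof -
    obtain n where n: "1/16 / \<tau> < 4 ^ n" using real_arch_pow[of 4 "1/16/\<tau>"] by auto
    define m where "m = (LEAST n. 1/16 < 4 ^ n * \<tau>)"
    have "1/16 < 4 ^ n * \<tau>" using n \<tau> by (simp add: field_simps)
    then have m: "1/16 < 4 ^ m * \<tau>" unfolding m_def by (rule LeastI)
    then have "m \<noteq> 0" using \<tau> by (cases m) auto
    then obtain q where q: "m = Suc q" by (cases m) auto
    have "q < m" using q by simp
    then have "\<not> 1/16 < 4 ^ q * \<tau>" unfolding m_def by (rule not_less_Least)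
    then show ?thesis using that[of q] m unfolding q by simp
  qed
  \<comment> \<open>Zero is dropped because coordinates on D are nonzero residues, and size minus
    one is the quantity that the doubling bound controls.\<close>
  define B where "B = bohr p r \<kappa> \<tau> - {0}"
  have cB: "real (card B) = real (card (bohr p r \<kappa> \<tau>)) - 1"
    using zero_in_bohr[OF p0, of \<tau> r \<kappa>] \<tau>
      card_gt_0_iff[of "bohr p r \<kappa> \<tau>"]
    unfolding B_def by (subst card_Diff_singleton) (auto simp: of_nat_diff Suc_leI)
  have sub16: "bohr p r \<kappa> (4 ^ q * \<tau>) \<subseteq> bohr p r \<kappa> (1/16)" using q by (intro bohr_mono)
  have "real (card (bohr p r \<kappa> (4 ^ q * \<tau>))) * s \<le> real (card (bohr p r \<kappa> (1/16))) * s"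
    using card_mono[OF _ sub16] s5 by (intro mult_right_mono) auto
  from order_trans[OF this cbig] have le16: "real (card (bohr p r \<kappa> (4 ^ q * \<tau>))) \<le> 4 * real p / s"
    using s5 by (simp add: pos_le_divide_eq)
  also have "\<dots> < real p" using s5 p0 by (simp add: field_simps)
  finally have "card (bohr p r \<kappa> (4 ^ q * \<tau>)) < p" by simp
  from card_bohr_doubling[OF p(1) _ this] have cB1: "2 ^ q * real (card B) \<le> 4 * real p / s"
    using cB \<tau> le16 by auto
  have q2: "1 \<le> 2 ^ q * (8 * sqrt \<tau>)"
  proof -
    have "1 \<le> 64 * \<tau> * 4 ^ q" using q(2) by (simp add: mult_ac)
    also have "\<dots> = (2 ^ q * (8 * sqrt \<tau>))\<^sup>2"
      using \<tau> by (simp add: power_mult_distrib power_mult[symmetric] mult.commute[of q 2])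
        (simp add: power_mult)
    finally show ?thesis using \<tau> by (metis abs_of_nonneg abs_le_square_iff abs_one less_eq_real_def mult_nonneg_nonneg one_power2 real_sqrt_ge_zero zero_le_numeral zero_le_power)
  qed
  have cB2: "real (card B) \<le> 8 * sqrt \<tau> * (4 * real p / s)"
  proof -
    have "real (card B) * 1 \<le> real (card B) * (2 ^ q * (8 * sqrt \<tau>))"
      using q2 by (intro mult_left_mono) auto
    also have "\<dots> = (2 ^ q * real (card B)) * (8 * sqrt \<tau>)" by simp
    also have "\<dots> \<le> (4 * real p / s) * (8 * sqrt \<tau>)" using cB1 \<tau> by (intro mult_right_mono) auto
    finally show ?thesis by (simp add: mult.commute)
  qed
  have tt: "sqrt (real t) \<le> 2 * exp (real t / 8)"
  proof -
    have "real t / 4 \<le> exp (real t / 4)"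
      by (rule order_trans[OF _ exp_ge_add_one_self]) simp
    then have "real t \<le> 4 * exp (real t / 4)" by simp
    also have "\<dots> = (2 * exp (real t / 8))\<^sup>2" by (simp add: power_mult_distrib exp_double[symmetric])
    finally show ?thesis by (simp add: real_le_lsqrt real_sqrt_le_iff)
  qed
  have cB3: "real (card B) \<le> 5120 / sqrt dd * (real p / \<Psi>)"
  proof -
    have "8 * sqrt \<tau> * (4 * real p / s) = 64 * sqrt (real t) / sqrt dd * real p / s"
      by (simp add: \<tau>_def real_sqrt_divide real_sqrt_mult)
    also have "\<dots> \<le> 64 * (2 * exp (real t / 8)) / sqrt dd * real p / (exp (real t / 8) * \<Psi> / 40)"
      using tt sS \<Psi>200 dd0 by (intro frac_le mult_right_mono divide_right_mono mult_left_mono) auto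
    also have "\<dots> = 5120 / sqrt dd * (real p / \<Psi>)" by (simp add: field_simps)
    finally show ?thesis using cB2 by simp
  qed
  obtain Y where Y: "Y \<subseteq> D" "2 * card Y \<le> card D" "real p * R p Y v \<le> 2 * \<Psi>"
    using exists_half_subset[OF D p0, of v] unfolding \<Psi>_def H_def by blast
  define E where "E = {i \<in> D. (\<Sum>j<r. sk p (int (\<kappa> j) * v i)) > \<tau> * real r}"
  have r0: "real r > 0" using r lnp by linarith
  have "real (card E) * (\<tau> * real r) \<le> (\<Sum>i\<in>E. \<Sum>j<r. sk p (int (\<kappa> j) * v i))"
    using sum_mono[of E "\<lambda>_. \<tau> * real r" "\<lambda>i. \<Sum>j<r. sk p (int (\<kappa> j) * v i)"] by (simp add: E_def)
  also have "\<dots> \<le> (\<Sum>i\<in>D. \<Sum>j<r. sk p (int (\<kappa> j) * v i))"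
    using D by (intro sum_mono2 sum_nonneg) (auto simp: E_def)
  also have "\<dots> = (\<Sum>j<r. H (\<kappa> j))" unfolding H_def by (rule sum.swap)
  also have "\<dots> \<le> (\<Sum>j<r. real t)"
    using \<kappa>(1) by (intro sum_mono) (auto simp: S_def PiE_iff)
  finally have "real (card E) * \<tau> * real r \<le> real t * real r" by (simp add: mult_ac)
  then have "real (card E) * \<tau> \<le> real t" using r0 by simp
  then have cE: "4 * card E \<le> card D"
    using dd0 t(1) by (simp add: \<tau>_def field_simps dd_def)
  have fin: "finite Y" "finite E" using Y(1) D finite_subset by (auto simp: E_def)
  show ?thesis
  proof (intro bexI[of _ \<kappa>] bexI[of _ t] exI[of _ "Y \<union> E"] conjI)
    show "\<kappa> \<in> PiE {..<r} (\<lambda>_. {..<p})" using \<kappa>(1) SS by (auto simp: PiE_iff)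
    show "t \<in> {1..T}" by fact
    show "Y \<union> E \<subseteq> D" using Y by (auto simp: E_def)
    show "4 * card (Y \<union> E) \<le> 3 * card D" using card_Un_le[of Y E] Y(2) cE by linarith
    show "\<forall>i\<in>D - (Y \<union> E). v i \<in> bohr p r \<kappa> (4 * real t / real (card D)) - {0}"
    proof
      fix i assume i: "i \<in> D - (Y \<union> E)"
      then have "(\<Sum>j<r. sk p (int (\<kappa> j) * v i)) \<le> \<tau> * real r" by (simp add: E_def not_less)
      then show "v i \<in> bohr p r \<kappa> (4 * real t / real (card D)) - {0}"
        using v[of i] i by (simp add: bohr_def \<tau>_def dd_def)
    qed
    have "real (card B) * R p (Y \<union> E) v \<le> real (card B) * R p Y v"
      using fin by (intro mult_left_mono R_mono) auto
    also have "\<dots> \<le> (5120 / sqrt dd * (real p / \<Psi>)) * R p Y v"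
      using cB3 by (intro mult_right_mono R_nonneg)
    also have "\<dots> = 5120 / sqrt dd / \<Psi> * (real p * R p Y v)" by simp
    also have "\<dots> \<le> 5120 / sqrt dd / \<Psi> * (2 * \<Psi>)"
      using Y(3) dd0 \<Psi>200 by (intro mult_left_mono) auto
    also have "\<dots> = 10240 / sqrt dd" using \<Psi>200 by simp
    finally show "real (card (bohr p r \<kappa> (4 * real t / real (card D)) - {0})) * R p (Y \<union> E) v \<le> 10240 / sqrt (real (card D))"
      unfolding B_def \<tau>_def dd_def .
  qed
qed

section \<open>Random symmetric systems modulo a prime\<close>

text \<open>A random symmetric matrix on the index set \<open>D\<close> is a random sign function \<open>m\<close> on \<open>pairs D\<close>: its
  entries are \<open>m {i, j}\<close>, the diagonal ones being \<open>m {i}\<close>.\<close>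

definition pairs :: "nat set \<Rightarrow> nat set set" where
  "pairs D = {{i, j} | i j. i \<in> D \<and> j \<in> D}"

lemma pairsI: "i \<in> D \<Longrightarrow> j \<in> D \<Longrightarrow> {i, j} \<in> pairs D"
  by (auto simp: pairs_def)

lemma finite_pairs [simp]: "finite D \<Longrightarrow> finite (pairs D)"
  by (rule finite_subset[of _ "Pow D"]) (auto simp: pairs_def)

lemma pairs_mono: "D \<subseteq> E \<Longrightarrow> pairs D \<subseteq> pairs E"
  by (auto simp: pairs_def)

definition star :: "nat \<Rightarrow> nat set \<Rightarrow> nat set set" where
  "star z D = (\<lambda>l. {z, l}) ` D"

lemma pairs_insert: "pairs (insert z D) = star z (insert z D) \<union> pairs D"
  by (auto simp: pairs_def star_def insert_commute)

lemma star_insert: "star z (insert z D) = insert {z} (star z D)"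
  by (auto simp: star_def)

lemma finite_star [simp]: "finite D \<Longrightarrow> finite (star z D)"
  by (simp add: star_def)

lemma star_Int_pairs: "z \<notin> D \<Longrightarrow> star z E \<inter> pairs D = {}"
  by (auto simp: star_def pairs_def doubleton_eq_iff)

lemma inj_on_doubleton: "inj_on (\<lambda>l. {z, l}) D"
  by (auto simp: inj_on_def doubleton_eq_iff)

definition solves :: "nat \<Rightarrow> (nat set \<Rightarrow> int) \<Rightarrow> nat set \<Rightarrow> (nat \<Rightarrow> int) \<Rightarrow> (nat \<Rightarrow> int) \<Rightarrow> bool" where
  "solves p m D v w \<longleftrightarrow> (\<forall>i\<in>D. [(\<Sum>l\<in>D. m {i, l} * v l) = w i] (mod int p))"

text \<open>Small-ball probability of the whole system. The supremum makes it stable under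
  conditioning: removing an index z shifts the right-hand side by column z times
  \<open>v z\<close>.\<close>

definition pr :: "nat \<Rightarrow> nat set \<Rightarrow> (nat \<Rightarrow> int) \<Rightarrow> real" where
  "pr p D v = (SUP w. avg (pairs D) (\<lambda>m. of_bool (solves p m D v w)))"

lemma avg_of_bool_le_1: "finite A \<Longrightarrow> avg A (\<lambda>x. of_bool (P x)) \<le> 1"
  by (rule avg_le_const) auto

lemma avg_solves_le_pr:
  assumes "finite D"
  shows "avg (pairs D) (\<lambda>m. of_bool (solves p m D v w)) \<le> pr p D v"
  unfolding pr_def
  by (rule cSUP_upper2[OF _ UNIV_I order_refl])
     (use assms in \<open>auto intro!: bdd_aboveI2[of _ _ 1] avg_of_bool_le_1\<close>)

lemma pr_le:
  assumes "\<And>w. avg (pairs D) (\<lambda>m. of_bool (solves p m D v w)) \<le> c"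
  shows "pr p D v \<le> c"
  unfolding pr_def using assms by (intro cSUP_least) auto

lemma pr_nonneg:
  assumes "finite D"
  shows "0 \<le> pr p D v"
  by (rule order_trans[OF avg_nonneg avg_solves_le_pr[OF assms]]) simp

lemma pr_le_1: "finite D \<Longrightarrow> pr p D v \<le> 1"
  by (intro pr_le avg_of_bool_le_1) simp

lemma pr_cong: "(\<And>i. i \<in> D \<Longrightarrow> v i = v' i) \<Longrightarrow> pr p D v = pr p D v'"
  by (simp add: pr_def solves_def cong: sum.cong)

lemma avg_star_row_le_R:
  assumes "finite D" "p > 0"
  shows "avg (star z D) (\<lambda>m. of_bool ([(\<Sum>l\<in>D. m {z, l} * v l) = b] (mod int p))) \<le> R p D v"
proof -
  have "avg (star z D) (\<lambda>m. of_bool ([(\<Sum>l\<in>D. m {z, l} * v l) = b] (mod int p)))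
      = avg (star z D) (\<lambda>m. (\<lambda>x. of_bool ([(\<Sum>l\<in>D. x l * v l) = b] (mod int p))) (restrict (m \<circ> (\<lambda>l. {z, l})) D))"
    by simp
  also have "\<dots> = avg D (\<lambda>x. of_bool ([(\<Sum>l\<in>D. x l * v l) = b] (mod int p)))"
    unfolding star_def by (rule avg_reindex[OF inj_on_doubleton])
  also have "\<dots> \<le> R p D v" by (rule avg_cong_le_R[OF assms])
  finally show ?thesis .
qed

text \<open>Row and column z are exposed first. Given the diagonal entry, the other signs must
  satisfy one linear congruence, at cost \<open>R p D v\<close>. What remains is an independent
  symmetric system on D with shifted right-hand side.\<close>

lemma pr_insert:
  assumes "finite D" "z \<notin> D" "p > 0"
  shows "pr p (insert z D) v \<le> R p D v * pr p D v"
proof (rule pr_le)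
  fix w
  let ?S = "star z (insert z D)"
  let ?row = "\<lambda>x. of_bool ([(\<Sum>l\<in>D. x {z, l} * v l) = w z - x {z} * v z] (mod int p)) :: real"
  have eq: "solves p (override_on y x ?S) (insert z D) v w \<longleftrightarrow>
      [(\<Sum>l\<in>D. x {z, l} * v l) = w z - x {z} * v z] (mod int p) \<and>
      solves p y D v (\<lambda>i. w i - x {z, i} * v z)" for x y
  proof -
    have S1: "override_on y x ?S {z, l} = x {z, l}" if "l \<in> insert z D" for l
      using that by (auto simp: override_on_def star_def)
    have S2: "override_on y x ?S {i, l} = y {i, l}" if "i \<in> D" "l \<in> D" for i l
      using that assms(2) by (auto simp: override_on_def star_def doubleton_eq_iff)
    have S3: "override_on y x ?S {i, z} = x {z, i}" if "i \<in> D" for i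
      using S1[of i] that by (simp add: insert_commute)
    have 1: "(\<Sum>l\<in>insert z D. override_on y x ?S {z, l} * v l) = x {z} * v z + (\<Sum>l\<in>D. x {z, l} * v l)"
      using assms S1 S1[of z] by (simp cong: sum.cong)
    have 2: "(\<Sum>l\<in>insert z D. override_on y x ?S {i, l} * v l) = x {z, i} * v z + (\<Sum>l\<in>D. y {i, l} * v l)"
      if "i \<in> D" for i
      using assms S2 S3 that by (simp cong: sum.cong)
    have 3: "[a + b = c] (mod int p) \<longleftrightarrow> [b = c - a] (mod int p)" for a b c
      by (simp add: cong_iff_dvd_diff algebra_simps)
    show ?thesis
      unfolding solves_def ball_simps(7) 1 by (simp add: 2 3)
  qed
  have "avg (pairs (insert z D)) (\<lambda>m. of_bool (solves p m (insert z D) v w))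
      = avg ?S (\<lambda>x. avg (pairs D) (\<lambda>y. of_bool (solves p (override_on y x ?S) (insert z D) v w)))"
    unfolding pairs_insert using assms by (intro avg_union star_Int_pairs) auto
  also have "\<dots> = avg ?S (\<lambda>x. ?row x * avg (pairs D) (\<lambda>y. of_bool (solves p y D v (\<lambda>i. w i - x {z, i} * v z))))"
    unfolding eq avg_cmult[symmetric] by (simp add: of_bool_conj)
  also have "\<dots> \<le> avg ?S (\<lambda>x. ?row x * pr p D v)"
    using assms(1) by (intro avg_mono mult_left_mono avg_solves_le_pr) auto
  also have "\<dots> = avg ?S ?row * pr p D v" by (rule avg_cmult_right)
  also have "\<dots> \<le> R p D v * pr p D v"
  proof (rule mult_right_mono)
    have "avg ?S ?row = avg ({{z}} \<union> star z D) ?row" by (simp add: star_insert)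
    also have "\<dots> = avg {{z}} (\<lambda>a. avg (star z D) (\<lambda>x. ?row (override_on x a {{z}})))"
      using assms by (intro avg_union) (auto simp: star_def)
    also have "\<dots> = avg {{z}} (\<lambda>a. avg (star z D)
        (\<lambda>x. of_bool ([(\<Sum>l\<in>D. x {z, l} * v l) = w z - a {z} * v z] (mod int p))))"
    proof -
      have "(\<Sum>l\<in>D. override_on x a {{z}} {z, l} * v l) = (\<Sum>l\<in>D. x {z, l} * v l)" for x a
        using assms(2) by (intro sum.cong) (auto simp: override_on_def)
      then show ?thesis by simp
    qed
    also have "\<dots> \<le> R p D v"
      using assms by (intro avg_le_const avg_star_row_le_R) auto
    finally show "avg ?S ?row \<le> R p D v" .
  qed (rule pr_nonneg[OF assms(1)])
  finally show "avg (pairs (insert z D)) (\<lambda>m. of_bool (solves p m (insert z D) v w)) \<le> R p D v * pr p D v" .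
qed

text \<open>Each new row is bounded by its concentration on D alone, R being monotone. The bound
  does not see the values of v on Z, which can therefore be counted separately.\<close>

lemma pr_union:
  assumes "finite Z" "finite D" "Z \<inter> D = {}" "p > 0"
  shows "pr p (D \<union> Z) v \<le> R p D v ^ card Z * pr p D v"
  using assms(1,3)
proof (induction Z)
  case (insert z Z)
  have "pr p (D \<union> insert z Z) v = pr p (insert z (D \<union> Z)) v" by simp
  also have "\<dots> \<le> R p (D \<union> Z) v * pr p (D \<union> Z) v"
    using insert assms by (intro pr_insert) auto
  also have "\<dots> \<le> R p D v * (R p D v ^ card Z * pr p D v)"
    using insert assms by (intro mult_mono R_mono R_nonneg pr_nonneg) auto
  finally show ?case using insert by (simp add: mult.assoc)
qed simp

text \<open>Starting from the single index i, every further row costs at most 3/4.\<close>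

lemma pr_nonzero_le:
  assumes "finite J" "i \<in> J" "prime p" "odd p" "\<not> int p dvd v i"
  shows "pr p J v \<le> (3/4) ^ (card J - 1)"
proof -
  have p0: "p > 0" using assms by (simp add: prime_gt_0_nat)
  have "\<not> int p dvd 2 * v i" using assms(4,5) by (simp add: coprime_dvd_mult_right_iff)
  have "pr p J v = pr p ({i} \<union> (J - {i})) v" using assms by (simp add: insert_absorb)
  also have "\<dots> \<le> R p {i} v ^ card (J - {i}) * pr p {i} v"
    using assms p0 by (intro pr_union) auto
  also have "\<dots> \<le> (3/4) ^ card (J - {i}) * 1"
    by (intro mult_mono power_mono R_singleton pr_le_1 R_nonneg pr_nonneg p0) (auto simp: \<open>\<not> int p dvd 2 * v i\<close>)
  finally show ?thesis using assms by simp
qed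

text \<open>Entries avoid 0, so D is exactly the support. Extensional functions keep these sets
  finite and let vectors be split along subsets of D.\<close>

definition struct_vecs :: "nat \<Rightarrow> real \<Rightarrow> nat set \<Rightarrow> (nat \<Rightarrow> int) set" where
  "struct_vecs p \<beta> D = {v \<in> PiE D (\<lambda>_. {1..<int p}). \<beta> \<le> R p D v}"

lemma finite_struct_vecs [simp]: "finite D \<Longrightarrow> finite (struct_vecs p \<beta> D)"
  by (rule finite_subset[of _ "PiE D (\<lambda>_. {1..<int p})"]) (auto simp: struct_vecs_def finite_PiE)

lemma card_struct_vecs_le:
  assumes "finite D"
  shows "card (struct_vecs p \<beta> D) \<le> p ^ card D"
proof -
  have "card (struct_vecs p \<beta> D) \<le> card (PiE D (\<lambda>_. {1..<int p}))"
    using assms by (intro card_mono finite_PiE) (auto simp: struct_vecs_def)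
  also have "\<dots> = (p - 1) ^ card D" using assms by (simp add: card_PiE) (simp add: nat_diff_distrib')
  also have "\<dots> \<le> p ^ card D" by (intro power_mono) auto
  finally show ?thesis .
qed

lemma inj_on_restrict_pair: "inj_on (\<lambda>v. (restrict v A, restrict v B)) (PiE (A \<union> B) F)"
proof (rule inj_onI)
  fix x y assume xy: "x \<in> PiE (A \<union> B) F" "y \<in> PiE (A \<union> B) F" "(restrict x A, restrict x B) = (restrict y A, restrict y B)"
  show "x = y"
  proof (rule PiE_ext[OF xy(1,2)])
    fix i assume "i \<in> A \<union> B"
    then show "x i = y i" using xy(3) by (auto simp: fun_eq_iff restrict_def split: if_splits)
  qed
qed

lemma sum_PiE_Un_le:
  fixes g :: "('a \<Rightarrow> 'b) \<Rightarrow> real"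
  assumes "finite V" "finite W" and sub: "X \<subseteq> PiE (A \<union> B) F"
    and V: "\<And>v. v \<in> X \<Longrightarrow> restrict v A \<in> V" and W: "\<And>v. v \<in> X \<Longrightarrow> restrict v B \<in> W"
    and g: "\<And>v. v \<in> V \<Longrightarrow> 0 \<le> g v" and f: "\<And>v. v \<in> X \<Longrightarrow> f v \<le> g (restrict v A)"
  shows "sum f X \<le> real (card W) * sum g V"
proof -
  have inj: "inj_on (\<lambda>v. (restrict v A, restrict v B)) X"
    using inj_on_restrict_pair inj_on_subset sub by blast
  have "sum f X \<le> (\<Sum>v\<in>X. g (restrict v A))" by (intro sum_mono f)
  also have "\<dots> = (\<Sum>u\<in>(\<lambda>v. (restrict v A, restrict v B)) ` X. g (fst u))"
    using inj by (simp add: sum.reindex)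
  also have "\<dots> \<le> (\<Sum>u\<in>V \<times> W. g (fst u))"
    using assms by (intro sum_mono2) auto
  also have "\<dots> = (\<Sum>v\<in>V. \<Sum>w\<in>W. g v)" unfolding sum.cartesian_product by (simp add: case_prod_beta)
  finally show ?thesis by (simp add: sum_distrib_left)
qed

section \<open>Counting structured vectors\<close>

text \<open>Here \<open>r\<close> is the number of sampled frequencies, \<open>T\<close> bounds the levels, and supports of size at most \<open>s\<close> are
  enumerated trivially.\<close>

locale lo_setup =
  fixes p r T s :: nat and \<beta> :: real
  assumes prime: "prime p" and odd: "odd p"
    and r: "real r > 16 * ln (real p)" and T: "real T \<ge> 4 * (ln (real p) + 1)"
    and s: "s \<ge> 64 * T" "s \<ge> 10240\<^sup>2" and \<beta>: "200 \<le> real p * \<beta>"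
begin

text \<open>Gain per removed coordinate: 10240 / sqrt (card D) at its worst value, as rounds stop
  once D has at most s elements.\<close>

definition \<gamma> :: real where "\<gamma> = 10240 / sqrt (real s)"

definition N :: nat where "N = T * p ^ r"

lemma p_pos: "p > 0" using prime by (simp add: prime_gt_0_nat)

lemma T_pos: "T > 0"
proof -
  have "ln (real p) \<ge> 0" using p_pos by simp
  then have "0 < real T" using order_less_le_trans[OF _ T, of 0] by simp
  then show ?thesis by simp
qed

lemma N_ge_1: "1 \<le> N" using T_pos p_pos by (simp add: N_def Suc_le_eq)

lemma \<gamma>_pos: "0 < \<gamma>" using s by (simp add: \<gamma>_def)

lemma \<gamma>_le_1: "\<gamma> \<le> 1"
proof -
  have "10240 = sqrt (10240\<^sup>2)" by simp
  also have "\<dots> \<le> sqrt (real s)"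
    using s(2) by (intro real_sqrt_le_mono) (metis of_nat_le_iff of_nat_numeral of_nat_power)
  finally show ?thesis using s by (simp add: \<gamma>_def divide_le_eq)
qed

definition codes :: "nat set \<Rightarrow> ((nat \<Rightarrow> nat) \<times> nat \<times> nat set) set" where
  "codes D = PiE {..<r} (\<lambda>_. {..<p}) \<times> {1..T} \<times> {D'. D' \<subseteq> D \<and> 4 * card D' \<le> 3 * card D}"

definition container :: "nat set \<Rightarrow> (nat \<Rightarrow> nat) \<Rightarrow> nat \<Rightarrow> int set" where
  "container D \<kappa> t = bohr p r \<kappa> (4 * real t / real (card D)) - {0}"

lemma finite_container [simp]: "finite (container D \<kappa> t)"
  by (simp add: container_def)

lemma finite_codes: "finite D \<Longrightarrow> finite (codes D)"
  unfolding codes_def by (intro finite_cartesian_product finite_PiE) auto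

lemma card_codes_le:
  assumes "finite D"
  shows "card (codes D) \<le> N * 2 ^ card D"
proof -
  have "card {D'. D' \<subseteq> D \<and> 4 * card D' \<le> 3 * card D} \<le> card (Pow D)"
    using assms by (intro card_mono) auto
  then show ?thesis
    using assms by (simp add: codes_def card_cartesian_product card_PiE N_def card_Pow)
qed

lemma exists_code:
  assumes "finite D" "s \<le> card D" "v \<in> struct_vecs p \<beta> D"
  shows "\<exists>(\<kappa>, t, D')\<in>codes D. (\<forall>i\<in>D - D'. v i \<in> container D \<kappa> t) \<and>
    real (card (container D \<kappa> t)) * R p D' v \<le> \<gamma>"
proof -
  have v: "v i \<in> {1..<int p}" if "i \<in> D" for i
    using assms(3) that by (auto simp: struct_vecs_def PiE_iff)
  have "200 \<le> real p * \<beta>" by (rule \<beta>)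
  also have "\<dots> \<le> real p * R p D v"
    using assms(3) by (intro mult_left_mono) (auto simp: struct_vecs_def)
  finally have R: "200 \<le> real p * R p D v" .
  have dT: "64 * T \<le> card D" using assms(2) s(1) by linarith
  obtain \<kappa> t D' where 1: "\<kappa> \<in> PiE {..<r} (\<lambda>_. {..<p})" "t \<in> {1..T}" "D' \<subseteq> D" "4 * card D' \<le> 3 * card D"
    "\<forall>i\<in>D - D'. v i \<in> container D \<kappa> t"
    "real (card (container D \<kappa> t)) * R p D' v \<le> 10240 / sqrt (real (card D))"
    using inverse_littlewood_offord_step[OF prime odd assms(1) r T dT R v] unfolding container_def by blast
  have "10240 / sqrt (real (card D)) \<le> \<gamma>"
    unfolding \<gamma>_def using assms(2) s by (intro divide_left_mono mult_pos_pos) auto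
  then have "real (card (container D \<kappa> t)) * R p D' v \<le> \<gamma>" using 1(6) by linarith
  then show ?thesis
    using 1(1-5) by (intro bexI[of _ "(\<kappa>, t, D')"]) (auto simp: codes_def)
qed

text \<open>A container that holds some coordinate is nonempty, so the bound on the product also
  bounds R on D', hence on the larger D. It supplies the gain for indices outside the
  support.\<close>

lemma R_le_\<gamma>:
  assumes "finite D" "s \<le> card D" "v \<in> struct_vecs p \<beta> D"
  shows "R p D v \<le> \<gamma>"
proof -
  obtain \<kappa> t D' where c: "(\<kappa>, t, D') \<in> codes D" "\<forall>i\<in>D - D'. v i \<in> container D \<kappa> t"
    "real (card (container D \<kappa> t)) * R p D' v \<le> \<gamma>"
    using exists_code[OF assms] by blast
  have "card D > 0" using assms(2) s T_pos by linarith
  then have "D - D' \<noteq> {}" using c(1) assms(1) by (auto simp: codes_def)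
  then have "container D \<kappa> t \<noteq> {}" using c(2) by blast
  then have "1 \<le> real (card (container D \<kappa> t))" by (simp add: Suc_le_eq card_gt_0_iff)
  then have "1 * R p D' v \<le> real (card (container D \<kappa> t)) * R p D' v"
    by (intro mult_right_mono R_nonneg)
  moreover have "R p D v \<le> R p D' v" using c(1) assms(1) by (intro R_mono) (auto simp: codes_def)
  ultimately show ?thesis using c(3) by simp
qed

text \<open>With Z = D - D', adding the rows of Z costs \<open>R p D' v\<close> to the power card Z,
  while v has at most one container's worth of choices for each coordinate on Z. Cost and choices
  multiply to at most \<gamma> per coordinate, which is why the inverse lemma bounds this
  product.\<close>

lemma sum_pr_le_step:
  assumes "finite D" "s \<le> card D" "D' \<subseteq> D"
  shows "(\<Sum>v | v \<in> struct_vecs p \<beta> D \<and> (\<forall>i\<in>D - D'. v i \<in> container D \<kappa> t) \<and>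
      real (card (container D \<kappa> t)) * R p D' v \<le> \<gamma>. pr p D v)
    \<le> \<gamma> ^ (card D - card D') * (\<Sum>v\<in>struct_vecs p \<beta> D'. pr p D' v)"
proof -
  let ?B = "container D \<kappa> t"
  let ?Z = "D - D'"
  let ?X = "{v. v \<in> struct_vecs p \<beta> D \<and> (\<forall>i\<in>?Z. v i \<in> ?B) \<and> real (card ?B) * R p D' v \<le> \<gamma>}"
  define g where "g v = (if real (card ?B) * R p D' v \<le> \<gamma> then R p D' v ^ card ?Z * pr p D' v else 0)" for v
  have finD': "finite D'" using assms finite_subset by blast
  have D: "D' \<union> ?Z = D" using assms(3) by blast
  have cZ: "card ?Z = card D - card D'" using assms finD' by (simp add: card_Diff_subset)
  have Rr: "R p D' (restrict v D') = R p D' v" for v by (rule R_cong[OF p_pos]) simp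
  have prr: "pr p D' (restrict v D') = pr p D' v" for v by (rule pr_cong) simp
  have "(\<Sum>v\<in>?X. pr p D v) \<le> real (card (PiE ?Z (\<lambda>_. ?B))) * (\<Sum>v\<in>struct_vecs p \<beta> D'. g v)"
  proof (rule sum_PiE_Un_le[where A = D' and B = ?Z and F = "\<lambda>_. {1..<int p}"])
    show "?X \<subseteq> PiE (D' \<union> ?Z) (\<lambda>_. {1..<int p})" unfolding D by (auto simp: struct_vecs_def)
    show "finite (PiE ?Z (\<lambda>_. ?B))" using assms(1) by (intro finite_PiE) auto
    fix v assume v: "v \<in> ?X"
    have "R p D v \<le> R p D' v" using assms by (intro R_mono)
    then show "restrict v D' \<in> struct_vecs p \<beta> D'"
      using v assms(3) unfolding struct_vecs_def by (auto simp: Rr PiE_iff)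
    show "restrict v ?Z \<in> PiE ?Z (\<lambda>_. ?B)" using v by auto
    have "pr p D v \<le> R p D' v ^ card ?Z * pr p D' v"
      using pr_union[of ?Z D' p v] finD' assms(1) p_pos unfolding D by auto
    then show "pr p D v \<le> g (restrict v D')" using v by (simp add: g_def Rr prr)
  qed (use finD' in \<open>auto simp: g_def intro!: mult_nonneg_nonneg zero_le_power R_nonneg pr_nonneg\<close>)
  also have "\<dots> = (\<Sum>v\<in>struct_vecs p \<beta> D'. real (card ?B) ^ card ?Z * g v)"
    using assms(1) by (simp add: card_PiE sum_distrib_left)
  also have "\<dots> \<le> (\<Sum>v\<in>struct_vecs p \<beta> D'. \<gamma> ^ card ?Z * pr p D' v)"
  proof (rule sum_mono)
    fix v
    show "real (card ?B) ^ card ?Z * g v \<le> \<gamma> ^ card ?Z * pr p D' v"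
    proof (cases "real (card ?B) * R p D' v \<le> \<gamma>")
      case True
      have "real (card ?B) ^ card ?Z * g v = (real (card ?B) * R p D' v) ^ card ?Z * pr p D' v"
        using True by (simp add: g_def power_mult_distrib)
      also have "\<dots> \<le> \<gamma> ^ card ?Z * pr p D' v"
        using True finD' by (intro mult_right_mono power_mono pr_nonneg mult_nonneg_nonneg R_nonneg) auto
      finally show ?thesis .
    next
      case False
      then show ?thesis using \<gamma>_pos pr_nonneg[OF finD'] by (simp add: g_def)
    qed
  qed
  finally show ?thesis unfolding cZ by (simp add: sum_distrib_left)
qed

lemma sum_pr_struct_vecs_le_trivial:
  assumes "finite D" "card D \<le> s"
  shows "(\<Sum>v\<in>struct_vecs p \<beta> D. pr p D v) \<le> real p ^ s * real N ^ K * 2 ^ (4 * card D) * (\<gamma> ^ card D / \<gamma> ^ s)"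
proof -
  have "(\<Sum>v\<in>struct_vecs p \<beta> D. pr p D v) \<le> real (card (struct_vecs p \<beta> D)) * 1"
    using assms by (intro sum_bounded_above pr_le_1)
  also have "\<dots> \<le> real (p ^ card D)"
    using card_struct_vecs_le[OF assms(1), of p \<beta>] by simp
  also have "\<dots> \<le> real p ^ s * 1 * 1 * 1"
    using assms(2) p_pos by (simp add: power_increasing)
  also have "\<dots> \<le> real p ^ s * real N ^ K * 2 ^ (4 * card D) * (\<gamma> ^ card D / \<gamma> ^ s)"
  proof (intro mult_mono order_refl)
    show "1 \<le> real N ^ K" using N_ge_1 by (intro one_le_power) simp
    have "\<gamma> ^ s \<le> \<gamma> ^ card D" using assms(2) \<gamma>_pos \<gamma>_le_1 by (intro power_decreasing) auto
    then show "1 \<le> \<gamma> ^ card D / \<gamma> ^ s" using \<gamma>_pos by (simp add: le_divide_eq)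
  qed auto
  finally show ?thesis .
qed

text \<open>A round passes to D' of at most 3/4 the size, pays N * 2^card D for the code and gains
  \<gamma> per removed coordinate; R only grows on subsets, so restrictions stay structured. The
  subset costs form a geometric series with sum 4, hence 2^(4 card D). The last at most s
  coordinates are enumerated, which costs p^s and forgoes \<gamma>^s.\<close>

lemma sum_pr_struct_vecs_le:
  assumes "finite D" "real (card D) \<le> real s * (4/3) ^ K"
  shows "(\<Sum>v\<in>struct_vecs p \<beta> D. pr p D v) \<le> real p ^ s * real N ^ K * 2 ^ (4 * card D) * (\<gamma> ^ card D / \<gamma> ^ s)"
  using assms
proof (induction K arbitrary: D)
  case 0
  then show ?case using sum_pr_struct_vecs_le_trivial[of D 0] by simp
next
  case (Suc K)
  show ?case
  proof (cases "card D \<le> s")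
    case True
    then show ?thesis using sum_pr_struct_vecs_le_trivial[OF Suc.prems(1)] by blast
  next
    case False
    then have sD: "s \<le> card D" by simp
    define c where "c x v \<longleftrightarrow> (case x of (\<kappa>, t, D') \<Rightarrow> (\<forall>i\<in>D - D'. v i \<in> container D \<kappa> t) \<and>
        real (card (container D \<kappa> t)) * R p D' v \<le> \<gamma>)" for x v
    let ?b = "real p ^ s * real N ^ K * 2 ^ (3 * card D) * (\<gamma> ^ card D / \<gamma> ^ s)"
    have bound: "(\<Sum>v | v \<in> struct_vecs p \<beta> D \<and> c x v. pr p D v) \<le> ?b" if x: "x \<in> codes D" for x
    proof -
      obtain \<kappa> t D' where x': "x = (\<kappa>, t, D')" by (cases x) auto
      have D': "D' \<subseteq> D" "4 * card D' \<le> 3 * card D" using x by (auto simp: x' codes_def)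
      have fin': "finite D'" using D'(1) Suc.prems(1) finite_subset by blast
      have le: "card D' \<le> card D" using D'(1) Suc.prems(1) by (intro card_mono)
      have "real (4 * card D') \<le> real (3 * card D)" using D'(2) by (simp only: of_nat_le_iff)
      then have "real (card D') \<le> real s * (4/3) ^ K" using Suc.prems(2) by simp
      note IH = Suc.IH[OF fin' this]
      have "(\<Sum>v | v \<in> struct_vecs p \<beta> D \<and> c x v. pr p D v)
          \<le> \<gamma> ^ (card D - card D') * (\<Sum>v\<in>struct_vecs p \<beta> D'. pr p D' v)"
        using sum_pr_le_step[OF Suc.prems(1) sD D'(1), of \<kappa> t] by (simp add: c_def x')
      also have "\<dots> \<le> \<gamma> ^ (card D - card D') * (real p ^ s * real N ^ K * 2 ^ (4 * card D') * (\<gamma> ^ card D' / \<gamma> ^ s))"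
        using \<gamma>_pos by (intro mult_left_mono IH) auto
      also have "\<dots> = real p ^ s * real N ^ K * 2 ^ (4 * card D') * (\<gamma> ^ card D / \<gamma> ^ s)"
        using le by (simp add: power_add[symmetric] mult_ac)
      also have "\<dots> \<le> ?b"
        using D'(2) \<gamma>_pos by (intro mult_right_mono mult_left_mono power_increasing) auto
      finally show ?thesis .
    qed
    have "(\<Sum>v\<in>struct_vecs p \<beta> D. pr p D v)
        \<le> (\<Sum>v\<in>struct_vecs p \<beta> D. \<Sum>x\<in>codes D. of_bool (c x v) * pr p D v)"
    proof (rule sum_mono)
      fix v assume "v \<in> struct_vecs p \<beta> D"
      then obtain x where x: "x \<in> codes D" "c x v"
        using exists_code[OF Suc.prems(1) sD] by (force simp: c_def)
      then have "pr p D v = of_bool (c x v) * pr p D v" by simp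
      also have "\<dots> \<le> (\<Sum>x\<in>codes D. of_bool (c x v) * pr p D v)"
        using x Suc.prems by (intro member_le_sum mult_nonneg_nonneg pr_nonneg finite_codes) auto
      finally show "pr p D v \<le> (\<Sum>x\<in>codes D. of_bool (c x v) * pr p D v)" .
    qed
    also have "\<dots> = (\<Sum>x\<in>codes D. \<Sum>v\<in>struct_vecs p \<beta> D. of_bool (c x v) * pr p D v)" by (rule sum.swap)
    also have "\<dots> = (\<Sum>x\<in>codes D. \<Sum>v | v \<in> struct_vecs p \<beta> D \<and> c x v. pr p D v)"
      using Suc.prems(1) by (intro sum.cong refl sum.mono_neutral_cong_right) auto
    also have "\<dots> \<le> real (card (codes D)) * ?b" by (intro sum_bounded_above bound)
    also have "\<dots> \<le> real (N * 2 ^ card D) * ?b"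
      using card_codes_le[OF Suc.prems(1)] \<gamma>_pos by (intro mult_right_mono) (auto simp del: of_nat_mult)
    also have "\<dots> = real p ^ s * real N ^ Suc K * 2 ^ (4 * card D) * (\<gamma> ^ card D / \<gamma> ^ s)"
    proof -
      have "(2::real) ^ (4 * card D) = 2 ^ card D * 2 ^ (3 * card D)" by (simp add: power_add[symmetric])
      then show ?thesis by simp
    qed
    finally show ?thesis .
  qed
qed

text \<open>U will hold the resampled coordinates: structure is tested off U, and values on U are
  counted crudely. Vectors are sorted by their support D off U. If card D \<le> s they are few, and
  being nonzero each costs (3/4)^(card J - 1). Otherwise the rounds above apply on D, and every
  index of J - D gains a further \<gamma>.\<close>

lemma sum_pr_bad_le:
  assumes J: "finite J" "U \<subseteq> J" "real (card J) \<le> real s * (4/3) ^ K"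
  defines "Bad \<equiv> {v \<in> PiE J (\<lambda>_. {0..<int p}). (\<exists>i\<in>J. v i \<noteq> 0) \<and> \<beta> \<le> R p (J - U) v}"
  shows "(\<Sum>v\<in>Bad. pr p J v) \<le> real p ^ card U *
    ((real (card J) + 1) ^ s * real p ^ s * (3/4) ^ (card J - 1)
     + 2 ^ card J * (real p ^ s * real N ^ K * 2 ^ (4 * card J) * (\<gamma> ^ card J / \<gamma> ^ s)))"
proof -
  let ?m = "card J"
  let ?a = "real p ^ s * (3/4) ^ (?m - 1)"
  let ?b = "real p ^ s * real N ^ K * 2 ^ (4 * card J) * (\<gamma> ^ card J / \<gamma> ^ s)"
  let ?supp = "\<lambda>v. {i \<in> J - U. v i \<noteq> 0}"
  have finBad: "finite Bad"
    by (rule finite_subset[of _ "PiE J (\<lambda>_. {0..<int p})"]) (use J in \<open>auto simp: Bad_def finite_PiE\<close>)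
  have finU: "finite U" using J finite_subset by blast
  have cU: "card (PiE U (\<lambda>_. {0..<int p})) = p ^ card U" using finU by (simp add: card_PiE)
  have each: "(\<Sum>v | v \<in> Bad \<and> ?supp v = D. pr p J v) \<le> real p ^ card U * (if card D \<le> s then ?a else ?b)"
    if D: "D \<subseteq> J - U" for D
  proof -
    let ?X = "{v. v \<in> Bad \<and> ?supp v = D}"
    have finD: "finite D" using D J finite_subset by blast
    have cDm: "card D \<le> ?m" using D J by (intro card_mono) auto
    have restr: "restrict v D \<in> struct_vecs p \<beta> D" if v: "v \<in> ?X" for v
    proof -
      have "R p (J - U) v = R p D v"
        using v J D by (intro R_remove_zeros p_pos) auto
      moreover have "R p D (restrict v D) = R p D v" by (rule R_cong[OF p_pos]) simp
      moreover have "restrict v D \<in> PiE D (\<lambda>_. {1..<int p})"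
      proof
        fix i assume "i \<in> D"
        then have "v i \<noteq> 0" "v i \<in> {0..<int p}" using v D by (auto simp: Bad_def PiE_iff)
        then show "restrict v D i \<in> {1..<int p}" using \<open>i \<in> D\<close> by auto
      qed auto
      ultimately show ?thesis using v by (auto simp: struct_vecs_def Bad_def)
    qed
    \<comment> \<open>Vectors of this class vanish on J outside D and U, so this restriction
      determines them.\<close>
    define h where "h v = restrict v (D \<union> U)" for v :: "nat \<Rightarrow> int"
    have inj_h: "inj_on h ?X"
    proof (rule inj_onI)
      fix x y assume xy: "x \<in> ?X" "y \<in> ?X" "h x = h y"
      show "x = y"
      proof (rule PiE_ext)
        show "x \<in> PiE J (\<lambda>_. {0..<int p})" "y \<in> PiE J (\<lambda>_. {0..<int p})" using xy by (auto simp: Bad_def)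
        fix i assume i: "i \<in> J"
        show "x i = y i"
        proof (cases "i \<in> D \<union> U")
          case True
          then show ?thesis using fun_cong[OF xy(3), of i] by (simp add: h_def)
        next
          case False
          then have "i \<notin> ?supp x" "i \<notin> ?supp y" using xy by auto
          then show ?thesis using False i by auto
        qed
      qed
    qed
    have key: "(\<Sum>v\<in>?X. pr p J v) \<le> real (card (PiE U (\<lambda>_. {0..<int p}))) * (\<Sum>v\<in>struct_vecs p \<beta> D. g v)"
      if g: "\<And>v. v \<in> struct_vecs p \<beta> D \<Longrightarrow> 0 \<le> g v" "\<And>v. v \<in> ?X \<Longrightarrow> pr p J v \<le> g (restrict v D)" for g
    proof -
      have "(\<Sum>v\<in>?X. pr p J v) \<le> (\<Sum>v\<in>?X. g (restrict v D))" by (intro sum_mono g)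
      also have "\<dots> = (\<Sum>v\<in>?X. g (restrict (h v) D))" by (simp add: h_def Int_absorb1)
      also have "\<dots> = (\<Sum>v\<in>h ` ?X. g (restrict v D))" using inj_h by (simp add: sum.reindex)
      also have "\<dots> \<le> real (card (PiE U (\<lambda>_. {0..<int p}))) * (\<Sum>v\<in>struct_vecs p \<beta> D. g v)"
      proof (rule sum_PiE_Un_le[where A = D and B = U and F = "\<lambda>_. {0..<int p}"])
        show "h ` ?X \<subseteq> PiE (D \<union> U) (\<lambda>_. {0..<int p})" using D J by (auto simp: h_def Bad_def PiE_iff)
        show "finite (PiE U (\<lambda>_. {0..<int p}))" using finU by (simp add: finite_PiE)
        fix v assume "v \<in> h ` ?X"
        then obtain v' where v': "v' \<in> ?X" "v = h v'" by blast
        show "restrict v D \<in> struct_vecs p \<beta> D" using restr[OF v'(1)] v'(2) by (simp add: h_def Int_absorb1)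
        show "restrict v U \<in> PiE U (\<lambda>_. {0..<int p})" using v' J by (auto simp: h_def Bad_def PiE_iff)
      qed (use finD g in auto)
      finally show ?thesis .
    qed
    show ?thesis
    proof (cases "card D \<le> s")
      case True
      have "(\<Sum>v\<in>?X. pr p J v) \<le> real (card (PiE U (\<lambda>_. {0..<int p}))) * (\<Sum>v\<in>struct_vecs p \<beta> D. (3/4) ^ (?m - 1))"
      proof (rule key)
        fix v assume v: "v \<in> ?X"
        then obtain i where i: "i \<in> J" "v i \<noteq> 0" "v i \<in> {0..<int p}" by (auto simp: Bad_def PiE_iff)
        then have "\<not> int p dvd v i" by (auto dest: zdvd_imp_le)
        then show "pr p J v \<le> (3/4) ^ (?m - 1)" using pr_nonzero_le[OF J(1) i(1) prime odd] by blast
      qed auto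
      also have "\<dots> = real p ^ card U * (real (card (struct_vecs p \<beta> D)) * (3/4) ^ (?m - 1))"
        unfolding cU by simp
      also have "\<dots> \<le> real p ^ card U * (real p ^ s * (3/4) ^ (?m - 1))"
      proof (intro mult_left_mono mult_right_mono)
        have "card (struct_vecs p \<beta> D) \<le> p ^ s"
          using card_struct_vecs_le[OF finD, of p \<beta>] power_increasing[OF True, of p] p_pos by linarith
        then show "real (card (struct_vecs p \<beta> D)) \<le> real p ^ s" by (metis of_nat_le_iff of_nat_power)
      qed auto
      finally show ?thesis using True by simp
    next
      case False
      then have sD: "s \<le> card D" by simp
      have "(\<Sum>v\<in>?X. pr p J v) \<le> real (card (PiE U (\<lambda>_. {0..<int p}))) * (\<Sum>v\<in>struct_vecs p \<beta> D. \<gamma> ^ (?m - card D) * pr p D v)"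
      proof (rule key)
        fix v assume v: "v \<in> ?X"
        have "pr p J v = pr p (D \<union> (J - D)) v" using D by (simp add: Un_absorb1 subset_iff)
        also have "\<dots> \<le> R p D v ^ card (J - D) * pr p D v"
          using J finD p_pos by (intro pr_union) auto
        also have "\<dots> = R p D (restrict v D) ^ card (J - D) * pr p D (restrict v D)"
          by (intro arg_cong2[where f="(*)"] arg_cong[where f="\<lambda>x. x ^ card (J - D)"] R_cong[OF p_pos] pr_cong) auto
        also have "\<dots> \<le> \<gamma> ^ card (J - D) * pr p D (restrict v D)"
          using R_le_\<gamma>[OF finD sD restr[OF v]] finD
          by (intro mult_right_mono power_mono R_nonneg pr_nonneg)
        also have "card (J - D) = ?m - card D" using D finD J by (intro card_Diff_subset) auto
        finally show "pr p J v \<le> \<gamma> ^ (?m - card D) * pr p D (restrict v D)" .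
      qed (use \<gamma>_pos finD in \<open>auto intro!: mult_nonneg_nonneg pr_nonneg\<close>)
      also have "\<dots> = real p ^ card U * (\<gamma> ^ (?m - card D) * (\<Sum>v\<in>struct_vecs p \<beta> D. pr p D v))"
        unfolding cU by (simp add: sum_distrib_left)
      also have "\<dots> \<le> real p ^ card U * (\<gamma> ^ (?m - card D) *
          (real p ^ s * real N ^ K * 2 ^ (4 * card D) * (\<gamma> ^ card D / \<gamma> ^ s)))"
      proof (intro mult_left_mono sum_pr_struct_vecs_le finD)
        have "real (card D) \<le> real ?m" using cDm by simp
        then show "real (card D) \<le> real s * (4/3) ^ K" using J(3) by linarith
      qed (use \<gamma>_pos in auto)
      also have "\<dots> = real p ^ card U * (real p ^ s * real N ^ K * 2 ^ (4 * card D) *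
          (\<gamma> ^ (?m - card D) * \<gamma> ^ card D / \<gamma> ^ s))" by simp
      also have "\<gamma> ^ (?m - card D) * \<gamma> ^ card D = \<gamma> ^ ?m"
        using cDm by (simp add: power_add[symmetric])
      also have "real p ^ card U * (real p ^ s * real N ^ K * 2 ^ (4 * card D) * (\<gamma> ^ ?m / \<gamma> ^ s)) \<le> real p ^ card U * ?b"
        using cDm \<gamma>_pos by (intro mult_left_mono mult_right_mono power_increasing) auto
      finally show ?thesis using False by simp
    qed
  qed
  have "(\<Sum>v\<in>Bad. pr p J v) = (\<Sum>D\<in>Pow (J - U). \<Sum>v | v \<in> Bad \<and> ?supp v = D. pr p J v)"
    using finBad J by (intro sum.group[symmetric]) auto
  also have "\<dots> \<le> (\<Sum>D\<in>Pow (J - U). real p ^ card U * (if card D \<le> s then ?a else ?b))"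
    by (intro sum_mono each) auto
  also have "\<dots> \<le> (\<Sum>D\<in>Pow J. real p ^ card U * (if card D \<le> s then ?a else ?b))"
    using J(1) \<gamma>_pos by (intro sum_mono2) auto
  \<comment> \<open>The indicator stays on the first term: a factor 2^card J would swamp (3/4)^card
    J, whereas the supports of size at most s number at most (card J + 1)^s.\<close>
  also have "\<dots> \<le> (\<Sum>D\<in>Pow J. real p ^ card U * (of_bool (card D \<le> s) * ?a + ?b))"
    using \<gamma>_pos by (intro sum_mono mult_left_mono) auto
  also have "\<dots> = real p ^ card U * (real (card {D \<in> Pow J. card D \<le> s}) * ?a + 2 ^ ?m * ?b)"
    using J(1) by (simp add: sum_distrib_left[symmetric] sum.distrib sum_distrib_right[symmetric]
        of_bool_def sum.If_cases Int_def card_Pow)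
  also have "\<dots> \<le> real p ^ card U * ((real ?m + 1) ^ s * ?a + 2 ^ ?m * ?b)"
  proof (intro mult_left_mono add_right_mono mult_right_mono)
    have "{D \<in> Pow J. card D \<le> s} = (\<Union>i\<in>{..s}. {D. D \<subseteq> J \<and> card D = i})" by auto
    then have "card {D \<in> Pow J. card D \<le> s} \<le> (\<Sum>i\<le>s. card {D. D \<subseteq> J \<and> card D = i})"
      by (simp add: card_UN_le)
    also have "\<dots> = (\<Sum>i\<le>s. ?m choose i)" using J(1) by (simp add: n_subsets)
    also have "\<dots> \<le> (\<Sum>i\<le>s. (s choose i) * ?m ^ i)"
    proof (rule sum_mono)
      fix i assume "i \<in> {..s}"
      then have "1 * ?m ^ i \<le> (s choose i) * ?m ^ i"
        by (intro mult_right_mono) (auto simp: Suc_le_eq)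
      moreover have "?m choose i \<le> ?m ^ i"
        by (cases "i \<le> ?m") (auto simp: binomial_le_pow binomial_eq_0)
      ultimately show "?m choose i \<le> (s choose i) * ?m ^ i" by linarith
    qed
    also have "\<dots> = (?m + 1) ^ s" unfolding binomial by (simp add: mult.commute)
    finally have "real (card {D \<in> Pow J. card D \<le> s}) \<le> real ((?m + 1) ^ s)" by (simp only: of_nat_le_iff)
    then show "real (card {D \<in> Pow J. card D \<le> s}) \<le> (real ?m + 1) ^ s" by (simp add: add.commute)
  qed auto
  finally show ?thesis by (simp add: mult.assoc)
qed

end

section \<open>Quadratic forms of inverse matrices\<close>

text \<open>A trivial integer kernel, equivalently invertibility over the rationals; it says nothing
  about the matrix modulo p.\<close>

definition nonsing :: "(nat set \<Rightarrow> int) \<Rightarrow> nat set \<Rightarrow> bool" where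
  "nonsing m J \<longleftrightarrow> (\<forall>v. (\<forall>i\<in>J. (\<Sum>l\<in>J. m {i, l} * v l) = 0) \<longrightarrow> (\<forall>i\<in>J. v i = 0))"

text \<open>For nonsingular \<open>M\<close> this says \<open>x\<^sup>T M\<^sup>-\<^sup>1 x = a\<close>, with denominators cleared.\<close>

definition quad :: "(nat set \<Rightarrow> int) \<Rightarrow> nat set \<Rightarrow> (nat \<Rightarrow> int) \<Rightarrow> int \<Rightarrow> bool" where
  "quad m J x a \<longleftrightarrow> (\<exists>v \<mu>. \<mu> \<noteq> 0 \<and> (\<forall>i\<in>J. (\<Sum>l\<in>J. m {i, l} * v l) = \<mu> * x i) \<and> (\<Sum>l\<in>J. x l * v l) = \<mu> * a)"

lemma nonsing_cong:
  assumes "\<And>i l. i \<in> J \<Longrightarrow> l \<in> J \<Longrightarrow> m {i, l} = m' {i, l}"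
  shows "nonsing m J = nonsing m' J"
  unfolding nonsing_def by (simp add: assms cong: sum.cong)

lemma quad_cong:
  assumes "\<And>i l. i \<in> J \<Longrightarrow> l \<in> J \<Longrightarrow> m {i, l} = m' {i, l}" "\<And>l. l \<in> J \<Longrightarrow> x l = x' l"
  shows "quad m J x a = quad m' J x' a"
  unfolding quad_def by (simp add: assms cong: sum.cong)

lemma sym_form_commute:
  "(\<Sum>i\<in>J. u i * (\<Sum>l\<in>J. m {i, l} * v l)) = (\<Sum>i\<in>J. v i * (\<Sum>l\<in>J. m {i, l} * (u l :: int)))"
  unfolding sum_distrib_left by (subst sum.swap) (simp add: insert_commute mult_ac)

lemma sum_mult_lin_comb:
  "(\<Sum>l\<in>J. f l * (a * v l - b * v' l)) = a * (\<Sum>l\<in>J. f l * v l) - b * (\<Sum>l\<in>J. f l * (v' l :: int))"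
  by (simp add: right_diff_distrib sum_subtractf sum_distrib_left mult.left_commute)

lemma nonsing_solutions_proportional:
  assumes "nonsing m J"
    "\<And>i. i \<in> J \<Longrightarrow> (\<Sum>l\<in>J. m {i, l} * v l) = \<mu> * w i"
    "\<And>i. i \<in> J \<Longrightarrow> (\<Sum>l\<in>J. m {i, l} * v' l) = \<mu>' * w i" "i \<in> J"
  shows "\<mu>' * v i = \<mu> * v' i"
proof -
  have "(\<Sum>l\<in>J. m {k, l} * (\<mu>' * v l - \<mu> * v' l)) = 0" if "k \<in> J" for k
    unfolding sum_mult_lin_comb using assms(2,3)[OF that] by simp
  then have "\<forall>i\<in>J. \<mu>' * v i - \<mu> * v' i = 0"
    using assms(1)[unfolded nonsing_def, rule_format, of "\<lambda>l. \<mu>' * v l - \<mu> * v' l"] by blast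
  then show ?thesis using assms(4) by simp
qed

text \<open>For symmetric M, x M^-1 x - x' M^-1 x' = (x - x') M^-1 (x + x'), and V is a multiple of
  M^-1 (x - x'). Equality of two quadratic values becomes one linear condition on x + x'.\<close>

lemma quad_difference:
  fixes m :: "nat set \<Rightarrow> int"
  assumes v: "\<And>i. i \<in> J \<Longrightarrow> (\<Sum>l\<in>J. m {i, l} * v l) = \<mu> * x i" "(\<Sum>l\<in>J. x l * v l) = \<mu> * a"
    and v': "\<And>i. i \<in> J \<Longrightarrow> (\<Sum>l\<in>J. m {i, l} * v' l) = \<mu>' * x' i" "(\<Sum>l\<in>J. x' l * v' l) = \<mu>' * a"
  defines "V \<equiv> \<lambda>l. \<mu>' * v l - \<mu> * v' l"
  shows "\<And>i. i \<in> J \<Longrightarrow> (\<Sum>l\<in>J. m {i, l} * V l) = \<mu> * \<mu>' * (x i - x' i)"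
    and "(\<Sum>l\<in>J. V l * (x l + x' l)) = 0"
proof -
  fix i assume i: "i \<in> J"
  show "(\<Sum>l\<in>J. m {i, l} * V l) = \<mu> * \<mu>' * (x i - x' i)"
    unfolding V_def sum_mult_lin_comb using v(1)[OF i] v'(1)[OF i] by (simp add: right_diff_distrib mult_ac)
next
  have "\<mu>' * (\<Sum>l\<in>J. x' l * v l) = (\<Sum>i\<in>J. v i * (\<Sum>l\<in>J. m {i, l} * v' l))"
    using v'(1) by (simp add: sum_distrib_left mult_ac)
  also have "\<dots> = \<mu> * (\<Sum>l\<in>J. x l * v' l)"
    unfolding sym_form_commute[of v] using v(1) by (simp add: sum_distrib_left mult_ac)
  finally have *: "\<mu>' * (\<Sum>l\<in>J. x' l * v l) = \<mu> * (\<Sum>l\<in>J. x l * v' l)" .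
  have "(\<Sum>l\<in>J. V l * (x l + x' l)) = (\<Sum>l\<in>J. (x l + x' l) * V l)"
    by (simp add: mult.commute)
  also have "\<dots> = \<mu>' * (\<Sum>l\<in>J. x l * v l) - \<mu> * (\<Sum>l\<in>J. x' l * v' l)
      + (\<mu>' * (\<Sum>l\<in>J. x' l * v l) - \<mu> * (\<Sum>l\<in>J. x l * v' l))"
    unfolding V_def sum_mult_lin_comb by (simp add: distrib_right sum.distrib distrib_left)
  finally have "(\<Sum>l\<in>J. V l * (x l + x' l)) = \<mu>' * (\<Sum>l\<in>J. x l * v l) - \<mu> * (\<Sum>l\<in>J. x' l * v' l)
      + (\<mu>' * (\<Sum>l\<in>J. x' l * v l) - \<mu> * (\<Sum>l\<in>J. x l * v' l))" .
  then show "(\<Sum>l\<in>J. V l * (x l + x' l)) = 0" using v(2) v'(2) * by (simp add: mult_ac)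
qed

section \<open>Decoupling the quadratic form\<close>

context lo_setup
begin

text \<open>The event excluded by the union bound. The multiple c is free because clearing
  denominators leaves an unknown factor, possibly 0 modulo p.\<close>

definition bad :: "nat set \<Rightarrow> nat set \<Rightarrow> (nat \<Rightarrow> int) \<Rightarrow> (nat set \<Rightarrow> int) \<Rightarrow> bool" where
  "bad J U w m \<longleftrightarrow> (\<exists>v c. (\<exists>i\<in>J. \<not> int p dvd v i) \<and> solves p m J v (\<lambda>i. c * w i) \<and> \<beta> \<le> R p (J - U) v)"

definition bad_bound :: "nat \<Rightarrow> nat \<Rightarrow> nat \<Rightarrow> real" where
  "bad_bound u n K = real p ^ u * ((real n + 1) ^ s * real p ^ s * (3/4) ^ (n - 1)
     + 2 ^ n * (real p ^ s * real N ^ K * 2 ^ (4 * n) * (\<gamma> ^ n / \<gamma> ^ s)))"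

text \<open>Reducing v and c modulo p leaves finitely many candidates; the values of c account for
  the leading factor p.\<close>

lemma avg_bad_le:
  assumes J: "finite J" "U \<subseteq> J" "real (card J) \<le> real s * (4/3) ^ K"
  shows "avg (pairs J) (\<lambda>m. of_bool (bad J U w m)) \<le> real p * bad_bound (card U) (card J) K"
proof -
  let ?Bad = "{v \<in> PiE J (\<lambda>_. {0..<int p}). (\<exists>i\<in>J. v i \<noteq> 0) \<and> \<beta> \<le> R p (J - U) v}"
  have finBad: "finite ?Bad"
    by (rule finite_subset[of _ "PiE J (\<lambda>_. {0..<int p})"]) (use J in \<open>auto simp: finite_PiE\<close>)
  have "avg (pairs J) (\<lambda>m. of_bool (bad J U w m))
      \<le> avg (pairs J) (\<lambda>m. \<Sum>c\<in>{0..<int p}. \<Sum>v\<in>?Bad. of_bool (solves p m J v (\<lambda>i. c * w i)))"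
  proof (rule avg_mono)
    fix m :: "nat set \<Rightarrow> int"
    show "of_bool (bad J U w m) \<le> (\<Sum>c\<in>{0..<int p}. \<Sum>v\<in>?Bad. of_bool (solves p m J v (\<lambda>i. c * w i)) :: real)"
    proof (cases "bad J U w m")
      case True
      then obtain v c where vc: "\<exists>i\<in>J. \<not> int p dvd v i" "solves p m J v (\<lambda>i. c * w i)" "\<beta> \<le> R p (J - U) v"
        unfolding bad_def by blast
      define v' where "v' = restrict (\<lambda>i. v i mod int p) J"
      define c' where "c' = c mod int p"
      have cong: "[v' i = v i] (mod int p)" if "i \<in> J" for i using that by (simp add: v'_def cong_def)
      have cc: "[c' = c] (mod int p)" by (simp add: c'_def cong_def)
      have "R p (J - U) v' = R p (J - U) v" by (rule R_cong[OF p_pos]) (use cong in auto)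
      then have v'Bad: "v' \<in> ?Bad"
        using vc p_pos by (auto simp: v'_def mod_eq_0_iff_dvd)
      have "solves p m J v' (\<lambda>i. c' * w i)"
        unfolding solves_def
      proof
        fix i assume i: "i \<in> J"
        have "[(\<Sum>l\<in>J. m {i, l} * v' l) = (\<Sum>l\<in>J. m {i, l} * v l)] (mod int p)"
          by (intro cong_sum cong_mult cong_refl cong)
        also have "[(\<Sum>l\<in>J. m {i, l} * v l) = c * w i] (mod int p)" using vc(2) i by (simp add: solves_def)
        also have "[c * w i = c' * w i] (mod int p)" by (intro cong_mult cong_refl cong_sym[OF cc])
        finally show "[(\<Sum>l\<in>J. m {i, l} * v' l) = c' * w i] (mod int p)" .
      qed
      then have "(1::real) = of_bool (solves p m J v' (\<lambda>i. c' * w i))" by simp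
      also have "\<dots> \<le> (\<Sum>v\<in>?Bad. of_bool (solves p m J v (\<lambda>i. c' * w i)))"
        using v'Bad finBad by (intro member_le_sum) auto
      also have "\<dots> \<le> (\<Sum>c\<in>{0..<int p}. \<Sum>v\<in>?Bad. of_bool (solves p m J v (\<lambda>i. c * w i)))"
        using p_pos by (intro member_le_sum[of c' "{0..<int p}" "\<lambda>c. \<Sum>v\<in>?Bad. of_bool (solves p m J v (\<lambda>i. c * w i))"])
          (auto simp: c'_def intro!: sum_nonneg)
      finally show ?thesis using True by simp
    qed (auto intro!: sum_nonneg)
  qed
  also have "\<dots> = (\<Sum>c\<in>{0..<int p}. \<Sum>v\<in>?Bad. avg (pairs J) (\<lambda>m. of_bool (solves p m J v (\<lambda>i. c * w i))))"
    by (simp only: avg_sum)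
  also have "\<dots> \<le> (\<Sum>c\<in>{0..<int p}. \<Sum>v\<in>?Bad. pr p J v)"
    by (intro sum_mono avg_solves_le_pr J)
  also have "\<dots> = real p * (\<Sum>v\<in>?Bad. pr p J v)" by simp
  also have "\<dots> \<le> real p * bad_bound (card U) (card J) K"
    unfolding bad_bound_def by (intro mult_left_mono sum_pr_bad_le J) auto
  finally show ?thesis .
qed

lemma \<beta>_nonneg: "0 \<le> \<beta>"
proof (rule ccontr)
  assume "\<not> 0 \<le> \<beta>"
  then have "real p * \<beta> \<le> 0" by (simp add: mult_le_0_iff)
  then show False using \<beta> by simp
qed

text \<open>Among all integer solutions of \<open>M V = \<mu> w\<close> with \<open>\<mu> \<noteq> 0\<close>, one with \<open>\<bar>\<mu>\<bar>\<close> minimal cannot vanish modulo \<open>p\<close>.\<close>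

lemma exists_solution_nonzero_mod:
  assumes "finite J" "\<mu>0 \<noteq> 0" "\<And>i. i \<in> J \<Longrightarrow> (\<Sum>l\<in>J. m {i, l} * V0 l) = \<mu>0 * w i"
    and w: "i0 \<in> J" "\<not> int p dvd w i0"
  shows "\<exists>V \<mu>. \<mu> \<noteq> 0 \<and> (\<forall>i\<in>J. (\<Sum>l\<in>J. m {i, l} * V l) = \<mu> * w i) \<and> (\<exists>i\<in>J. \<not> int p dvd V i)"
proof -
  define Q where "Q k \<longleftrightarrow> (\<exists>V \<mu>. \<mu> \<noteq> 0 \<and> (\<forall>i\<in>J. (\<Sum>l\<in>J. m {i, l} * V l) = \<mu> * w i) \<and> nat \<bar>\<mu>\<bar> = k)" for k
  have "Q (nat \<bar>\<mu>0\<bar>)" using assms unfolding Q_def by blast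
  then have "Q (LEAST k. Q k)" by (rule LeastI)
  then obtain V \<mu> where V: "\<mu> \<noteq> 0" "\<forall>i\<in>J. (\<Sum>l\<in>J. m {i, l} * V l) = \<mu> * w i" "nat \<bar>\<mu>\<bar> = (LEAST k. Q k)"
    unfolding Q_def by blast
  have "\<exists>i\<in>J. \<not> int p dvd V i"
  proof (rule ccontr)
    assume "\<not> ?thesis"
    then have dv: "\<forall>i\<in>J. int p dvd V i" by blast
    have "int p dvd (\<Sum>l\<in>J. m {i0, l} * V l)" using dv by (intro dvd_sum dvd_mult) auto
    then have "int p dvd \<mu> * w i0" using V(2) w(1) by simp
    then have "int p dvd \<mu>" using w(2) prime by (metis prime_dvd_mult_iff prime_nat_int_transfer)
    then obtain \<mu>' where \<mu>': "\<mu> = int p * \<mu>'" by blast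
    have "(\<Sum>l\<in>J. m {i, l} * (V l div int p)) = \<mu>' * w i" if "i \<in> J" for i
    proof -
      have "int p * (\<Sum>l\<in>J. m {i, l} * (V l div int p)) = (\<Sum>l\<in>J. m {i, l} * V l)"
        unfolding sum_distrib_left
        using dv by (intro sum.cong refl) (auto simp: mult.left_commute)
      also have "\<dots> = int p * (\<mu>' * w i)" using V(2) that by (simp add: \<mu>')
      finally show ?thesis using p_pos by simp
    qed
    then have "Q (nat \<bar>\<mu>'\<bar>)" using V(1) \<mu>' unfolding Q_def
      by (intro exI[of _ "\<lambda>l. V l div int p"] exI[of _ \<mu>']) auto
    then have "nat \<bar>\<mu>\<bar> \<le> nat \<bar>\<mu>'\<bar>" unfolding V(3) by (rule Least_le)
    moreover have "\<bar>\<mu>\<bar> = int p * \<bar>\<mu>'\<bar>" by (simp add: \<mu>' abs_mult)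
    moreover have "\<mu>' \<noteq> 0" using V(1) \<mu>' by auto
    moreover have "p \<ge> 2" using prime by (simp add: prime_ge_2_nat)
    moreover have "2 * \<bar>\<mu>'\<bar> \<le> int p * \<bar>\<mu>'\<bar>" using \<open>p \<ge> 2\<close> by (intro mult_right_mono) auto
    ultimately show False by linarith
  qed
  then show ?thesis using V by blast
qed

text \<open>All solutions of M V = \<mu> (x - x') are proportional, so one V serves every y. V is
  orthogonal to the sum of the two vectors, which is 2 y off U; this is one linear equation on y
  with a fixed right-hand side. Since \<open>bad\<close> fails, V has concentration below
  \<beta>.\<close>

lemma avg_quad_pair_le:
  assumes J: "finite J" "U \<subseteq> J" and ns: "nonsing m J" and x: "x \<in> signs U" "x' \<in> signs U" "x \<noteq> x'"
    and good: "\<not> bad J U (\<lambda>i. if i \<in> U then x i - x' i else 0) m"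
  shows "avg (J - U) (\<lambda>y. of_bool (quad m J (override_on y x U) a \<and> quad m J (override_on y x' U) a)) \<le> \<beta>"
proof -
  let ?w = "\<lambda>i. if i \<in> U then x i - x' i else 0"
  let ?E = "\<lambda>y. quad m J (override_on y x U) a \<and> quad m J (override_on y x' U) a"
  have fin: "finite (J - U)" using J by simp
  have diff: "override_on y x U i - override_on y x' U i = ?w i" for y i by (simp add: override_on_def)
  have ex: "\<exists>V \<mu>. \<mu> \<noteq> 0 \<and> (\<forall>i\<in>J. (\<Sum>l\<in>J. m {i, l} * V l) = \<mu> * ?w i) \<and>
      (\<Sum>l\<in>J. V l * (override_on y x U l + override_on y x' U l)) = 0" if y: "?E y" for y
  proof -
    let ?x = "override_on y x U" and ?x' = "override_on y x' U"
    obtain v \<mu> where v: "\<mu> \<noteq> 0" "\<And>i. i \<in> J \<Longrightarrow> (\<Sum>l\<in>J. m {i, l} * v l) = \<mu> * ?x i" "(\<Sum>l\<in>J. ?x l * v l) = \<mu> * a"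
      using y unfolding quad_def by blast
    obtain v' \<mu>' where v': "\<mu>' \<noteq> 0" "\<And>i. i \<in> J \<Longrightarrow> (\<Sum>l\<in>J. m {i, l} * v' l) = \<mu>' * ?x' i" "(\<Sum>l\<in>J. ?x' l * v' l) = \<mu>' * a"
      using y unfolding quad_def by blast
    note d = quad_difference[OF v(2,3) v'(2,3), unfolded diff]
    show ?thesis
      using d v(1) v'(1) by (intro exI[of _ "\<lambda>l. \<mu>' * v l - \<mu> * v' l"] exI[of _ "\<mu> * \<mu>'"]) auto
  qed
  show ?thesis
  proof (cases "\<exists>y0. ?E y0")
    case False
    then have "avg (J - U) (\<lambda>y. of_bool (?E y)) = avg (J - U) (\<lambda>y. 0)" by (intro avg_cong) auto
    then show ?thesis using \<beta>_nonneg fin by simp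
  next
    case True
    then obtain y0 where y0: "?E y0" by blast
    obtain i0 where i0: "i0 \<in> U" "x i0 \<noteq> x' i0" using x by (meson PiE_ext)
    \<comment> \<open>Distinct signs differ by 2, which is invertible modulo the odd prime, so w
      does not vanish modulo p.\<close>
    have "\<bar>?w i0\<bar> = 2" using i0 signsD[OF x(1) i0(1)] signsD[OF x(2) i0(1)] by auto
    moreover have "\<not> int p dvd 2"
    proof
      assume "int p dvd 2"
      then have "p dvd 2" by presburger
      then show False using odd prime by (metis dvd_refl primes_dvd_imp_eq two_is_prime_nat)
    qed
    ultimately have w0: "\<not> int p dvd ?w i0" by (metis dvd_abs_iff)
    obtain V0 \<mu>0 where "\<mu>0 \<noteq> 0" "\<forall>i\<in>J. (\<Sum>l\<in>J. m {i, l} * V0 l) = \<mu>0 * ?w i"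
      using ex[OF y0] by blast
    then obtain V \<mu> where V: "\<mu> \<noteq> 0" "\<And>i. i \<in> J \<Longrightarrow> (\<Sum>l\<in>J. m {i, l} * V l) = \<mu> * ?w i" "\<exists>i\<in>J. \<not> int p dvd V i"
      using exists_solution_nonzero_mod[OF J(1), of \<mu>0 m V0 ?w i0] i0 w0 J(2) by blast
    have "solves p m J V (\<lambda>i. \<mu> * ?w i)" using V(2) by (simp add: solves_def)
    then have RV: "R p (J - U) V < \<beta>" using good V(3) unfolding bad_def by (meson not_le)
    have orth: "2 * (\<Sum>l\<in>J - U. y l * V l) = - (\<Sum>l\<in>U. V l * (x l + x' l))" if y: "?E y" for y
    proof -
      obtain V2 \<mu>2 where V2: "\<mu>2 \<noteq> 0" "\<And>i. i \<in> J \<Longrightarrow> (\<Sum>l\<in>J. m {i, l} * V2 l) = \<mu>2 * ?w i"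
        "(\<Sum>l\<in>J. V2 l * (override_on y x U l + override_on y x' U l)) = 0"
        using ex[OF y] by blast
      have "\<mu>2 * (\<Sum>l\<in>J. V l * (override_on y x U l + override_on y x' U l))
          = (\<Sum>l\<in>J. (\<mu>2 * V l) * (override_on y x U l + override_on y x' U l))"
        by (simp add: sum_distrib_left mult.assoc)
      also have "\<dots> = (\<Sum>l\<in>J. (\<mu> * V2 l) * (override_on y x U l + override_on y x' U l))"
        using nonsing_solutions_proportional[OF ns V(2) V2(2)] by (intro sum.cong) auto
      also have "\<dots> = \<mu> * (\<Sum>l\<in>J. V2 l * (override_on y x U l + override_on y x' U l))"
        by (simp add: sum_distrib_left mult.assoc)
      finally have "0 = (\<Sum>l\<in>J. V l * (override_on y x U l + override_on y x' U l))"
        using V2 by simp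
      also have "\<dots> = (\<Sum>l\<in>U. V l * (override_on y x U l + override_on y x' U l))
          + (\<Sum>l\<in>J - U. V l * (override_on y x U l + override_on y x' U l))"
        using J by (metis (no_types) add.commute sum.subset_diff)
      also have "(\<Sum>l\<in>U. V l * (override_on y x U l + override_on y x' U l)) = (\<Sum>l\<in>U. V l * (x l + x' l))"
        by (intro sum.cong) (auto simp: override_on_def)
      also have "(\<Sum>l\<in>J - U. V l * (override_on y x U l + override_on y x' U l)) = 2 * (\<Sum>l\<in>J - U. y l * V l)"
        unfolding sum_distrib_left by (intro sum.cong) (auto simp: override_on_def)
      finally show ?thesis by simp
    qed
    define c where "c = (\<Sum>l\<in>J - U. y0 l * V l)"
    have "avg (J - U) (\<lambda>y. of_bool (?E y)) \<le> avg (J - U) (\<lambda>y. of_bool ([(\<Sum>l\<in>J - U. y l * V l) = c] (mod int p)))"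
    proof (rule avg_mono)
      fix y :: "nat \<Rightarrow> int"
      have "(\<Sum>l\<in>J - U. y l * V l) = c" if "?E y"
        using orth[OF that] orth[OF y0] unfolding c_def by linarith
      then show "of_bool (?E y) \<le> (of_bool ([(\<Sum>l\<in>J - U. y l * V l) = c] (mod int p)) :: real)" by auto
    qed
    also have "\<dots> \<le> R p (J - U) V" by (rule avg_cong_le_R[OF fin p_pos])
    finally show ?thesis using RV by simp
  qed
qed

text \<open>By Cauchy-Schwarz in m and y, the squared mean over U becomes a mean over independent
  copies x, x' sharing m and y. The diagonal x = x' has mass 1 / 2^card U; any other pair costs
  \<beta> unless \<open>bad\<close> occurs. As x - x' is independent of m, that event is averaged
  over m for each fixed difference.\<close>

lemma avg_quad_power2_le:
  assumes J: "finite J" "U \<subseteq> J" "real (card J) \<le> real s * (4/3) ^ K"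
  shows "(avg (pairs J) (\<lambda>m. avg J (\<lambda>x. of_bool (nonsing m J \<and> quad m J x a))))\<^sup>2
    \<le> 1 / 2 ^ card U + \<beta> + real p * bad_bound (card U) (card J) K"
proof -
  let ?W = "J - U"
  let ?F = "\<lambda>m x y. of_bool (nonsing m J \<and> quad m J (override_on y x U) a) :: real"
  let ?w = "\<lambda>x x' i. if i \<in> U then x i - x' i else 0 :: int"
  let ?E = "real p * bad_bound (card U) (card J) K"
  have fin: "finite U" "finite ?W" "finite (pairs J)" using J finite_subset by auto
  have "avg J (\<lambda>x. of_bool (nonsing m J \<and> quad m J x a)) = avg ?W (\<lambda>y. avg U (\<lambda>x. ?F m x y))" for m
  proof -
    have "avg J (\<lambda>x. of_bool (nonsing m J \<and> quad m J x a)) = avg (U \<union> ?W) (\<lambda>x. of_bool (nonsing m J \<and> quad m J x a))"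
      using J by (simp add: Un_absorb1)
    also have "\<dots> = avg U (\<lambda>x. avg ?W (\<lambda>y. ?F m x y))" using fin by (intro avg_union) auto
    finally show ?thesis by (simp only: avg_swap[of U])
  qed
  then have "(avg (pairs J) (\<lambda>m. avg J (\<lambda>x. of_bool (nonsing m J \<and> quad m J x a))))\<^sup>2
      = (avg (pairs J) (\<lambda>m. avg ?W (\<lambda>y. avg U (\<lambda>x. ?F m x y))))\<^sup>2" by simp
  also have "\<dots> \<le> avg (pairs J) (\<lambda>m. (avg ?W (\<lambda>y. avg U (\<lambda>x. ?F m x y)))\<^sup>2)"
    by (rule avg_power2_le[OF fin(3)])
  also have "\<dots> \<le> avg (pairs J) (\<lambda>m. avg ?W (\<lambda>y. (avg U (\<lambda>x. ?F m x y))\<^sup>2))"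
    by (intro avg_mono avg_power2_le fin)
  also have "\<dots> = avg (pairs J) (\<lambda>m. avg ?W (\<lambda>y. avg U (\<lambda>x. avg U (\<lambda>x'. ?F m x y * ?F m x' y))))"
    by (simp only: power2_eq_square avg_cmult avg_cmult_right)
  also have "\<dots> = avg (pairs J) (\<lambda>m. avg U (\<lambda>x. avg U (\<lambda>x'. avg ?W (\<lambda>y. ?F m x y * ?F m x' y))))"
    by (simp only: avg_swap[of ?W])
  also have "\<dots> \<le> avg (pairs J) (\<lambda>m. avg U (\<lambda>x. avg U (\<lambda>x'. of_bool (x = x') + (\<beta> + of_bool (bad J U (?w x x') m)))))"
  proof (intro avg_mono)
    fix m x x' assume x: "x \<in> signs U" "x' \<in> signs U"
    show "avg ?W (\<lambda>y. ?F m x y * ?F m x' y) \<le> of_bool (x = x') + (\<beta> + of_bool (bad J U (?w x x') m))"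
    proof (cases "x = x' \<or> bad J U (?w x x') m")
      case True
      have "avg ?W (\<lambda>y. ?F m x y * ?F m x' y) \<le> 1" using fin by (intro avg_le_const) auto
      also have "\<dots> \<le> of_bool (x = x') + (\<beta> + of_bool (bad J U (?w x x') m))" using True \<beta>_nonneg by auto
      finally show ?thesis .
    next
      case False
      show ?thesis
      proof (cases "nonsing m J")
        case True
        have "avg ?W (\<lambda>y. ?F m x y * ?F m x' y)
            = avg ?W (\<lambda>y. of_bool (quad m J (override_on y x U) a \<and> quad m J (override_on y x' U) a))"
          using True by (intro avg_cong) auto
        also have "\<dots> \<le> \<beta>" using avg_quad_pair_le[OF J(1,2) True x] False by blast
        finally show ?thesis using False by simp
      next
        case ns: False
        then have "avg ?W (\<lambda>y. ?F m x y * ?F m x' y) = 0" using fin by simp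
        then show ?thesis using \<beta>_nonneg by simp
      qed
    qed
  qed
  also have "\<dots> = avg U (\<lambda>x. avg U (\<lambda>x'. avg (pairs J) (\<lambda>m. of_bool (x = x') + (\<beta> + of_bool (bad J U (?w x x') m)))))"
    by (simp only: avg_swap[of "pairs J"])
  also have "\<dots> \<le> avg U (\<lambda>x. avg U (\<lambda>x'. of_bool (x = x') + (\<beta> + ?E)))"
    unfolding avg_add using fin avg_bad_le[OF J]
    by (intro avg_mono add_mono) auto
  also have "\<dots> \<le> avg U (\<lambda>x. 1 / 2 ^ card U + (\<beta> + ?E))"
  proof (intro avg_mono)
    fix x
    have "avg U (\<lambda>x'. of_bool (x = x')) \<le> 1 / 2 ^ card U"
      by (rule avg_of_bool_le_inverse[OF fin(1)]) auto
    then show "avg U (\<lambda>x'. of_bool (x = x') + (\<beta> + ?E)) \<le> 1 / 2 ^ card U + (\<beta> + ?E)"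
      unfolding avg_add using fin by simp
  qed
  finally show ?thesis using fin by simp
qed

text \<open>Row j, with its diagonal entry, is independent of the matrix on J; fixing the diagonal
  entry makes it the constant a.\<close>

lemma avg_quad_insert_le:
  assumes J: "finite J" "U \<subseteq> J" "real (card J) \<le> real s * (4/3) ^ K" and j: "j \<notin> J"
  shows "avg (pairs (insert j J)) (\<lambda>m. of_bool (nonsing m J \<and> quad m J (\<lambda>l. m {j, l}) (m {j})))
    \<le> sqrt (1 / 2 ^ card U + \<beta> + real p * bad_bound (card U) (card J) K)"
proof -
  let ?S = "star j (insert j J)"
  let ?Q = "\<lambda>m x a. of_bool (nonsing m J \<and> quad m J x a) :: real"
  have ent: "override_on y x ?S {i, l} = y {i, l}" if "i \<in> J" "l \<in> J" for x y :: "nat set \<Rightarrow> int" and i l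
    using that j by (auto simp: override_on_def star_def doubleton_eq_iff)
  have ent': "override_on y x ?S {j, l} = x {j, l}" if "l \<in> insert j J" for x y :: "nat set \<Rightarrow> int" and l
    using that by (auto simp: override_on_def star_def)
  have "avg (pairs (insert j J)) (\<lambda>m. ?Q m (\<lambda>l. m {j, l}) (m {j}))
      = avg ?S (\<lambda>x. avg (pairs J) (\<lambda>y. ?Q (override_on y x ?S) (\<lambda>l. override_on y x ?S {j, l}) (override_on y x ?S {j})))"
    unfolding pairs_insert using J j by (intro avg_union star_Int_pairs) auto
  also have "\<dots> = avg ?S (\<lambda>x. avg (pairs J) (\<lambda>y. ?Q y (\<lambda>l. x {j, l}) (x {j})))"
  proof -
    have "nonsing (override_on y x ?S) J = nonsing y J" for x y
      unfolding nonsing_def by (simp add: ent cong: sum.cong)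
    moreover have "quad (override_on y x ?S) J (\<lambda>l. override_on y x ?S {j, l}) (override_on y x ?S {j})
        = quad y J (\<lambda>l. x {j, l}) (x {j})" for x y
      using ent'[of j y x] unfolding quad_def by (simp add: ent ent' cong: sum.cong)
    ultimately show ?thesis by simp
  qed
  also have "\<dots> = avg ({{j}} \<union> star j J) (\<lambda>x. avg (pairs J) (\<lambda>y. ?Q y (\<lambda>l. x {j, l}) (x {j})))"
    by (simp add: star_insert)
  also have "\<dots> = avg {{j}} (\<lambda>a. avg (star j J) (\<lambda>x. avg (pairs J)
      (\<lambda>y. ?Q y (\<lambda>l. override_on x a {{j}} {j, l}) (override_on x a {{j}} {j}))))"
    using J j by (intro avg_union) (auto simp: star_def)
  also have "\<dots> \<le> sqrt (1 / 2 ^ card U + \<beta> + real p * bad_bound (card U) (card J) K)"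
  proof (rule avg_le_const)
    fix a :: "nat set \<Rightarrow> int"
    let ?G = "\<lambda>x. avg (pairs J) (\<lambda>y. ?Q y x (a {j}))"
    have "avg (star j J) (\<lambda>x. avg (pairs J) (\<lambda>y. ?Q y (\<lambda>l. override_on x a {{j}} {j, l}) (override_on x a {{j}} {j})))
        = avg (star j J) (\<lambda>x. ?G (restrict (x \<circ> (\<lambda>l. {j, l})) J))"
    proof -
      have "quad y J (\<lambda>l. override_on x a {{j}} {j, l}) (override_on x a {{j}} {j})
          = quad y J (restrict (x \<circ> (\<lambda>l. {j, l})) J) (a {j})" for x y
      proof -
        have "override_on x a {{j}} {j} = a {j}" by (simp add: override_on_def)
        then show ?thesis using j by (simp only:) (intro quad_cong, auto simp: override_on_def)
      qed
      then show ?thesis by simp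
    qed
    also have "\<dots> = avg J ?G" unfolding star_def by (rule avg_reindex[OF inj_on_doubleton])
    also have "\<dots> = avg (pairs J) (\<lambda>m. avg J (\<lambda>x. ?Q m x (a {j})))" by (rule avg_swap)
    also have "\<dots> \<le> sqrt (1 / 2 ^ card U + \<beta> + real p * bad_bound (card U) (card J) K)"
      by (rule real_le_rsqrt[OF avg_quad_power2_le[OF J]])
    finally show "avg (star j J) (\<lambda>x. avg (pairs J) (\<lambda>y. ?Q y (\<lambda>l. override_on x a {{j}} {j, l}) (override_on x a {{j}} {j})))
        \<le> sqrt (1 / 2 ^ card U + \<beta> + real p * bad_bound (card U) (card J) K)" .
  qed simp
  finally show ?thesis .
qed

end

section \<open>Maximal nonsingular principal submatrices\<close>

lemma nonsing_empty: "nonsing m {}"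
  by (simp add: nonsing_def)

text \<open>Given that the principal submatrix on \<open>J\<close> is nonsingular, \<open>bordered m J i j\<close> says that the entry
  \<open>(i, j)\<close> of its Schur complement vanishes.\<close>

definition bordered :: "(nat set \<Rightarrow> int) \<Rightarrow> nat set \<Rightarrow> nat \<Rightarrow> nat \<Rightarrow> bool" where
  "bordered m J i j \<longleftrightarrow> (\<exists>v \<mu>. \<mu> \<noteq> 0 \<and> (\<forall>k\<in>J. (\<Sum>l\<in>J. m {k, l} * v l) = \<mu> * m {k, j}) \<and>
    (\<Sum>l\<in>J. m {i, l} * v l) = \<mu> * m {i, j})"

lemma bordered_diag_iff_quad: "bordered m J j j \<longleftrightarrow> quad m J (\<lambda>l. m {j, l}) (m {j})"
  by (simp add: bordered_def quad_def insert_commute)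

text \<open>A kernel vector on \<open>insert j J\<close> has a nonzero entry at j, since J alone has
  trivial kernel; minus that entry serves as \<mu>.\<close>

lemma bordered_diag:
  assumes "finite J" "j \<notin> J" "nonsing m J" "\<not> nonsing m (insert j J)"
  shows "bordered m J j j"
proof -
  obtain y i0 where y: "\<forall>i\<in>insert j J. (\<Sum>l\<in>insert j J. m {i, l} * y l) = 0" "i0 \<in> insert j J" "y i0 \<noteq> 0"
    using assms(4) unfolding nonsing_def by blast
  then have eq: "m {i, j} * y j + (\<Sum>l\<in>J. m {i, l} * y l) = 0" if "i \<in> insert j J" for i
    using that assms(1,2) by auto
  have "y j \<noteq> 0"
  proof
    assume 0: "y j = 0"
    then have "\<forall>i\<in>J. y i = 0" using eq assms(3) unfolding nonsing_def by simp
    then show False using 0 y by auto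
  qed
  moreover have "(\<Sum>l\<in>J. m {i, l} * y l) = (- y j) * m {i, j}" if "i \<in> insert j J" for i
    using eq[OF that] by (simp add: mult.commute)
  ultimately show ?thesis unfolding bordered_def by (intro exI[of _ y] exI[of _ "- y j"]) auto
qed

lemma bordered_symI:
  assumes "bordered m J j i" "bordered m J j j"
  shows "bordered m J i j"
proof -
  obtain v \<mu> where v: "\<mu> \<noteq> 0" "\<forall>k\<in>J. (\<Sum>l\<in>J. m {k, l} * v l) = \<mu> * m {k, i}" "(\<Sum>l\<in>J. m {j, l} * v l) = \<mu> * m {j, i}"
    using assms(1) unfolding bordered_def by blast
  obtain v' \<mu>' where v': "\<mu>' \<noteq> 0" "\<forall>k\<in>J. (\<Sum>l\<in>J. m {k, l} * v' l) = \<mu>' * m {k, j}"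
    using assms(2) unfolding bordered_def by blast
  have "\<mu> * (\<Sum>l\<in>J. m {i, l} * v' l) = (\<Sum>k\<in>J. v' k * (\<Sum>l\<in>J. m {k, l} * v l))"
    using v(2) by (simp add: sum_distrib_left insert_commute mult_ac)
  also have "\<dots> = (\<Sum>k\<in>J. v k * (\<Sum>l\<in>J. m {k, l} * v' l))" by (rule sym_form_commute)
  also have "\<dots> = \<mu>' * (\<Sum>k\<in>J. m {j, k} * v k)"
    using v'(2) by (simp add: sum_distrib_left insert_commute mult_ac)
  also have "\<dots> = \<mu> * (\<mu>' * m {i, j})" using v(3) by (simp add: insert_commute)
  finally have "(\<Sum>l\<in>J. m {i, l} * v' l) = \<mu>' * m {i, j}" using v(1) by simp
  then show ?thesis using v' unfolding bordered_def by blast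
qed

text \<open>The 2 by 2 Schur complement has zero diagonal, so its determinant is minus the square of
  the off-diagonal entry and singularity kills that entry too. For a kernel vector y, one of
  \<open>y i\<close> and \<open>y j\<close> is nonzero, and the other index is eliminated by its
  diagonal relation.\<close>

lemma bordered_offdiag:
  assumes J: "finite J" "i \<notin> J" "j \<notin> J" "i \<noteq> j"
    and b: "bordered m J i i" "bordered m J j j"
    and ns: "nonsing m J" "\<not> nonsing m (insert i (insert j J))"
  shows "bordered m J i j"
proof -
  have main: "bordered m J i j" if ij: "i \<notin> J" "j \<notin> J" "i \<noteq> j" and bi: "bordered m J i i"
    and y: "\<And>k. k \<in> insert i (insert j J) \<Longrightarrow> m {k, i} * y i + m {k, j} * y j + (\<Sum>l\<in>J. m {k, l} * y l) = 0"
    and yj: "y j \<noteq> 0" for i j y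
  proof -
    obtain v \<mu> where v: "\<mu> \<noteq> 0" "\<forall>k\<in>J. (\<Sum>l\<in>J. m {k, l} * v l) = \<mu> * m {k, i}" "(\<Sum>l\<in>J. m {i, l} * v l) = \<mu> * m {i, i}"
      using bi unfolding bordered_def by blast
    \<comment> \<open>Adding \<open>y i\<close> times the diagonal relation for i cancels column i
      and leaves column j with factor -\<mu> \<open>y j\<close>.\<close>
    let ?z = "\<lambda>l. \<mu> * y l - (- y i) * v l"
    have z: "(\<Sum>l\<in>J. m {k, l} * ?z l) = (- \<mu> * y j) * m {k, j}" if k: "k \<in> insert i J" for k
    proof -
      have yk: "(\<Sum>l\<in>J. m {k, l} * y l) = - (m {k, i} * y i) - m {k, j} * y j" using y[of k] k by auto
      have "(\<Sum>l\<in>J. m {k, l} * v l) = \<mu> * m {k, i}" using v k by auto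
      then show ?thesis unfolding sum_mult_lin_comb yk by (simp add: algebra_simps)
    qed
    show ?thesis unfolding bordered_def
      using z v(1) yj by (intro exI[of _ ?z] exI[of _ "- \<mu> * y j"]) auto
  qed
  obtain y i0 where y0: "\<forall>k\<in>insert i (insert j J). (\<Sum>l\<in>insert i (insert j J). m {k, l} * y l) = 0"
    "i0 \<in> insert i (insert j J)" "y i0 \<noteq> 0"
    using ns(2) unfolding nonsing_def by blast
  have y: "m {k, i} * y i + m {k, j} * y j + (\<Sum>l\<in>J. m {k, l} * y l) = 0" if "k \<in> insert i (insert j J)" for k
    using y0(1) that J by (auto simp: add.assoc)
  show ?thesis
  proof (cases "y j = 0")
    case False
    then show ?thesis using main[of i j y] J b y by blast
  next
    case True
    have "y i \<noteq> 0"
    proof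
      assume 0: "y i = 0"
      then have "\<forall>i\<in>J. y i = 0" using y True ns(1) unfolding nonsing_def by simp
      then show False using 0 True y0 by auto
    qed
    have "bordered m J j i"
    proof (rule main[of j i y])
      fix k assume "k \<in> insert j (insert i J)"
      then have "k \<in> insert i (insert j J)" by blast
      from y[OF this] show "m {k, j} * y j + m {k, i} * y i + (\<Sum>l\<in>J. m {k, l} * y l) = 0" by linarith
    qed (use J b \<open>y i \<noteq> 0\<close> in auto)
    then show ?thesis by (rule bordered_symI[OF _ b(2)])
  qed
qed

text \<open>Maximality is recorded by what it yields: the whole Schur complement of J in S
  vanishes.\<close>

definition maximal_nonsing :: "(nat set \<Rightarrow> int) \<Rightarrow> nat set \<Rightarrow> nat set \<Rightarrow> bool" where
  "maximal_nonsing m S J \<longleftrightarrow> nonsing m J \<and> (\<forall>i\<in>S - J. \<forall>j\<in>S - J. bordered m J i j)"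

text \<open>J has maximal size among nonsingular principal submatrices. One added index handles a
  diagonal entry; off the diagonal two indices are added at once, since only principal submatrices
  are compared.\<close>

lemma exists_maximal_nonsing:
  assumes "finite S" "\<not> nonsing m S"
  shows "\<exists>J. J \<subset> S \<and> maximal_nonsing m S J"
proof -
  define Q where "Q k \<longleftrightarrow> (\<exists>J\<subseteq>S. nonsing m J \<and> card J = k)" for k
  have "Q 0" unfolding Q_def using nonsing_empty by (intro exI[of _ "{}"]) auto
  moreover have "\<forall>k. Q k \<longrightarrow> k \<le> card S" unfolding Q_def using assms(1) card_mono by blast
  ultimately obtain k where k: "Q k" "\<forall>k'. Q k' \<longrightarrow> k' \<le> k"
    using GreatestI_nat[of Q] Greatest_le_nat[of Q] by metis
  then obtain J where J: "J \<subseteq> S" "nonsing m J" "card J = k" unfolding Q_def by blast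
  have finJ: "finite J" using J(1) assms(1) finite_subset by blast
  have max: "\<not> nonsing m J'" if "J' \<subseteq> S" "card J' > k" for J'
  proof
    assume "nonsing m J'"
    then have "Q (card J')" using that(1) unfolding Q_def by blast
    then show False using k(2) that(2) by (meson leD)
  qed
  have diag: "bordered m J j j" if "j \<in> S - J" for j
    using that J finJ by (intro bordered_diag max) auto
  have "bordered m J i j" if ij: "i \<in> S - J" "j \<in> S - J" for i j
  proof (cases "i = j")
    case False
    then have "card (insert i (insert j J)) > k" using ij finJ J(3) by simp
    then have "\<not> nonsing m (insert i (insert j J))" using ij J(1) by (intro max) auto
    then show ?thesis using bordered_offdiag[OF finJ _ _ False diag diag J(2)] ij by blast
  qed (use diag ij in auto)
  moreover have "J \<noteq> S" using J(2) assms(2) by blast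
  ultimately show ?thesis using J unfolding maximal_nonsing_def by blast
qed

lemma card_pairs: "finite D \<Longrightarrow> 2 * card (pairs D) = card D * (card D + 1)"
proof (induction D rule: finite_induct)
  case empty
  then show ?case by (simp add: pairs_def)
next
  case (insert z D)
  have "card (pairs (insert z D)) = card (star z (insert z D)) + card (pairs D)"
    unfolding pairs_insert using insert.hyps by (intro card_Un_disjoint star_Int_pairs) auto
  also have "card (star z (insert z D)) = card D + 1"
    unfolding star_def card_image[OF inj_on_doubleton] using insert.hyps by simp
  finally show ?case using insert by simp
qed

text \<open>Given the entries outside the block on S - J, a vanishing Schur complement determines
  every entry of that block, so at most one sign pattern survives.\<close>

lemma avg_maximal_nonsing_le_power:
  assumes "finite S" "J \<subseteq> S"
  shows "avg (pairs S) (\<lambda>m. of_bool (maximal_nonsing m S J)) \<le> 1 / 2 ^ card (pairs (S - J))"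
proof -
  let ?B = "pairs (S - J)"
  let ?A = "pairs S - ?B"
  have fin: "finite ?A" "finite ?B" using assms by auto
  have "pairs S = ?A \<union> ?B" using pairs_mono[of "S - J" S] by blast
  then have "avg (pairs S) (\<lambda>m. of_bool (maximal_nonsing m S J))
      = avg (?A \<union> ?B) (\<lambda>m. of_bool (maximal_nonsing m S J))" by simp
  also have "\<dots> = avg ?A (\<lambda>x. avg ?B (\<lambda>y. of_bool (maximal_nonsing (override_on y x ?A) S J)))"
    using fin by (intro avg_union) auto
  also have "\<dots> \<le> 1 / 2 ^ card ?B"
  proof (rule avg_le_const[OF fin(1)], rule avg_of_bool_le_inverse[OF fin(2)])
    fix x y y' assume x: "x \<in> signs ?A" and y: "y \<in> signs ?B" "y' \<in> signs ?B"
      and mx: "maximal_nonsing (override_on y x ?A) S J" "maximal_nonsing (override_on y' x ?A) S J"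
    have inner: "override_on z x ?A {i, j} = z {i, j}" if "i \<in> S - J" "j \<in> S - J" for z i j
      using pairsI[OF that] by (simp add: override_on_def)
    have outer: "override_on z x ?A {i, j} = x {i, j}" if "i \<in> S" "j \<in> J" for z i j
    proof -
      have "{i, j} \<in> pairs S" using that assms by (intro pairsI) auto
      moreover have "{i, j} \<notin> ?B" using that by (auto simp: pairs_def doubleton_eq_iff)
      ultimately show ?thesis by (simp add: override_on_def)
    qed
    have outer': "override_on z x ?A {j, i} = x {i, j}" if "i \<in> S" "j \<in> J" for z i j
      using outer[OF that] by (simp add: insert_commute)
    show "y = y'"
    proof (rule PiE_ext[OF y])
      fix e assume "e \<in> ?B"
      then obtain i j where e: "e = {i, j}" and ij: "i \<in> S - J" "j \<in> S - J" unfolding pairs_def by blast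
      have JS: "k \<in> S" if "k \<in> J" for k using that assms by blast
      obtain v \<mu> where v0: "\<mu> \<noteq> 0"
        "\<forall>k\<in>J. (\<Sum>l\<in>J. override_on y x ?A {k, l} * v l) = \<mu> * override_on y x ?A {k, j}"
        "(\<Sum>l\<in>J. override_on y x ?A {i, l} * v l) = \<mu> * override_on y x ?A {i, j}"
        using mx(1) ij unfolding maximal_nonsing_def bordered_def by blast
      have v: "(\<Sum>l\<in>J. x {k, l} * v l) = \<mu> * x {j, k}" if "k \<in> J" for k
        using bspec[OF v0(2) that] that JS ij(2) outer'[of j k y] by (simp add: outer cong: sum.cong)
      have w: "(\<Sum>l\<in>J. x {i, l} * v l) = \<mu> * y {i, j}"
        using v0(3) ij(1) inner[OF ij, of y] by (simp add: outer cong: sum.cong)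
      obtain v' \<mu>' where v0': "\<mu>' \<noteq> 0"
        "\<forall>k\<in>J. (\<Sum>l\<in>J. override_on y' x ?A {k, l} * v' l) = \<mu>' * override_on y' x ?A {k, j}"
        "(\<Sum>l\<in>J. override_on y' x ?A {i, l} * v' l) = \<mu>' * override_on y' x ?A {i, j}"
        using mx(2) ij unfolding maximal_nonsing_def bordered_def by blast
      have v': "(\<Sum>l\<in>J. x {k, l} * v' l) = \<mu>' * x {j, k}" if "k \<in> J" for k
        using bspec[OF v0'(2) that] that JS ij(2) outer'[of j k y'] by (simp add: outer cong: sum.cong)
      have w': "(\<Sum>l\<in>J. x {i, l} * v' l) = \<mu>' * y' {i, j}"
        using v0'(3) ij(1) inner[OF ij, of y'] by (simp add: outer cong: sum.cong)
      have "nonsing (override_on y x ?A) J" using mx(1) by (simp add: maximal_nonsing_def)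
      then have ns: "nonsing x J" unfolding nonsing_def using JS by (simp add: outer cong: sum.cong)
      have "\<mu>' * v l = \<mu> * v' l" if "l \<in> J" for l
        by (rule nonsing_solutions_proportional[OF ns v v' that])
      then have "(\<Sum>l\<in>J. x {i, l} * (\<mu>' * v l - \<mu> * v' l)) = 0" by (simp cong: sum.cong)
      then have "\<mu>' * (\<mu> * y {i, j}) - \<mu> * (\<mu>' * y' {i, j}) = 0" unfolding sum_mult_lin_comb w w' .
      then show "y e = y' e" using v0(1) v0'(1) by (simp add: e mult.left_commute)
    qed
  qed
  finally show ?thesis .
qed

text \<open>A single diagonal entry of the Schur complement is retained; it only involves entries on
  \<open>insert j J\<close>. This serves when S - J is small, the power bound when it is
  large.\<close>

lemma avg_maximal_nonsing_le_quad:
  assumes "finite S" "J \<subseteq> S" "j \<in> S - J"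
  shows "avg (pairs S) (\<lambda>m. of_bool (maximal_nonsing m S J))
    \<le> avg (pairs (insert j J)) (\<lambda>m. of_bool (nonsing m J \<and> quad m J (\<lambda>l. m {j, l}) (m {j})))"
proof -
  let ?Q = "\<lambda>m. of_bool (nonsing m J \<and> quad m J (\<lambda>l. m {j, l}) (m {j})) :: real"
  have eq: "?Q (restrict m (pairs (insert j J))) = ?Q m" for m
  proof -
    have 1: "restrict m (pairs (insert j J)) {i, l} = m {i, l}" if "i \<in> insert j J" "l \<in> insert j J" for i l
      using pairsI[OF that] by simp
    have 2: "restrict m (pairs (insert j J)) {j} = m {j}" using 1[of j j] by simp
    have "nonsing (restrict m (pairs (insert j J))) J = nonsing m J"
      using 1 by (intro nonsing_cong) auto
    moreover have "quad (restrict m (pairs (insert j J))) J (\<lambda>l. restrict m (pairs (insert j J)) {j, l})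
        (restrict m (pairs (insert j J)) {j}) = quad m J (\<lambda>l. m {j, l}) (m {j})"
      unfolding 2 using 1 by (intro quad_cong) auto
    ultimately show ?thesis by simp
  qed
  have "avg (pairs S) (\<lambda>m. of_bool (maximal_nonsing m S J)) \<le> avg (pairs S) ?Q"
    using assms(3) by (intro avg_mono) (auto simp: maximal_nonsing_def bordered_diag_iff_quad[symmetric])
  also have "\<dots> = avg (pairs S) (\<lambda>m. ?Q (restrict m (pairs (insert j J))))" by (simp only: eq)
  also have "\<dots> = avg (pairs (insert j J)) ?Q"
    using assms by (intro avg_marginal pairs_mono) auto
  finally show ?thesis .
qed

lemma avg_singular_le:
  assumes "finite S"
  shows "avg (pairs S) (\<lambda>m. of_bool (\<not> nonsing m S))
    \<le> (\<Sum>J | J \<subset> S. avg (pairs S) (\<lambda>m. of_bool (maximal_nonsing m S J)))"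
proof -
  have fin: "finite {J. J \<subset> S}" by (rule finite_subset[of _ "Pow S"]) (use assms in auto)
  have "avg (pairs S) (\<lambda>m. of_bool (\<not> nonsing m S))
    \<le> avg (pairs S) (\<lambda>m. \<Sum>J | J \<subset> S. of_bool (maximal_nonsing m S J))"
  proof (rule avg_mono)
    fix m
    show "of_bool (\<not> nonsing m S) \<le> (\<Sum>J | J \<subset> S. of_bool (maximal_nonsing m S J) :: real)"
    proof (cases "nonsing m S")
      case False
      then obtain J where J: "J \<subset> S" "maximal_nonsing m S J" using exists_maximal_nonsing[OF assms] by blast
      then have "(1::real) = of_bool (maximal_nonsing m S J)" by simp
      also have "\<dots> \<le> (\<Sum>J | J \<subset> S. of_bool (maximal_nonsing m S J))"
        using J fin by (intro member_le_sum) auto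
      finally show ?thesis using False by simp
    qed (simp add: sum_nonneg)
  qed
  then show ?thesis by (simp only: avg_sum)
qed

section \<open>From determinants and matrix counts to sign averages\<close>

lemma det_eq_0_iff_not_nonsing:
  "det (mat n n (\<lambda>(i, j). m {i, j})) = 0 \<longleftrightarrow> \<not> nonsing m {..<n}"
proof -
  let ?A = "mat n n (\<lambda>(i, j). m {i, j})"
  have A: "?A \<in> carrier_mat n n" by simp
  have mv: "?A *\<^sub>v v = 0\<^sub>v n \<longleftrightarrow> (\<forall>i<n. (\<Sum>l<n. m {i, l} * v $ l) = 0)" if "v \<in> carrier_vec n" for v
    using that by (auto simp: vec_eq_iff scalar_prod_def atLeast0LessThan)
  have "det ?A = 0 \<longleftrightarrow> (\<exists>v. v \<in> carrier_vec n \<and> v \<noteq> 0\<^sub>v n \<and> (\<forall>i<n. (\<Sum>l<n. m {i, l} * v $ l) = 0))"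
    unfolding det_0_iff_vec_prod_zero[OF A] using mv by blast
  also have "\<dots> \<longleftrightarrow> \<not> nonsing m {..<n}"
  proof
    assume "\<exists>v. v \<in> carrier_vec n \<and> v \<noteq> 0\<^sub>v n \<and> (\<forall>i<n. (\<Sum>l<n. m {i, l} * v $ l) = 0)"
    then obtain v where v: "v \<in> carrier_vec n" "v \<noteq> 0\<^sub>v n" "\<forall>i<n. (\<Sum>l<n. m {i, l} * v $ l) = 0" by blast
    then obtain i where "i < n" "v $ i \<noteq> 0" by (auto simp: vec_eq_iff)
    then show "\<not> nonsing m {..<n}" using v(3) unfolding nonsing_def by (auto intro!: exI[of _ "\<lambda>i. v $ i"])
  next
    assume "\<not> nonsing m {..<n}"
    then obtain v i where v: "\<forall>i<n. (\<Sum>l<n. m {i, l} * v l) = 0" "i < n" "v i \<noteq> 0"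
      unfolding nonsing_def by auto
    have "vec n v \<noteq> 0\<^sub>v n" using v(2,3) by (metis index_vec index_zero_vec(1))
    moreover have "\<forall>i<n. (\<Sum>l<n. m {i, l} * vec n v $ l) = 0" using v(1) by simp
    ultimately show "\<exists>v. v \<in> carrier_vec n \<and> v \<noteq> 0\<^sub>v n \<and> (\<forall>i<n. (\<Sum>l<n. m {i, l} * v $ l) = 0)"
      by (intro exI[of _ "vec n v"]) auto
  qed
  finally show ?thesis .
qed

text \<open>The inverse reads the upper triangle: an unordered pair becomes the position of its
  minimum and maximum, a singleton a diagonal position.\<close>

lemma bij_betw_sym_sign_mats:
  "bij_betw (\<lambda>m. mat n n (\<lambda>(i, j). m {i, j})) (signs (pairs {..<n})) (sym_sign_mats n)"
proof (rule bij_betw_byWitness[where f' = "\<lambda>A. restrict (\<lambda>e. A $$ (Min e, Max e)) (pairs {..<n})"])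
  have mm: "A $$ (Min {i, j}, Max {i, j}) = A $$ (i, j)"
    if "A \<in> sym_sign_mats n" "i < n" "j < n" for A i j
    using that by (auto simp: sym_sign_mats_def min_def max_def)
  show "\<forall>m\<in>signs (pairs {..<n}). restrict (\<lambda>e. mat n n (\<lambda>(i, j). m {i, j}) $$ (Min e, Max e)) (pairs {..<n}) = m"
  proof
    fix m assume m: "m \<in> signs (pairs {..<n})"
    show "restrict (\<lambda>e. mat n n (\<lambda>(i, j). m {i, j}) $$ (Min e, Max e)) (pairs {..<n}) = m"
    proof (rule extensionalityI[of _ "pairs {..<n}"])
      fix e assume e: "e \<in> pairs {..<n}"
      then obtain i j where ij: "e = {i, j}" "i < n" "j < n" unfolding pairs_def by auto
      have "{min i j, max i j} = {i, j}" by (auto simp: min_def max_def)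
      then show "restrict (\<lambda>e. mat n n (\<lambda>(i, j). m {i, j}) $$ (Min e, Max e)) (pairs {..<n}) e = m e"
        using e ij by simp
    qed (use m in \<open>auto simp: PiE_iff\<close>)
  qed
  show "\<forall>A\<in>sym_sign_mats n. mat n n (\<lambda>(i, j). restrict (\<lambda>e. A $$ (Min e, Max e)) (pairs {..<n}) {i, j}) = A"
  proof
    fix A assume A: "A \<in> sym_sign_mats n"
    show "mat n n (\<lambda>(i, j). restrict (\<lambda>e. A $$ (Min e, Max e)) (pairs {..<n}) {i, j}) = A"
    proof (rule eq_matI)
      fix i j assume "i < dim_row A" "j < dim_col A"
      then have ij: "i < n" "j < n" using A by (auto simp: sym_sign_mats_def)
      then have "{i, j} \<in> pairs {..<n}" by (intro pairsI) auto
      then show "mat n n (\<lambda>(i, j). restrict (\<lambda>e. A $$ (Min e, Max e)) (pairs {..<n}) {i, j}) $$ (i, j) = A $$ (i, j)"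
        using mm[OF A ij] ij by simp
    qed (use A in \<open>auto simp: sym_sign_mats_def\<close>)
  qed
  show "(\<lambda>m. mat n n (\<lambda>(i, j). m {i, j})) ` signs (pairs {..<n}) \<subseteq> sym_sign_mats n"
  proof
    fix A assume "A \<in> (\<lambda>m. mat n n (\<lambda>(i, j). m {i, j})) ` signs (pairs {..<n})"
    then obtain m where m: "m \<in> signs (pairs {..<n})" "A = mat n n (\<lambda>(i, j). m {i, j})" by blast
    have "m {i, j} \<in> {-1, 1}" if "i < n" "j < n" for i j
      using PiE_mem[OF m(1) pairsI[of i "{..<n}" j]] that by simp
    then show "A \<in> sym_sign_mats n" by (simp add: sym_sign_mats_def m(2) insert_commute)
  qed
  show "(\<lambda>A. restrict (\<lambda>e. A $$ (Min e, Max e)) (pairs {..<n})) ` sym_sign_mats n \<subseteq> signs (pairs {..<n})"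
  proof
    fix m assume "m \<in> (\<lambda>A. restrict (\<lambda>e. A $$ (Min e, Max e)) (pairs {..<n})) ` sym_sign_mats n"
    then obtain A where A: "A \<in> sym_sign_mats n" "m = restrict (\<lambda>e. A $$ (Min e, Max e)) (pairs {..<n})" by blast
    show "m \<in> signs (pairs {..<n})"
      unfolding A(2)
    proof
      fix e assume e: "e \<in> pairs {..<n}"
      then obtain i j where ij: "e = {i, j}" "i < n" "j < n" unfolding pairs_def by auto
      have "A $$ (i, j) \<in> {-1, 1}" using A(1) ij by (simp add: sym_sign_mats_def)
      then show "restrict (\<lambda>e. A $$ (Min e, Max e)) (pairs {..<n}) e \<in> {-1, 1}"
        using e mm[OF A(1) ij(2,3)] ij(1) by simp
    qed simp
  qed
qed

lemma prob_singular_eq_avg: "prob_singular n = avg (pairs {..<n}) (\<lambda>m. of_bool (\<not> nonsing m {..<n}))"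
proof -
  let ?f = "\<lambda>m. mat n n (\<lambda>(i, j). m {i, j})"
  have inj: "inj_on ?f (signs (pairs {..<n}))" and img: "?f ` signs (pairs {..<n}) = sym_sign_mats n"
    using bij_betw_sym_sign_mats[of n] by (auto simp: bij_betw_def)
  have "{A \<in> sym_sign_mats n. det A = 0} = ?f ` {m \<in> signs (pairs {..<n}). \<not> nonsing m {..<n}}"
    unfolding img[symmetric] by (auto simp: det_eq_0_iff_not_nonsing)
  then have "card {A \<in> sym_sign_mats n. det A = 0} = card {m \<in> signs (pairs {..<n}). \<not> nonsing m {..<n}}"
    by (simp add: card_image inj_on_subset[OF inj])
  moreover have "card (sym_sign_mats n) = 2 ^ card (pairs {..<n})"
    unfolding img[symmetric] using inj by (simp add: card_image card_signs)
  moreover have "(\<Sum>m\<in>signs (pairs {..<n}). of_bool (\<not> nonsing m {..<n})) = real (card {m \<in> signs (pairs {..<n}). \<not> nonsing m {..<n}})"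
    by (simp add: sum.If_cases of_bool_def Int_def)
  ultimately show ?thesis unfolding prob_singular_def avg_def by simp
qed

section \<open>Primes in long intervals\<close>

text \<open>Leibniz' harmonic triangle: \<open>1 / ((k + 1) C(N, k + 1)) = 1 / (k C(N - 1, k)) - 1 / (k C(N, k))\<close>.\<close>

lemma mult_binomial_dvd_common_multiple:
  fixes d :: nat
  assumes "\<And>i. i \<in> {1..N} \<Longrightarrow> i dvd d" "1 \<le> k" "k \<le> N"
  shows "k * (N choose k) dvd d"
  using assms(2,3,1)
proof (induction k arbitrary: N rule: dec_induct)
  case base
  then show ?case by simp
next
  case (step k)
  define M where "M = N - 1"
  have N: "N = Suc M" using step.prems by (simp add: M_def)
  have kM: "k \<le> M" "1 \<le> k" using step N by auto
  let ?a = "k * (M choose k)" and ?b = "k * (N choose k)" and ?c = "Suc k * (N choose Suc k)"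
  have "?a dvd d" using step.IH[of M] step.prems kM by (auto simp: N)
  then obtain x where x: "d = ?a * x" by blast
  have "?b dvd d" using step.IH[of N] step.prems kM by (auto simp: N)
  then obtain y where y: "d = ?b * y" by blast
  have c: "?c = N * (M choose k)" unfolding N by (rule Suc_times_binomial)
  have "(N - k) * (N choose k) = N * (M choose k)"
    using binomial_absorb_comp[of N k] by (simp add: M_def)
  then have b: "?b * (N - k) = N * ?a" by (simp add: mult_ac)
  have "(N - k) * d = ?b * (N - k) * y" by (simp add: y mult_ac)
  also have "\<dots> = ?a * (N * y)" unfolding b by (simp add: mult_ac)
  finally have "(N - k) * d = ?a * (N * y)" .
  moreover have "(N - k) * d = ?a * ((N - k) * x)" by (simp add: x mult_ac)
  ultimately have "?a * (N * y) = ?a * ((N - k) * x)" by (rule trans[OF sym])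
  moreover have "?a > 0" using kM by simp
  ultimately have eq: "N * y = (N - k) * x" by simp
  obtain j where j: "N = k + j" using kM N by (metis le_SucI le_Suc_ex)
  have "int N * int y = int j * int x" 
    using arg_cong[OF eq, of int] by (simp add: j)
  then have "int N * (int x - int y) = int k * int x"
    unfolding right_diff_distrib by (simp add: j algebra_simps)
  \<comment> \<open>x and y are the quotients of d by ?a and ?b, so by the triangle identity x - y
    is the quotient by ?c.\<close>
  then have "int ?c * (int x - int y) = int d"
    unfolding c by (simp add: x mult_ac)
  then have "int ?c dvd int d" by (metis dvd_triv_left)
  then show ?case by (simp only: int_dvd_int_iff)
qed

text \<open>Without such primes the least common multiple of 1, ..., 2 n is a product of at most M
  prime powers, each at most 2 n. Yet it is a multiple of n C(2 n, n), and C(2 n, n) \<ge> 4^n / (2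
  n).\<close>

lemma exists_prime_between:
  assumes n: "n > 0" and big: "real (2 * n) ^ (M + 1) < 4 ^ n"
  shows "\<exists>p. prime p \<and> M < p \<and> p \<le> 2 * n"
proof (rule ccontr)
  assume neg: "\<not> ?thesis"
  define N where "N = 2 * n"
  have N: "N \<ge> 2" using n by (simp add: N_def)
  define P where "P = {q. prime q \<and> q \<le> N}"
  have finP: "finite P" by (rule finite_subset[of _ "{..N}"]) (auto simp: P_def)
  have PM: "P \<subseteq> {1..M}" 
  proof
    fix q assume "q \<in> P"
    then have q: "prime q" "q \<le> 2 * n" by (auto simp: P_def N_def)
    then have "q \<le> M" using neg by (meson not_le)
    then show "q \<in> {1..M}" using prime_ge_1_nat[OF q(1)] by simp
  qed
  define f where "f q = Max (multiplicity q ` {1..N})" for q :: nat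
  define d where "d = (\<Prod>q\<in>P. q ^ f q)"
  have f_le: "q ^ f q \<le> N" if q: "q \<in> P" for q
  proof -
    have "f q \<in> multiplicity q ` {1..N}" unfolding f_def using N by (intro Max_in) auto
    then obtain i where i: "i \<in> {1..N}" "f q = multiplicity q i" by blast
    have "q ^ multiplicity q i dvd i" by (rule multiplicity_dvd)
    then have "q ^ multiplicity q i \<le> i" using i(1) by (intro dvd_imp_le) auto
    then show ?thesis using i by simp
  qed
  have d0: "d \<noteq> 0" using finP by (auto simp: d_def P_def)
  have "i dvd d" if i: "i \<in> {1..N}" for i
  proof (rule multiplicity_le_imp_dvd)
    show "i \<noteq> 0" using i by auto
    fix q :: nat assume q: "prime q"
    show "multiplicity q i \<le> multiplicity q d"
    proof (cases "q \<in> P")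
      case True
      have "multiplicity q d = f q"
        unfolding d_def using True finP q by (subst multiplicity_prod_prime_powers) (auto simp: P_def)
      then show ?thesis unfolding f_def using i by (simp add: Max_ge)
    next
      case False
      then have "q > i" using q i by (auto simp: P_def)
      then have "\<not> q dvd i" using i by (auto dest: dvd_imp_le)
      then show ?thesis by (simp add: not_dvd_imp_multiplicity_0)
    qed
  qed
  then have "n * (N choose n) dvd d"
    using n by (intro mult_binomial_dvd_common_multiple) (auto simp: N_def)
  then have "n * (N choose n) \<le> d" using d0 by (intro dvd_imp_le) auto
  moreover have "1 * (N choose n) \<le> n * (N choose n)" using n by (intro mult_le_mono1) simp
  ultimately have "N choose n \<le> d" by linarith
  also have "d \<le> (\<Prod>q\<in>P. N)" unfolding d_def by (intro prod_mono) (auto simp: f_le)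
  also have "\<dots> = N ^ card P" by simp
  also have "\<dots> \<le> N ^ M"
    using card_mono[OF _ PM] N by (intro power_increasing) auto
  finally have "real (N choose n) \<le> real N ^ M" by (metis of_nat_le_iff of_nat_power)
  moreover have "4 ^ n / real N \<le> real (N choose n)"
    using central_binomial_lower_bound[OF n] by (simp add: N_def)
  ultimately have "4 ^ n / real N \<le> real N ^ M" by linarith
  then have "4 ^ n \<le> real N ^ M * real N" using N by (simp add: pos_divide_le_eq)
  then show False using big by (simp add: N_def mult.commute)
qed

section \<open>Choice of parameters\<close>

lemma power_le_exp:
  fixes a :: real
  assumes "0 \<le> a" "a \<le> exp b" "real k \<le> c" "0 \<le> b"
  shows "a ^ k \<le> exp (c * b)"
proof -
  have "a ^ k \<le> exp b ^ k" using assms by (intro power_mono)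
  also have "\<dots> = exp (real k * b)" by (simp add: exp_of_nat_mult)
  also have "\<dots> \<le> exp (c * b)" using assms by (simp add: mult_right_mono)
  finally show ?thesis .
qed

lemma power_le_exp_neg:
  fixes a :: real
  assumes "0 \<le> a" "a \<le> exp b" "c \<le> real k" "b \<le> 0"
  shows "a ^ k \<le> exp (c * b)"
proof -
  have "a ^ k \<le> exp b ^ k" using assms by (intro power_mono)
  also have "\<dots> = exp (real k * b)" by (simp add: exp_of_nat_mult)
  also have "\<dots> \<le> exp (c * b)" using assms by (simp add: mult_right_mono_neg)
  finally show ?thesis .
qed

lemma exp_quarter_le: "exp (1/4) \<le> (4/3 :: real)"
  using exp_ge_add_one_self[of "-1/4 :: real"] by (simp add: exp_minus field_simps)

text \<open>\<open>C1\<close> and \<open>C2\<close> make s large enough for the counting.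
  \<open>C3\<close> and \<open>C4\<close> treat the logarithms of the two terms of p *
  \<open>bad_bound\<close>, the -1 leaving room for a factor 2. In \<open>C4\<close> the entropy of
  the codes is about 64 n ln n / 10^6 and the gain about n ln n / 8.\<close>

locale large_n =
  fixes n p :: nat
  assumes p: "prime p" "odd p" "exp (sqrt n / 4000) \<le> real p" "real p \<le> exp (sqrt n / 1000)"
    and C1: "10240\<^sup>2 + 1 \<le> sqrt n"
    and C2: "64 * (4 * (sqrt n / 1000 + 1) + 1) \<le> sqrt n - 1"
    and C3: "(2 * sqrt n + 1) * (sqrt n / 1000) + sqrt n * ln (real n + 1) - (real n / 2 - 1) / 4 \<le> - sqrt n - 1"
    and C4: "(2 * sqrt n + 1) * (sqrt n / 1000) + 5 * real n
        + (4 * ln n + 1) * (ln (4 * (sqrt n / 1000 + 1) + 1) + (16 * sqrt n / 1000 + 1) * (sqrt n / 1000))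
        + (real n / 2 - sqrt n) * (ln 10240 - ln (sqrt n - 1) / 2) \<le> - sqrt n - 1"
begin

text \<open>This number plays two parts: the size up to which supports are enumerated and the number
  of resampled coordinates.\<close>

definition s :: nat where "s = nat \<lfloor>sqrt n\<rfloor>"
definition T :: nat where "T = nat \<lceil>4 * (sqrt n / 1000 + 1)\<rceil>"
definition r :: nat where "r = nat \<lfloor>16 * sqrt n / 1000\<rfloor> + 1"
definition K :: nat where "K = nat \<lceil>4 * ln n\<rceil>"

lemma x_ge: "10240\<^sup>2 \<le> sqrt n - 1" using C1 by simp

lemma n_pos: "n > 0" using C1 by (cases n) auto

lemma s_bounds: "sqrt n - 1 \<le> real s" "real s \<le> sqrt n"
proof -
  have "0 \<le> \<lfloor>sqrt n\<rfloor>" by simp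
  then have "real s = of_int \<lfloor>sqrt n\<rfloor>" unfolding s_def by (rule of_nat_nat)
  then show "sqrt n - 1 \<le> real s" "real s \<le> sqrt n" by linarith+
qed

lemma T_bounds: "4 * (sqrt n / 1000 + 1) \<le> real T" "real T \<le> 4 * (sqrt n / 1000 + 1) + 1"
proof -
  have "0 \<le> 4 * (sqrt n / 1000 + 1)" by simp
  then have "0 \<le> \<lceil>4 * (sqrt n / 1000 + 1)\<rceil>" by linarith
  then have "real T = of_int \<lceil>4 * (sqrt n / 1000 + 1)\<rceil>" unfolding T_def by (rule of_nat_nat)
  then show "4 * (sqrt n / 1000 + 1) \<le> real T" "real T \<le> 4 * (sqrt n / 1000 + 1) + 1" by linarith+
qed

lemma r_bounds: "16 * sqrt n / 1000 < real r" "real r \<le> 16 * sqrt n / 1000 + 1"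
proof -
  have "0 \<le> \<lfloor>16 * sqrt n / 1000\<rfloor>" by simp
  then have "real r = of_int \<lfloor>16 * sqrt n / 1000\<rfloor> + 1" by (simp add: r_def)
  then show "16 * sqrt n / 1000 < real r" "real r \<le> 16 * sqrt n / 1000 + 1" by linarith+
qed

lemma K_bounds: "4 * ln n \<le> real K" "real K \<le> 4 * ln n + 1"
proof -
  have "0 \<le> 4 * ln (real n)" using n_pos by simp
  then have "real K = of_int \<lceil>4 * ln n\<rceil>" by (simp add: K_def)
  then show "4 * ln n \<le> real K" "real K \<le> 4 * ln n + 1" by linarith+
qed

lemma ln_p: "ln (real p) \<le> sqrt n / 1000"
proof -
  have "ln (real p) \<le> ln (exp (sqrt n / 1000))"
    using p(1,4) by (intro ln_mono) (auto simp: prime_gt_0_nat)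
  then show ?thesis by simp
qed

text \<open>\<beta> = 200 / p is the smallest threshold allowed, so unstructured vectors concentrate
  with probability O(1 / p).\<close>

sublocale lo_setup p r T s "200 / real p"
proof
  show "prime p" "odd p" by (rule p)+
  show "16 * ln (real p) < real r" using ln_p r_bounds(1) by simp
  show "4 * (ln (real p) + 1) \<le> real T" using ln_p T_bounds(1) by simp
  have "real (64 * T) \<le> real s" using T_bounds(2) s_bounds(1) C2 by simp
  then show "64 * T \<le> s" by (simp only: of_nat_le_iff)
  have "real (10240\<^sup>2) \<le> real s" using s_bounds(1) x_ge by simp
  then show "10240\<^sup>2 \<le> s" by (simp only: of_nat_le_iff)
  show "200 \<le> real p * (200 / real p)" using p(1) by (simp add: prime_gt_0_nat)
qed

text \<open>As 4/3 \<ge> exp (1/4), about 4 ln n rounds of shrinking by 3/4 exhaust any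
  support.\<close>

lemma n_le_K: "real n \<le> real s * (4/3) ^ K"
proof -
  have "real n = exp (4 * ln n * (1/4))" using n_pos by simp
  also have "\<dots> \<le> exp (real K * (1/4))" using K_bounds(1) by simp
  also have "\<dots> = exp (1/4) ^ K" by (rule exp_of_nat_mult)
  also have "\<dots> \<le> 1 * (4/3) ^ K" using exp_quarter_le by (simp add: power_mono)
  also have "\<dots> \<le> real s * (4/3) ^ K" using s_bounds(1) x_ge by (intro mult_right_mono) auto
  finally show ?thesis .
qed

lemma p_bad_bound_le:
  assumes m: "real n / 2 \<le> real m" "m \<le> n"
  shows "real p * bad_bound s m K \<le> exp (- sqrt n)"
proof -
  let ?x = "sqrt (real n)"
  let ?L = "?x / 1000"
  let ?EN = "ln (4 * (?x / 1000 + 1) + 1) + (16 * ?x / 1000 + 1) * ?L"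
  let ?g = "ln 10240 - ln (?x - 1) / 2"
  have x0: "0 \<le> ?x" by simp
  have p0: "0 < real p" using p_pos by simp
  have m1: "real m - 1 \<le> real (m - 1)" by simp
  \<comment> \<open>One p for the line parameter c, p^s for the values on U and p^s for the
    enumerated supports.\<close>
  have pp: "real p ^ (s + s + 1) \<le> exp ((2 * ?x + 1) * ?L)"
    using s_bounds(2) p(4) by (intro power_le_exp) auto
  have t1: "(real m + 1) ^ s \<le> exp (?x * ln (real n + 1))"
    using s_bounds(2) m(2) by (intro power_le_exp) auto
  have t2: "(3/4 :: real) ^ (m - 1) \<le> exp ((real n / 2 - 1) * (- (1/4)))"
    using m m1 exp_ge_add_one_self[of "- (1/4) :: real"] by (intro power_le_exp_neg) auto
  have t3: "(2::real) ^ (5 * m) \<le> exp (5 * real n * 1)"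
    using m exp_ge_add_one_self[of "1 :: real"] by (intro power_le_exp) auto
  have EN0: "0 \<le> ?EN" using x0 by (intro add_nonneg_nonneg mult_nonneg_nonneg ln_ge_zero) auto
  have "real N \<le> exp ?EN"
  proof -
    have "real T \<le> exp (ln (4 * (?x / 1000 + 1) + 1))"
    proof -
      have "0 < 4 * (?x / 1000 + 1) + 1"
        by (intro add_nonneg_pos mult_nonneg_nonneg add_nonneg_nonneg) auto
      then show ?thesis using T_bounds(2) by simp
    qed
    moreover have "real p ^ r \<le> exp ((16 * ?x / 1000 + 1) * ?L)"
      using r_bounds(2) p(4) by (intro power_le_exp) auto
    ultimately have "real T * real p ^ r \<le> exp (ln (4 * (?x / 1000 + 1) + 1)) * exp ((16 * ?x / 1000 + 1) * ?L)"
      by (intro mult_mono) auto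
    then show ?thesis by (simp add: N_def exp_add)
  qed
  then have t4: "real N ^ K \<le> exp ((4 * ln n + 1) * ?EN)"
    using K_bounds(2) EN0 by (intro power_le_exp) auto
  have xb: "0 < ?x - 1" using x_ge by (rule less_le_trans[rotated]) simp
  have g0: "?g \<le> 0"
  proof -
    have "ln (10240\<^sup>2) \<le> ln (?x - 1)" using x_ge xb by (intro ln_mono) auto
    moreover have "ln ((10240::real)\<^sup>2) = 2 * ln 10240" using ln_realpow[of "10240::real" 2] by simp
    ultimately show ?thesis by linarith
  qed
  have t5: "\<gamma> ^ m / \<gamma> ^ s \<le> exp ((real n / 2 - ?x) * ?g)"
  proof -
    have sp: "0 < real s" using s_bounds(1) xb by linarith
    have "\<gamma> = exp (ln 10240 - ln (real s) / 2)"
      using sp by (simp add: \<gamma>_def exp_diff ln_sqrt[symmetric])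
    also have "\<dots> \<le> exp ?g"
    proof -
      have "ln (?x - 1) \<le> ln (real s)" using s_bounds(1) xb by (intro ln_mono)
      then have "ln 10240 - ln (real s) / 2 \<le> ?g" by simp
      then show ?thesis by (rule exp_le_cancel_iff[THEN iffD2])
    qed
    finally have \<gamma>: "\<gamma> \<le> exp ?g" .
    have "s \<le> m"
    proof -
      have "2 * ?x \<le> ?x * ?x" using x_ge by (intro mult_right_mono) auto
      then have "real s \<le> real m" using s_bounds(2) m(1) by simp
      then show ?thesis by simp
    qed
    then have "\<gamma> ^ m / \<gamma> ^ s = \<gamma> ^ (m - s)" using \<gamma>_pos by (simp add: power_diff)
    also have "\<dots> \<le> exp ((real n / 2 - ?x) * ?g)"
      using \<gamma> \<gamma>_pos g0 \<open>s \<le> m\<close> s_bounds(2) m(1) by (intro power_le_exp_neg) (auto simp: of_nat_diff)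
    finally show ?thesis .
  qed
  have eq: "real p * bad_bound s m K = real p ^ (s + s + 1) * ((real m + 1) ^ s * (3/4) ^ (m - 1))
      + real p ^ (s + s + 1) * (2 ^ (5 * m) * (real N ^ K * (\<gamma> ^ m / \<gamma> ^ s)))"
  proof -
    have "(2::real) ^ (5 * m) = 2 ^ m * 2 ^ (4 * m)" by (simp add: power_add[symmetric])
    then show ?thesis unfolding bad_bound_def by (simp add: power_add distrib_left mult_ac)
  qed
  have "real p ^ (s + s + 1) * ((real m + 1) ^ s * (3/4) ^ (m - 1))
      \<le> exp ((2 * ?x + 1) * ?L) * (exp (?x * ln (real n + 1)) * exp ((real n / 2 - 1) * (- (1/4))))"
    by (intro mult_mono pp t1 t2) auto
  also have "\<dots> = exp ((2 * ?x + 1) * ?L + ?x * ln (real n + 1) - (real n / 2 - 1) / 4)"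
    unfolding exp_add[symmetric] by (intro arg_cong[of _ _ exp]) (simp add: algebra_simps diff_divide_distrib)
  also have "\<dots> \<le> exp (- ?x - 1)" using C3 by simp
  finally have 1: "real p ^ (s + s + 1) * ((real m + 1) ^ s * (3/4) ^ (m - 1)) \<le> exp (- ?x - 1)" .
  have "real p ^ (s + s + 1) * (2 ^ (5 * m) * (real N ^ K * (\<gamma> ^ m / \<gamma> ^ s)))
      \<le> exp ((2 * ?x + 1) * ?L) * (exp (5 * real n * 1) * (exp ((4 * ln n + 1) * ?EN) * exp ((real n / 2 - ?x) * ?g)))"
    using \<gamma>_pos by (intro mult_mono pp t3 t4 t5) auto
  also have "\<dots> = exp ((2 * ?x + 1) * ?L + 5 * real n + (4 * ln n + 1) * ?EN + (real n / 2 - ?x) * ?g)"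
    unfolding exp_add[symmetric] by (simp only: mult_1_right add.assoc)
  also have "\<dots> \<le> exp (- ?x - 1)" using C4 by simp
  finally have 2: "real p ^ (s + s + 1) * (2 ^ (5 * m) * (real N ^ K * (\<gamma> ^ m / \<gamma> ^ s))) \<le> exp (- ?x - 1)" .
  have "2 * exp (- ?x - 1) \<le> exp 1 * exp (- ?x - 1)"
    using exp_ge_add_one_self[of "1 :: real"] by (intro mult_right_mono) auto
  also have "\<dots> = exp (- ?x)" by (simp add: exp_add[symmetric])
  finally show ?thesis unfolding eq using 1 2 by simp
qed

lemma avg_quad_insert_le_exp:
  assumes J: "finite J" "real n / 2 \<le> real (card J)" "card J \<le> n" and j: "j \<notin> J"
  shows "avg (pairs (insert j J)) (\<lambda>m. of_bool (nonsing m J \<and> quad m J (\<lambda>l. m {j, l}) (m {j})))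
    \<le> 15 * exp (- sqrt n / 8000)"
proof -
  let ?x = "sqrt (real n)"
  have x2: "2 \<le> ?x" using x_ge by simp
  have "2 * ?x \<le> ?x * ?x" using x2 by (intro mult_right_mono) auto
  then have "real s \<le> real (card J)" using s_bounds(2) J(2) by simp
  then have "s \<le> card J" by simp
  then obtain U where U: "U \<subseteq> J" "card U = s" using obtain_subset_with_card_n by metis
  have "real (card J) \<le> real s * (4/3) ^ K" using n_le_K J(3) by (meson of_nat_le_iff order_trans)
  from avg_quad_insert_le[OF J(1) U(1) this j]
  have "avg (pairs (insert j J)) (\<lambda>m. of_bool (nonsing m J \<and> quad m J (\<lambda>l. m {j, l}) (m {j})))
      \<le> sqrt (1 / 2 ^ s + 200 / real p + real p * bad_bound s (card J) K)" by (simp add: U)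
  \<comment> \<open>The three terms contribute 1, 200 and 1 times the exponential; 225 is the next
    perfect square. The root halves the rate to 1/8000.\<close>
  also have "\<dots> \<le> sqrt (225 * exp (- ?x / 4000))"
  proof (rule real_sqrt_le_mono)
    have "exp (1/2) \<le> (2::real)"
      using exp_ge_add_one_self[of "-1/2 :: real"] by (simp add: exp_minus field_simps)
    then have "exp (1/2) ^ s \<le> (2::real) ^ s" by (intro power_mono) auto
    then have "exp (real s * (1/2)) \<le> 2 ^ s" unfolding exp_of_nat_mult .
    moreover have "exp (?x / 4000) \<le> exp (real s * (1/2))" using s_bounds(1) x2 by simp
    ultimately have "exp (?x / 4000) \<le> 2 ^ s" by linarith
    then have 1: "1 / 2 ^ s \<le> exp (- ?x / 4000)" by (simp add: exp_minus field_simps)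
    have 2: "200 / real p \<le> 200 * exp (- ?x / 4000)"
      using p(3) p_pos by (simp add: exp_minus field_simps)
    have "real p * bad_bound s (card J) K \<le> exp (- ?x)" by (rule p_bad_bound_le[OF J(2,3)])
    also have "\<dots> \<le> exp (- ?x / 4000)" by simp
    finally show "1 / 2 ^ s + 200 / real p + real p * bad_bound s (card J) K \<le> 225 * exp (- ?x / 4000)"
      using 1 2 exp_gt_zero[of "- ?x / 4000"] by linarith
  qed
  also have "\<dots> = 15 * exp (- ?x / 8000)"
  proof -
    have "225 * exp (- ?x / 4000) = (15 * exp (- ?x / 8000))\<^sup>2"
      by (simp add: power_mult_distrib exp_double[symmetric])
    then show ?thesis by (simp only: real_sqrt_abs abs_of_nonneg) simp
  qed
  finally show ?thesis .
qed

end

text \<open>The interval runs from some X to X^4, so a crude existence bound is enough: M lies just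
  above X and 2 h just below X^4, and 4^h far exceeds (2 h)^(M + 1).\<close>

lemma eventually_exists_prime:
  "\<forall>\<^sub>F n in sequentially. \<exists>p. prime p \<and> odd p \<and> exp (sqrt (real n) / 4000) \<le> real p \<and> real p \<le> exp (sqrt (real n) / 1000)"
proof -
  have "\<forall>\<^sub>F n in sequentially. (exp (sqrt (real n) / 4000) + 2) * (sqrt (real n) / 1000)
      < (exp (sqrt (real n) / 1000) / 2 - 1) * ln 4" by real_asymp
  moreover have "\<forall>\<^sub>F n in sequentially. exp (sqrt (real n) / 4000) \<ge> 3" by real_asymp
  ultimately show ?thesis
  proof eventually_elim
    case (elim n)
    let ?x = "sqrt (real n)"
    define h where "h = nat \<lfloor>exp (?x / 1000) / 2\<rfloor>"
    define M where "M = nat \<lfloor>exp (?x / 4000)\<rfloor> + 1"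
    have h: "real h \<le> exp (?x / 1000) / 2" "exp (?x / 1000) / 2 - 1 < real h"
      by (simp_all add: h_def) linarith+
    have M: "exp (?x / 4000) \<le> real M" "real M \<le> exp (?x / 4000) + 1"
      by (simp_all add: M_def) linarith+
    have "exp (?x / 1000) \<ge> exp (?x / 4000)" by simp
    then have "real h > 0" using h(2) elim(2) by linarith
    then have h0: "h > 0" by simp
    have "ln (real (2 * h)) \<le> ln (exp (?x / 1000))" using h h0 by (intro ln_mono) auto
    then have lnh: "ln (real (2 * h)) \<le> ?x / 1000" by simp
    have "real (M + 1) * ln (real (2 * h)) \<le> (exp (?x / 4000) + 2) * (?x / 1000)"
      using M lnh h0 by (intro mult_mono) auto
    also have "\<dots> < (exp (?x / 1000) / 2 - 1) * ln 4" by (rule elim(1))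
    also have "\<dots> \<le> real h * ln 4" using h by (intro mult_right_mono) auto
    finally have lt: "real (M + 1) * ln (real (2 * h)) < real h * ln 4" .
    have "real (2 * h) ^ (M + 1) = exp (real (M + 1) * ln (real (2 * h)))"
      using h0 by (simp only: exp_of_nat_mult) simp
    also have "\<dots> < exp (real h * ln 4)" using lt by simp
    also have "\<dots> = 4 ^ h" by (simp only: exp_of_nat_mult) simp
    finally obtain p where p: "prime p" "M < p" "p \<le> 2 * h" using exists_prime_between[OF h0] by blast
    have "real p > 3" using p(2) M(1) elim(2) by linarith
    then have "odd p" using p(1) prime_odd_nat[of p] by simp
    moreover have "exp (?x / 4000) \<le> real p" using p(2) M(1) by linarith
    moreover have "real p \<le> exp (?x / 1000)" using p(3) h(1) by linarith
    ultimately show ?case using p(1) by blast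
  qed
qed

lemma eventually_large_n: "\<forall>\<^sub>F n in sequentially. \<exists>p. large_n n p"
proof -
  have "\<forall>\<^sub>F n in sequentially. 10240\<^sup>2 + 1 \<le> sqrt (real n)" by real_asymp
  moreover have "\<forall>\<^sub>F n in sequentially. 64 * (4 * (sqrt (real n) / 1000 + 1) + 1) \<le> sqrt (real n) - 1" by real_asymp
  moreover have "\<forall>\<^sub>F n in sequentially. (2 * sqrt (real n) + 1) * (sqrt (real n) / 1000) + sqrt (real n) * ln (real n + 1)
      - (real n / 2 - 1) / 4 \<le> - sqrt (real n) - 1" by real_asymp
  moreover have "\<forall>\<^sub>F n in sequentially. (2 * sqrt (real n) + 1) * (sqrt (real n) / 1000) + 5 * real n
        + (4 * ln (real n) + 1) * (ln (4 * (sqrt (real n) / 1000 + 1) + 1) + (16 * sqrt (real n) / 1000 + 1) * (sqrt (real n) / 1000))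
        + (real n / 2 - sqrt (real n)) * (ln 10240 - ln (sqrt (real n) - 1) / 2) \<le> - sqrt (real n) - 1"
    by real_asymp
  ultimately show ?thesis
    using eventually_exists_prime by eventually_elim (auto simp: large_n_def)
qed

context large_n
begin

text \<open>Weighting a set \<open>J\<close> by \<open>n ^ - (n - card J)\<close> makes the sum over all \<open>J\<close> at most \<open>(1 + 1 / n) ^ n \<le> 3\<close>.\<close>

lemma prob_singular_le:
  fixes \<kappa> :: real
  assumes \<kappa>: "0 \<le> \<kappa>" "\<kappa> \<le> real n / 2" "8 * ln n \<le> \<kappa>" "sqrt n \<le> \<kappa>\<^sup>2"
  shows "prob_singular n \<le> 45 * exp (\<kappa> * ln n - sqrt n / 8000)"
proof -
  define B where "B = 15 * exp (\<kappa> * ln n - sqrt n / 8000)"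
  let ?S = "{..<n}"
  let ?f = "\<lambda>J. avg (pairs ?S) (\<lambda>m. of_bool (maximal_nonsing m ?S J))"
  have n0: "real n > 0" using n_pos by simp
  have lnn: "0 \<le> ln (real n)" using n_pos by simp
  have bound: "?f J \<le> B * (1 / real n) ^ card (?S - J)" if J: "J \<subset> ?S" for J
  proof -
    define k where "k = card (?S - J)"
    have finJ: "finite J" using J finite_subset by blast
    have ck: "card J + k = n" unfolding k_def using J finJ
      by (simp add: card_Diff_subset card_mono[of ?S J, simplified] psubset_imp_subset)
    have pow: "real n ^ k = exp (real k * ln n)" using n0 by (simp only: exp_of_nat_mult) simp
    have "?f J * real n ^ k \<le> B"
    proof (cases "real k \<le> \<kappa>")
      case True
      obtain j where j: "j \<in> ?S - J" using J by blast
      have "?f J \<le> avg (pairs (insert j J)) (\<lambda>m. of_bool (nonsing m J \<and> quad m J (\<lambda>l. m {j, l}) (m {j})))"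
        using J j by (intro avg_maximal_nonsing_le_quad) auto
      also have "\<dots> \<le> 15 * exp (- sqrt n / 8000)"
      proof (rule avg_quad_insert_le_exp[OF finJ])
        have "real (card J) + real k = real n" using ck by (simp flip: of_nat_add)
        then show "real n / 2 \<le> real (card J)" using True \<kappa>(2) by linarith
      qed (use ck j in auto)
      finally have "?f J * real n ^ k \<le> 15 * exp (- sqrt n / 8000) * exp (\<kappa> * ln n)"
        unfolding pow using True lnn by (intro mult_mono) (auto intro: mult_right_mono)
      also have "\<dots> = B" by (simp add: B_def exp_add[symmetric])
      finally show ?thesis .
    next
      case False
      \<comment> \<open>8 ln n \<le> \<kappa> < k keeps k ln n below k^2 / 8, and sqrt n \<le>
        \<kappa>^2 keeps sqrt n / 8 below the same amount. So the roughly k^2 / 2 determined entries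
        outweigh n^k.\<close>
      have e: "real k * ln n + sqrt n / 8 \<le> real k * real k / 4"
      proof -
        have lin: "a + x / 8 \<le> c / 4" if "8 * a \<le> b" "b \<le> c" "x \<le> d" "d \<le> b" for a b c d x :: real
          using that by linarith
        show ?thesis
        proof (rule lin)
          show "8 * (real k * ln n) \<le> real k * \<kappa>"
            using mult_left_mono[OF \<kappa>(3), of "real k"] by (simp add: mult_ac)
          show "real k * \<kappa> \<le> real k * real k" "\<kappa> * \<kappa> \<le> real k * \<kappa>"
            using False \<kappa>(1) by (auto intro: mult_left_mono mult_right_mono)
          show "sqrt n \<le> \<kappa> * \<kappa>" using \<kappa>(4) by (simp add: power2_eq_square)
        qed
      qed
      have "2 * card (pairs (?S - J)) = k * (k + 1)" unfolding k_def by (rule card_pairs) simp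
      then have "2 * real (card (pairs (?S - J))) = real k * (real k + 1)"
        by (metis of_nat_1 of_nat_add of_nat_mult of_nat_numeral)
      then have "real k * real k / 4 \<le> real (card (pairs (?S - J))) * (1/2)" by (simp add: algebra_simps)
      then have "exp (real k * real k / 4) \<le> exp (real (card (pairs (?S - J))) * (1/2))" by simp
      also have "\<dots> = exp (1/2) ^ card (pairs (?S - J))" by (rule exp_of_nat_mult)
      also have "\<dots> \<le> 2 ^ card (pairs (?S - J))"
        using exp_ge_add_one_self[of "-1/2 :: real"] by (intro power_mono) (auto simp: exp_minus field_simps)
      finally have "1 / 2 ^ card (pairs (?S - J)) \<le> exp (- (real k * real k / 4))"
        by (simp add: exp_minus field_simps)
      then have "?f J \<le> exp (- (real k * real k / 4))"
        using avg_maximal_nonsing_le_power[of ?S J] J by (meson finite_lessThan order_trans psubset_imp_subset)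
      then have "?f J * real n ^ k \<le> exp (- (real k * real k / 4)) * exp (real k * ln n)"
        unfolding pow by (intro mult_right_mono) auto
      also have "\<dots> = exp (real k * ln n - real k * real k / 4)" by (simp add: exp_add[symmetric])
      also have "\<dots> \<le> 1 * exp (\<kappa> * ln n - sqrt n / 8000)"
      proof -
        have "0 \<le> \<kappa> * ln n" using \<kappa>(1) lnn by simp
        moreover have "0 \<le> sqrt (real n)" by simp
        ultimately have "real k * ln n - real k * real k / 4 \<le> \<kappa> * ln n - sqrt n / 8000" using e by argo
        then show ?thesis by simp
      qed
      also have "\<dots> \<le> B" unfolding B_def by (intro mult_right_mono) auto
      finally show ?thesis .
    qed
    then show ?thesis unfolding k_def[symmetric] using n0 by (simp add: power_one_over field_simps)
  qed
  have "prob_singular n \<le> (\<Sum>J | J \<subset> ?S. ?f J)"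
    unfolding prob_singular_eq_avg by (rule avg_singular_le) simp
  also have "\<dots> \<le> (\<Sum>J | J \<subset> ?S. B * (1 / real n) ^ card (?S - J))"
    by (intro sum_mono bound) simp
  also have "\<dots> \<le> (\<Sum>J\<in>Pow ?S. B * (1 / real n) ^ card (?S - J))"
    by (intro sum_mono2) (auto simp: B_def)
  also have "\<dots> = B * (\<Sum>J\<in>Pow ?S. (\<Prod>i\<in>J. 1) * (\<Prod>i\<in>?S - J. 1 / real n))"
    by (simp add: sum_distrib_left)
  also have "(\<Sum>J\<in>Pow ?S. (\<Prod>i\<in>J. 1) * (\<Prod>i\<in>?S - J. 1 / real n)) = (\<Prod>i\<in>?S. 1 + 1 / real n)"
    by (rule prod_add[symmetric]) simp
  also have "\<dots> \<le> 3"
  proof -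
    have "(1 + 1 / real n) ^ n \<le> exp (1 / real n) ^ n" by (intro power_mono exp_ge_add_one_self) simp
    also have "\<dots> = exp 1" using n0 by (simp add: exp_of_nat_mult[symmetric])
    also have "\<dots> \<le> 3" by (rule exp_le)
    finally show ?thesis by simp
  qed
  finally show ?thesis by (simp add: B_def mult_left_mono)
qed

end

theorem theorem1p1:
  shows "\<exists>c>0. \<forall>\<^sub>F n in sequentially. prob_singular n \<le> exp (- c * sqrt (real n))"
proof (intro exI[of _ "1/16000"] conjI)
  \<comment> \<open>The exponent of \<kappa> must be at least 1/4 for \<kappa>^2 to reach sqrt n,
    and below 1/2 for \<kappa> ln n to be negligible. Halving 1/8000 absorbs \<kappa> ln n and the
    factor 45.\<close>
  have "\<forall>\<^sub>F n in sequentially. real n powr (1/3) \<le> real n / 2" by real_asymp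
  moreover have "\<forall>\<^sub>F n in sequentially. 8 * ln (real n) \<le> real n powr (1/3)" by real_asymp
  moreover have "\<forall>\<^sub>F n in sequentially. sqrt (real n) \<le> (real n powr (1/3))\<^sup>2" by real_asymp
  moreover have "\<forall>\<^sub>F n in sequentially. 45 * exp (real n powr (1/3) * ln (real n) - sqrt (real n) / 8000)
      \<le> exp (- (1/16000) * sqrt (real n))" by real_asymp
  ultimately show "\<forall>\<^sub>F n in sequentially. prob_singular n \<le> exp (- (1/16000) * sqrt (real n))"
    using eventually_large_n
  proof eventually_elim
    case (elim n)
    then obtain p where "large_n n p" by blast
    then interpret large_n n p .
    show ?case using prob_singular_le[of "real n powr (1/3)"] elim(1-4) by simp
  qed
qed simp

end
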